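(* Let $d\ge 1$, $R>0$, let $b=(b_l)_{l\in\mathbb{N}_*^d}$ be a mildly or severely ill-posed sequence and let $a=(a_l)_{l\in\mathbb{N}_*^d}$ be of Sobolev or tensor product type (notions defined in the context). Consider, in the model $y_l=b_l\theta_l+\epsilon\xi_l$, $l\in\mathbb{N}_*^d$, the problem of testing $H_0:\theta=0$ against $H_{1,r_\epsilon}:\theta\in\Theta_{a,R}(r_\epsilon)$, where $r_\epsilon>0$ is a radius allowed to depend on $\epsilon$, and the tests $\Psi_{\epsilon,t}$ defined in the context. Then, given $\alpha\in(0,1)$: 1. (a) If $u_\epsilon(r_\epsilon)\to 0$, then $\beta_\epsilon(\Theta_{a,R}(r_\epsilon),\alpha)\to 1-\alpha$ as $\epsilon\to 0$. In this case, minimax testing is impossible. (b) If $u_\epsilon(r_\epsilon)=\mathcal{O}(1)$ and $\omega_0=o(1)$ as $\epsilon\to0$, then the test $\Psi_{\epsilon,H^{(\alpha)}}$ is a level-$\alpha$ test and is asymptotically minimax, i.e. $$\beta_\epsilon(\Theta_{a,R}(r_\epsilon),\Psi_{\epsilon,H^{(\alpha)}})=\beta_\epsilon(\Theta_{a,R}(r_\epsilon),\alpha)+o(1)\quad\text{as }\epsilon\to0.$$ Moreover, one has the sharp asymptotics $$\beta_\epsilon(\Theta_{a,R}(r_\epsilon),\alpha)=\Phi\big(H^{(\alpha)}-u_\epsilon(r_\epsilon)\big)+o(1)\quad\text{as }\epsilon\to0.$$ 2. If $u_\epsilon(r_\epsilon)\to+\infty$, then the family of tests $\Psi_{\epsilon,t}$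 with $t=c\,u_\epsilon(r_\epsilon)$ for some $c\in(0,1)$ is asymptotically consistent, i.e. $\beta_\epsilon(\Theta_{a,R}(r_\epsilon),\Psi_{\epsilon,t})\to0$ as $\epsilon\to0$.
   Context: $\mathbb{N}_*=\{1,2,3,\dots\}$. For a noise level $\epsilon>0$ one observes $y=(y_l)_{l\in\mathbb{N}_*^d}$, $y_l=b_l\theta_l+\epsilon\xi_l$, where the $\xi_l$ are i.i.d. standard Gaussian, $b=(b_l)$ is a known sequence of non-zero reals and $\theta\in\ell^2(\mathbb{N}_*^d)$ is unknown. $\mathbb{P}_\theta$ is the law of $y$; $\mathbb{P}_0$ corresponds to $\theta=0$. $\|\cdot\|$ is the $\ell^2$ norm. The quantities $d,\alpha,R,a,b$ do not depend on $\epsilon$. The sequence $b$ is mildly ill-posed if there are $0<c_0\le c_1$ and $(t_1,\dots,t_d)$ with $t_j\ge0$ such that $c_0\prod_j l_j^{-t_j}\le|b_l|\le c_1\prod_j l_j^{-t_j}$ for all $l\in\mathbb{N}_*^d$; it is severely ill-posed if the same holds with $\prod_j e^{-t_jl_j}$ in place of $\prod_j l_j^{-t_j}$. The positive sequence $a$ is of Sobolev type if, for some $s_1,\dots,s_d>0$, $a_l^2=\sum_j l_j^{2s_j}$ for all $l$, or $a_l^2=\sum_j e^{2s_jl_j}$ for all $l$; it is of tensor product type if $a_l^2=\prod_j l_j^{2s_j}$ for all $l$, or $a_l^2=\prod_j e^{2s_jl_j}$ for all $l$. $\Theta_{a,R}=\{\theta\in\ell^2(\mathbb{N}_*^d):\sum_l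 a_l^2\theta_l^2\le R^2\}$ and $\Theta_{a,R}(r)=\{\theta\in\Theta_{a,R}:\|\theta\|\ge r\}$. A test $\psi$ is a measurable function of the data with values in $\{0,1\}$ ($\psi=1$ means rejection of $H_0$). A level-$\alpha$ test is a test function $\psi_\alpha$ (which may depend on $\epsilon$) satisfying $\mathbb{P}_0(\psi_\alpha=1)\le\alpha+o(1)$ as $\epsilon\to0$. The maximal type II error is $\beta_\epsilon(\Theta_{a,R}(r_\epsilon),\psi)=\sup_{\theta\in\Theta_{a,R}(r_\epsilon)}\mathbb{P}_\theta(\psi=0)$, and the minimax type II error is $\beta_\epsilon(\Theta_{a,R}(r_\epsilon),\alpha)=\inf_{\psi_\alpha}\beta_\epsilon(\Theta_{a,R}(r_\epsilon),\psi_\alpha)$, the infimum being over all level-$\alpha$ tests. Extremal problem: $u_\epsilon^2(r_\epsilon)=\frac{1}{2\epsilon^4}\inf_{\theta\in\Theta_{a,R}(r_\epsilon)}\sum_k b_k^4\theta_k^4=\frac1{2\epsilon^4}\sum_k b_k^4\tilde\theta_k^4$, where $\tilde\theta=(\tilde\theta_k)$ is the solution, and $u_\epsilon(r_\epsilon)\ge0$. Filter: $\omega_k=b_k^2\tilde\theta_k^2\big/\sqrt{2\sum_{m}b_m^4\tilde\theta_m^4}$ for $k\in\mathbb{N}_*^d$, and $\omega_0=\sup_{k}\omega_k$. Test statistic $T=\sum_{k\in\mathbb{N}_*^d}\omega_k\big((y_k/\epsilon)^2-1\big)$ and tests $\Psi_{\epsilon,t}=\mathbf 1_{\{T>t\}}$.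 $\Phi$ is the standard Gaussian distribution function and $H^{(\alpha)}$ its $(1-\alpha)$-quantile. *)

theory Defs
  imports "HOL-Probability.Probability"
begin

text \<open>Multi-indices in dimension \<open>d\<close> are functions from a finite type with \<open>d\<close> elements; sequences
  are functions on multi-indices, of which only the values on \<open>Nstar\<close> matter.\<close>

type_synonym 'd seq = "('d \<Rightarrow> nat) \<Rightarrow> real"

definition Nstar :: "('d::finite \<Rightarrow> nat) set" where
  "Nstar = {l. \<forall>j. 1 \<le> l j}"

definition mildly_ill_posed :: "('d::finite) seq \<Rightarrow> bool" where
  "mildly_ill_posed b \<longleftrightarrow>
     (\<exists>c0 c1 t. 0 < c0 \<and> c0 \<le> c1 \<and> (\<forall>j::'d. 0 \<le> t j) \<and>
        (\<forall>l\<in>Nstar. c0 * (\<Prod>j\<in>UNIV. real (l j) powr (- t j)) \<le> \<bar>b l\<bar> \<and>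
                    \<bar>b l\<bar> \<le> c1 * (\<Prod>j\<in>UNIV. real (l j) powr (- t j))))"

definition severely_ill_posed :: "('d::finite) seq \<Rightarrow> bool" where
  "severely_ill_posed b \<longleftrightarrow>
     (\<exists>c0 c1 t. 0 < c0 \<and> c0 \<le> c1 \<and> (\<forall>j::'d. 0 \<le> t j) \<and>
        (\<forall>l\<in>Nstar. c0 * (\<Prod>j\<in>UNIV. exp (- t j * real (l j))) \<le> \<bar>b l\<bar> \<and>
                    \<bar>b l\<bar> \<le> c1 * (\<Prod>j\<in>UNIV. exp (- t j * real (l j)))))"

definition sobolev_type :: "('d::finite) seq \<Rightarrow> bool" where
  "sobolev_type a \<longleftrightarrow> (\<forall>l\<in>Nstar. 0 < a l) \<and>
     (\<exists>s. (\<forall>j::'d. 0 < s j) \<and>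
        ((\<forall>l\<in>Nstar. (a l)\<^sup>2 = (\<Sum>j\<in>UNIV. real (l j) powr (2 * s j))) \<or>
         (\<forall>l\<in>Nstar. (a l)\<^sup>2 = (\<Sum>j\<in>UNIV. exp (2 * s j * real (l j))))))"

definition tensor_product_type :: "('d::finite) seq \<Rightarrow> bool" where
  "tensor_product_type a \<longleftrightarrow> (\<forall>l\<in>Nstar. 0 < a l) \<and>
     (\<exists>s. (\<forall>j::'d. 0 < s j) \<and>
        ((\<forall>l\<in>Nstar. (a l)\<^sup>2 = (\<Prod>j\<in>UNIV. real (l j) powr (2 * s j))) \<or>
         (\<forall>l\<in>Nstar. (a l)\<^sup>2 = (\<Prod>j\<in>UNIV. exp (2 * s j * real (l j))))))"

text \<open>Summability is required explicitly since \<^const>\<open>infsum\<close> is \<open>0\<close> on families that are not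
  summable.\<close>

definition ellipsoid :: "('d::finite) seq \<Rightarrow> real \<Rightarrow> 'd seq set" where
  "ellipsoid a R = {\<theta>. (\<lambda>l. (\<theta> l)\<^sup>2) summable_on Nstar \<and>
      (\<lambda>l. (a l)\<^sup>2 * (\<theta> l)\<^sup>2) summable_on Nstar \<and>
      (\<Sum>\<^sub>\<infinity>l\<in>Nstar. (a l)\<^sup>2 * (\<theta> l)\<^sup>2) \<le> R\<^sup>2}"

definition alternative :: "('d::finite) seq \<Rightarrow> real \<Rightarrow> real \<Rightarrow> 'd seq set" where
  "alternative a R r = {\<theta> \<in> ellipsoid a R. sqrt (\<Sum>\<^sub>\<infinity>l\<in>Nstar. (\<theta> l)\<^sup>2) \<ge> r}"

definition obs_space :: "('d::finite) seq measure" where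
  "obs_space = (\<Pi>\<^sub>M l\<in>Nstar. borel)"

definition obs_law :: "('d::finite) seq \<Rightarrow> real \<Rightarrow> 'd seq \<Rightarrow> 'd seq measure" where
  "obs_law b \<epsilon> \<theta> =
     distr (\<Pi>\<^sub>M l\<in>Nstar. std_normal_distribution) obs_space
       (\<lambda>\<xi>. \<lambda>l\<in>Nstar. b l * \<theta> l + \<epsilon> * \<xi> l)"

definition is_test :: "(('d::finite) seq \<Rightarrow> nat) \<Rightarrow> bool" where
  "is_test \<psi> \<longleftrightarrow> \<psi> \<in> obs_space \<rightarrow>\<^sub>M count_space {0, 1}"

text \<open>The tests at noise level \<open>\<epsilon>\<close> whose type I error is at most \<open>\<alpha> + \<delta> \<epsilon>\<close>, where the function
  \<open>\<delta>\<close> plays the role of the remainder \<open>o(1)\<close>.\<close>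

definition level_tests ::
    "('d::finite) seq \<Rightarrow> real \<Rightarrow> (real \<Rightarrow> real) \<Rightarrow> real \<Rightarrow> ('d seq \<Rightarrow> nat) set" where
  "level_tests b \<alpha> \<delta> \<epsilon> =
     {\<psi>. is_test \<psi> \<and>
          measure (obs_law b \<epsilon> (\<lambda>_. 0)) {y \<in> space obs_space. \<psi> y = 1} \<le> \<alpha> + \<delta> \<epsilon>}"

definition asymp_level_test ::
    "('d::finite) seq \<Rightarrow> real \<Rightarrow> (real \<Rightarrow> 'd seq \<Rightarrow> nat) \<Rightarrow> bool" where
  "asymp_level_test b \<alpha> \<psi> \<longleftrightarrow>
     (\<exists>\<delta>. (\<delta> \<longlongrightarrow> 0) (at_right 0) \<and> (\<forall>\<epsilon>>0. \<psi> \<epsilon> \<in> level_tests b \<alpha> \<delta> \<epsilon>))"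

text \<open>The supremum is taken in \<^typ>\<open>ennreal\<close>, so that it is \<open>0\<close> over an empty alternative.\<close>

definition type2_error ::
    "('d::finite) seq \<Rightarrow> real \<Rightarrow> 'd seq set \<Rightarrow> ('d seq \<Rightarrow> nat) \<Rightarrow> real" where
  "type2_error b \<epsilon> \<Theta> \<psi> =
     enn2real (SUP \<theta>\<in>\<Theta>. emeasure (obs_law b \<epsilon> \<theta>) {y \<in> space obs_space. \<psi> y = 0})"

text \<open>The remainder \<open>\<delta>\<close> is a parameter: for each single \<open>\<epsilon>\<close>, an infimum over all families of tests
  that are of level \<open>\<alpha>\<close> merely in the limit would be \<open>0\<close>, since a family may be changed
  arbitrarily at that \<open>\<epsilon>\<close>. Results about the minimax error are to be stated for
  every \<open>\<delta>\<close> that tends to \<open>0\<close>.\<close>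

definition minimax_type2_error ::
    "('d::finite) seq \<Rightarrow> real \<Rightarrow> 'd seq set \<Rightarrow> real \<Rightarrow> (real \<Rightarrow> real) \<Rightarrow> real" where
  "minimax_type2_error b \<epsilon> \<Theta> \<alpha> \<delta> = (INF \<psi>\<in>level_tests b \<alpha> \<delta> \<epsilon>. type2_error b \<epsilon> \<Theta> \<psi>)"

definition energy :: "('d::finite) seq \<Rightarrow> 'd seq \<Rightarrow> real" where
  "energy b \<theta> = (\<Sum>\<^sub>\<infinity>k\<in>Nstar. (b k) ^ 4 * (\<theta> k) ^ 4)"

text \<open>Extended real, with value \<open>\<infinity>\<close> when the alternative is empty (infimum over the empty set).\<close>

definition extremal_sq ::
    "('d::finite) seq \<Rightarrow> 'd seq \<Rightarrow> real \<Rightarrow> real \<Rightarrow> real \<Rightarrow> ereal" where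
  "extremal_sq a b R \<epsilon> r = (INF \<theta>\<in>alternative a R r. ereal (1 / (2 * \<epsilon> ^ 4) * energy b \<theta>))"

definition extremal ::
    "('d::finite) seq \<Rightarrow> 'd seq \<Rightarrow> real \<Rightarrow> real \<Rightarrow> real \<Rightarrow> ereal" where
  "extremal a b R \<epsilon> r =
     (if extremal_sq a b R \<epsilon> r = \<infinity> then \<infinity>
      else ereal (sqrt (real_of_ereal (extremal_sq a b R \<epsilon> r))))"

text \<open>A minimiser is unique only up to the signs of its entries on \<open>Nstar\<close>; everything below
  depends on their squares only.\<close>

definition extremal_solution ::
    "('d::finite) seq \<Rightarrow> 'd seq \<Rightarrow> real \<Rightarrow> real \<Rightarrow> 'd seq" where
  "extremal_solution a b R r =
     (SOME \<theta>. \<theta> \<in> alternative a R r \<and> (\<forall>\<theta>'\<in>alternative a R r. energy b \<theta> \<le> energy b \<theta>'))"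

definition weight ::
    "('d::finite) seq \<Rightarrow> 'd seq \<Rightarrow> real \<Rightarrow> real \<Rightarrow> 'd seq" where
  "weight a b R r k =
     (b k)\<^sup>2 * (extremal_solution a b R r k)\<^sup>2 / sqrt (2 * energy b (extremal_solution a b R r))"

definition max_weight ::
    "('d::finite) seq \<Rightarrow> 'd seq \<Rightarrow> real \<Rightarrow> real \<Rightarrow> real" where
  "max_weight a b R r = (SUP k\<in>Nstar. weight a b R r k)"

definition test_statistic ::
    "('d::finite) seq \<Rightarrow> 'd seq \<Rightarrow> real \<Rightarrow> real \<Rightarrow> real \<Rightarrow> 'd seq \<Rightarrow> real" where
  "test_statistic a b R \<epsilon> r y = (\<Sum>\<^sub>\<infinity>k\<in>Nstar. weight a b R r k * ((y k / \<epsilon>)\<^sup>2 - 1))"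

definition Psi_test ::
    "('d::finite) seq \<Rightarrow> 'd seq \<Rightarrow> real \<Rightarrow> real \<Rightarrow> real \<Rightarrow> real \<Rightarrow> 'd seq \<Rightarrow> nat" where
  "Psi_test a b R \<epsilon> r t y = (if test_statistic a b R \<epsilon> r y > t then 1 else 0)"

definition Phi :: "real \<Rightarrow> real" where
  "Phi x = cdf std_normal_distribution x"

definition Phi_quantile :: "real \<Rightarrow> real" where
  "Phi_quantile p = Inf {x. p \<le> Phi x}"

end

theory Submission
  imports Defs
begin

text \<open>
  Writing \<open>v = \<theta>\<^sup>2\<close> makes the extremal problem the minimisation of the strictly convex form
  \<open>\<Sum> b\<^sup>4 v\<^sup>2\<close> over a convex set, so a solution exists, it has finite support because \<open>a\<close> tends to
  infinity, and it satisfies a variational inequality. The inequality says that the statistic has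
  mean at least \<open>u\<close> under every alternative, while its centred part is asymptotically normal when
  \<open>\<omega>0\<close> tends to \<open>0\<close>; this gives the upper bounds.

  For the lower bounds, put random signs on the extremal solution. The likelihood ratio of this
  mixture is a product of factors \<open>exp (- l / 2) * cosh (sqrt l * x)\<close> with \<open>l = 2 * u * w\<close>. Its squared
  distance from \<open>1\<close> in \<open>L\<^sup>2\<close> is at most \<open>exp (u\<^sup>2) - 1\<close>, which settles the case \<open>u \<longlongrightarrow> 0\<close>. If \<open>\<omega>0\<close> tends to
  \<open>0\<close>, it is close in \<open>L\<^sup>2\<close> to the likelihood ratio for a centred Gaussian prior, that is the product of
  \<open>sqrt (1 - l) * exp (l * x\<^sup>2 / 2)\<close>, which is an increasing function of the test statistic: by
  Neyman and Pearson no test of the same level beats the threshold test, up to \<open>o(1)\<close>.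
\<close>

section \<open>The extremal problem\<close>

text \<open>Both likelihood ratios of the sharp lower bound have second moment
  \<open>exp (\<Sum> l\<^sup>2 / 2)\<close> up to terms of third order in \<open>l\<close>, and
  \<open>\<Sum> l ^ 3\<close> is at most \<open>4 * u ^ 3 * \<omega>0\<close>. So
  \<open>\<omega>0\<close> enters there, in the central limit theorem, and in the variance of the
  part of the statistic that is linear in the noise. The finite support keeps every likelihood ratio
  a finite product. Three obstacles shape the asymptotics. No bound uniform in
  \<open>\<epsilon>\<close> is available for the mean of the statistic over the alternatives, so
  deviations are measured relative to that mean. The remainder \<open>\<delta>\<close> in the level
  may be negative, so the test with threshold \<open>H\<close> need not belong to the class over
  which the minimax error is an infimum; thresholds slightly above \<open>H\<close> replace it, at a
  cost controlled by the Lipschitz constant of \<open>Phi\<close>. Tests take the values 0 and 1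
  only, so the upper bound \<open>1 - \<alpha>\<close> for vanishing \<open>u\<close> needs an
  actual test that hardly sees the signal.\<close>

lemma summable_on_mult_bounded:
  fixes f g :: "'i \<Rightarrow> real"
  assumes f: "f summable_on I" "\<And>k. k \<in> I \<Longrightarrow> 0 \<le> f k" and g: "\<And>k. k \<in> I \<Longrightarrow> \<bar>g k\<bar> \<le> B"
  shows "(\<lambda>k. g k * f k) summable_on I"
proof -
  have "(\<lambda>k. B * f k) summable_on I"
    using f(1) by (rule summable_on_cmult_right)
  then have "(\<lambda>k. norm (g k * f k)) summable_on I"
  proof (rule summable_on_comparison_test)
    fix k assume k: "k \<in> I"
    show "norm (g k * f k) \<le> B * f k"
      using g[OF k] f(2)[OF k] by (simp add: abs_mult mult_right_mono)
  qed auto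
  then show ?thesis by (rule abs_summable_summable)
qed

lemma le_infsum_of_member:
  fixes f :: "'i \<Rightarrow> real"
  assumes "f summable_on I" "\<And>k. k \<in> I \<Longrightarrow> 0 \<le> f k" "k \<in> I"
  shows "f k \<le> infsum f I"
  using finite_sum_le_infsum[of f I "{k}"] assms by auto

lemma summable_on_mult_nonneg:
  fixes f g :: "'i \<Rightarrow> real"
  assumes f: "f summable_on I" "\<And>k. k \<in> I \<Longrightarrow> 0 \<le> f k"
    and g: "g summable_on I" "\<And>k. k \<in> I \<Longrightarrow> 0 \<le> g k"
  shows "(\<lambda>k. f k * g k) summable_on I"
  by (rule summable_on_mult_bounded[OF g, where B = "infsum f I"])
     (use le_infsum_of_member[OF f] f(2) in auto)

lemma infsum_linear_combination:
  fixes f g h :: "'i \<Rightarrow> real"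
  assumes "f summable_on I" "g summable_on I" "h summable_on I"
  shows "(\<Sum>\<^sub>\<infinity>k\<in>I. x * f k + y * g k + z * h k) = x * infsum f I + y * infsum g I + z * infsum h I"
proof -
  note S = summable_on_cmult_right[OF assms(1), of x] summable_on_cmult_right[OF assms(2), of y]
    summable_on_cmult_right[OF assms(3), of z]
  show ?thesis
    by (simp add: infsum_add[OF summable_on_add[OF S(1,2)] S(3)] infsum_add[OF S(1,2)] infsum_cmult_right assms)
qed

text \<open>Abstract form in the squared parameters: \<open>c\<close> will be \<open>b ^ 4\<close>,
  \<open>A\<close> will be \<open>a ^ 2\<close>, and \<open>\<rho>\<close> and \<open>s\<close> the
  squares of \<open>R\<close> and \<open>r\<close>. Finiteness of the sublevel sets of
  \<open>A\<close> plays the part of compactness.\<close>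

locale extremal_problem =
  fixes I :: "'i set" and c A :: "'i \<Rightarrow> real" and C \<rho> s :: real
  assumes infinite_I: "infinite I"
    and c_pos: "\<And>k. k \<in> I \<Longrightarrow> 0 < c k" and c_le: "\<And>k. k \<in> I \<Longrightarrow> c k \<le> C"
    and A_ge1: "\<And>k. k \<in> I \<Longrightarrow> 1 \<le> A k"
    and A_fin: "\<And>K. finite {k \<in> I. A k \<le> K}"
begin

definition feasible :: "('i \<Rightarrow> real) set" where
  "feasible = {v. (\<forall>k\<in>I. 0 \<le> v k) \<and> v summable_on I \<and> (\<lambda>k. A k * v k) summable_on I \<and>
     (\<Sum>\<^sub>\<infinity>k\<in>I. A k * v k) \<le> \<rho> \<and> s \<le> (\<Sum>\<^sub>\<infinity>k\<in>I. v k)}"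

definition form :: "('i \<Rightarrow> real) \<Rightarrow> ('i \<Rightarrow> real) \<Rightarrow> real" where
  "form v w = (\<Sum>\<^sub>\<infinity>k\<in>I. c k * (v k * w k))"

lemma feasibleD:
  assumes "v \<in> feasible"
  shows "\<And>k. k \<in> I \<Longrightarrow> 0 \<le> v k" "v summable_on I" "(\<lambda>k. A k * v k) summable_on I"
    "(\<Sum>\<^sub>\<infinity>k\<in>I. A k * v k) \<le> \<rho>" "s \<le> (\<Sum>\<^sub>\<infinity>k\<in>I. v k)"
  using assms by (auto simp: feasible_def)

lemma form_summable:
  assumes "v \<in> feasible" "w \<in> feasible"
  shows "(\<lambda>k. c k * (v k * w k)) summable_on I"
proof (rule summable_on_mult_bounded[where B = C])
  show "(\<lambda>k. v k * w k) summable_on I"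
    using feasibleD[OF assms(1)] feasibleD[OF assms(2)] by (intro summable_on_mult_nonneg) auto
qed (use feasibleD[OF assms(1)] feasibleD[OF assms(2)] c_pos c_le in \<open>auto simp: abs_of_pos\<close>)

lemma form_nonneg: "v \<in> feasible \<Longrightarrow> w \<in> feasible \<Longrightarrow> 0 \<le> form v w"
  unfolding form_def by (intro infsum_nonneg mult_nonneg_nonneg) (auto dest: feasibleD(1) c_pos)

lemma feasible_convex:
  assumes v: "v \<in> feasible" and w: "w \<in> feasible" and t: "0 \<le> t" "t \<le> 1"
  shows "(\<lambda>k. (1 - t) * v k + t * w k) \<in> feasible"
proof -
  note V = feasibleD[OF v] and W = feasibleD[OF w]
  have 1: "(\<lambda>k. (1 - t) * v k + t * w k) summable_on I"
    by (intro summable_on_add summable_on_cmult_right V W)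
  have eq: "(\<lambda>k. A k * ((1 - t) * v k + t * w k)) = (\<lambda>k. (1 - t) * (A k * v k) + t * (A k * w k))"
    by (auto simp: algebra_simps)
  have 2: "(\<lambda>k. A k * ((1 - t) * v k + t * w k)) summable_on I"
    unfolding eq by (intro summable_on_add summable_on_cmult_right V W)
  have "(\<Sum>\<^sub>\<infinity>k\<in>I. A k * ((1 - t) * v k + t * w k))
      = (1 - t) * (\<Sum>\<^sub>\<infinity>k\<in>I. A k * v k) + t * (\<Sum>\<^sub>\<infinity>k\<in>I. A k * w k)"
    unfolding eq by (subst infsum_add) (auto intro!: summable_on_cmult_right V W simp: infsum_cmult_right V W)
  also have "\<dots> \<le> (1 - t) * \<rho> + t * \<rho>"
    using V W t by (intro add_mono mult_left_mono) auto
  finally have 3: "(\<Sum>\<^sub>\<infinity>k\<in>I. A k * ((1 - t) * v k + t * w k)) \<le> \<rho>" by (simp add: algebra_simps)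
  have "(\<Sum>\<^sub>\<infinity>k\<in>I. (1 - t) * v k + t * w k) = (1 - t) * (\<Sum>\<^sub>\<infinity>k\<in>I. v k) + t * (\<Sum>\<^sub>\<infinity>k\<in>I. w k)"
    by (subst infsum_add) (auto intro!: summable_on_cmult_right V W simp: infsum_cmult_right V W)
  also have "\<dots> \<ge> (1 - t) * s + t * s"
    using V W t by (intro add_mono mult_left_mono) auto
  finally have 4: "s \<le> (\<Sum>\<^sub>\<infinity>k\<in>I. (1 - t) * v k + t * w k)" by (simp add: algebra_simps)
  show ?thesis
    using 1 2 3 4 V(1) W(1) t unfolding feasible_def by auto
qed

lemma form_convex_comb:
  assumes v: "v \<in> feasible" and w: "w \<in> feasible"
  shows "form (\<lambda>k. (1 - t) * v k + t * w k) (\<lambda>k. (1 - t) * v k + t * w k)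
    = (1 - t)\<^sup>2 * form v v + 2 * t * (1 - t) * form v w + t\<^sup>2 * form w w"
proof -
  have "form (\<lambda>k. (1 - t) * v k + t * w k) (\<lambda>k. (1 - t) * v k + t * w k)
    = (\<Sum>\<^sub>\<infinity>k\<in>I. (1 - t)\<^sup>2 * (c k * (v k * v k)) + 2 * t * (1 - t) * (c k * (v k * w k)) + t\<^sup>2 * (c k * (w k * w k)))"
    unfolding form_def by (intro infsum_cong) (simp add: algebra_simps power2_eq_square)
  also have "\<dots> = (1 - t)\<^sup>2 * form v v + 2 * t * (1 - t) * form v w + t\<^sup>2 * form w w"
    unfolding form_def by (intro infsum_linear_combination form_summable v w)
  finally show ?thesis .
qed

text \<open>Parallelogram law: a minimising sequence converges in every coordinate.\<close>

lemma form_parallelogram: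
  assumes v: "v \<in> feasible" and w: "w \<in> feasible" and k: "k \<in> I"
    and m: "\<And>x. x \<in> feasible \<Longrightarrow> m \<le> form x x"
  shows "c k * (v k - w k)\<^sup>2 \<le> 2 * (form v v - m) + 2 * (form w w - m)"
proof -
  have "c k * (v k - w k)\<^sup>2 = c k * (v k * v k) + (- 2) * (c k * (v k * w k)) + c k * (w k * w k)"
    by (simp add: power2_eq_square algebra_simps)
  also have "\<dots> \<le> (\<Sum>\<^sub>\<infinity>k\<in>I. c k * (v k * v k) + (- 2) * (c k * (v k * w k)) + c k * (w k * w k))"
  proof (rule le_infsum_of_member[OF _ _ k])
    fix j assume "j \<in> I"
    have "c j * (v j * v j) + (- 2) * (c j * (v j * w j)) + c j * (w j * w j) = c j * (v j - w j)\<^sup>2"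
      by (simp add: power2_eq_square algebra_simps)
    then show "0 \<le> c j * (v j * v j) + (- 2) * (c j * (v j * w j)) + c j * (w j * w j)"
      using c_pos[OF \<open>j \<in> I\<close>] by simp
  qed (intro summable_on_add summable_on_cmult_right form_summable v w)
  also have "\<dots> = form v v + (- 2) * form v w + form w w"
    using infsum_linear_combination[OF form_summable[OF v v] form_summable[OF v w] form_summable[OF w w], of 1 "-2" 1]
    unfolding form_def by simp
  finally have 1: "c k * (v k - w k)\<^sup>2 \<le> form v v - 2 * form v w + form w w" by simp
  \<comment> \<open>The midpoint is feasible, so its value is at least \<open>m\<close>; this bounds
    the cross term from below.\<close>
  have "m \<le> (1/2)\<^sup>2 * form v v + 1/2 * form v w + (1/2)\<^sup>2 * form w w"
    using m[OF feasible_convex[OF v w, of "1/2"]] form_convex_comb[OF v w, of "1/2"] by simp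
  then have "4 * m \<le> form v v + 2 * form v w + form w w"
    by (simp add: power2_eq_square)
  with 1 show ?thesis by simp
qed

text \<open>Direct method. The budget and the form pass to the coordinatewise limit of a minimising
  sequence because they are suprema of finite partial sums of nonnegative terms. The mass constraint
  is a lower bound and could be lost at infinity; the budget prevents this, leaving mass at most
  \<open>\<rho> / K\<close> where \<open>A\<close> exceeds \<open>K\<close>.\<close>

lemma minimiser_exists:
  assumes "feasible \<noteq> {}"
  obtains v where "v \<in> feasible" "\<And>w. w \<in> feasible \<Longrightarrow> form v v \<le> form w w"
proof -
  define m where "m = (INF v\<in>feasible. form v v)"
  have bdd: "bdd_below ((\<lambda>v. form v v) ` feasible)"
    by (rule bdd_belowI2[of _ 0]) (auto intro: form_nonneg)
  have m: "m \<le> form x x" if "x \<in> feasible" for x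
    unfolding m_def using bdd that by (rule cINF_lower)
  have "\<exists>v\<in>feasible. form v v < m + 1 / real (Suc n)" for n
    using cINF_less_iff[OF assms bdd, of "m + 1 / real (Suc n)"] by (simp add: m_def)
  then obtain f where f: "\<And>n. f n \<in> feasible" "\<And>n. form (f n) (f n) < m + 1 / real (Suc n)"
    by metis
  note F = feasibleD[OF f(1)]
  have AF: "0 \<le> A k * f n k" if "k \<in> I" for k n
    using F(1)[OF that] A_ge1[OF that] by simp
  have "Cauchy (\<lambda>n. f n k)" if k: "k \<in> I" for k
  proof (rule metric_CauchyI)
    fix e :: real assume e: "0 < e"
    \<comment> \<open>The parallelogram bound adds twice the excess over \<open>m\<close> of each of
      the two points, hence the 4.\<close>
    then have "0 < c k * e\<^sup>2 / 4" using c_pos[OF k] by simp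
    from reals_Archimedean[OF this] obtain N where N: "1 / real (Suc N) < c k * e\<^sup>2 / 4"
      by (auto simp: inverse_eq_divide)
    show "\<exists>N. \<forall>p\<ge>N. \<forall>n\<ge>N. dist (f p k) (f n k) < e"
    proof (intro exI[of _ N] allI impI)
      fix p n assume pn: "N \<le> p" "N \<le> n"
      have "1 / real (Suc p) \<le> 1 / real (Suc N)" "1 / real (Suc n) \<le> 1 / real (Suc N)"
        using pn by (auto simp: frac_le)
      moreover have par: "c k * (f p k - f n k)\<^sup>2 \<le> 2 * (form (f p) (f p) - m) + 2 * (form (f n) (f n) - m)"
        by (rule form_parallelogram[OF f(1) f(1) k]) (rule m)
      ultimately have "c k * (f p k - f n k)\<^sup>2 < c k * e\<^sup>2"
        using par f(2)[of p] f(2)[of n] N by argo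
      then have "(f p k - f n k)\<^sup>2 < e\<^sup>2" using c_pos[OF k] by simp
      then show "dist (f p k) (f n k) < e"
        using e power2_less_imp_less[of "\<bar>f p k - f n k\<bar>" e] by (simp add: dist_real_def)
    qed
  qed
  then have "\<forall>k\<in>I. \<exists>l. (\<lambda>n. f n k) \<longlonglongrightarrow> l"
    by (auto simp: Cauchy_convergent_iff convergent_def)
  then obtain v where v: "\<And>k. k \<in> I \<Longrightarrow> (\<lambda>n. f n k) \<longlonglongrightarrow> v k" by metis
  have v0: "0 \<le> v k" if "k \<in> I" for k
    using v[OF that] F(1)[OF that] by (intro LIMSEQ_le_const) auto
  have Av: "0 \<le> A k * v k" if "k \<in> I" for k using v0[OF that] A_ge1[OF that] by simp
  have finA: "(\<Sum>k\<in>X. A k * v k) \<le> \<rho>" if X: "finite X" "X \<subseteq> I" for X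
  proof (rule LIMSEQ_le_const2)
    show "(\<lambda>n. \<Sum>k\<in>X. A k * f n k) \<longlonglongrightarrow> (\<Sum>k\<in>X. A k * v k)"
      using X by (intro tendsto_sum tendsto_mult tendsto_const v) auto
    have "(\<Sum>k\<in>X. A k * f n k) \<le> \<rho>" for n
    proof -
      have "(\<Sum>k\<in>X. A k * f n k) \<le> (\<Sum>\<^sub>\<infinity>k\<in>I. A k * f n k)"
        using X F(3)[of n] AF by (intro finite_sum_le_infsum) auto
      with F(4)[of n] show ?thesis by linarith
    qed
    then show "\<exists>N. \<forall>n\<ge>N. (\<Sum>k\<in>X. A k * f n k) \<le> \<rho>" by blast
  qed
  have sumA: "(\<lambda>k. A k * v k) summable_on I"
    by (rule nonneg_bdd_above_summable_on) (use Av finA in \<open>auto intro!: bdd_aboveI2[where M = \<rho>]\<close>)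
  have sumv: "v summable_on I"
  proof (rule summable_on_comparison_test[OF sumA])
    show "v k \<le> A k * v k" if "k \<in> I" for k
      using mult_right_mono[OF A_ge1 v0, OF that that] by simp
  qed (rule v0)
  have leA: "(\<Sum>\<^sub>\<infinity>k\<in>I. A k * v k) \<le> \<rho>"
    using sumA finA by (rule infsum_le_finite_sums)
  have \<rho>: "0 \<le> \<rho>" using finA[of "{}"] by simp
  have mass: "s - \<rho> / K \<le> infsum v I" if K: "0 < K" for K
  proof -
    define X where "X = {k \<in> I. A k \<le> K}"
    have X: "finite X" "X \<subseteq> I" using A_fin by (auto simp: X_def)
    have "s - \<rho> / K \<le> (\<Sum>k\<in>X. f n k)" for n
    proof -
      have "s \<le> infsum (f n) (X \<union> (I - X))" using F(5)[of n] X by (simp add: Un_absorb1)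
      also have "\<dots> = infsum (f n) X + infsum (f n) (I - X)"
        using X F(2)[of n] by (intro infsum_Un_disjoint) (auto intro: summable_on_subset_banach)
      also have "infsum (f n) (I - X) \<le> infsum (\<lambda>k. (1 / K) * (A k * f n k)) (I - X)"
      proof (rule infsum_mono)
        show "f n summable_on I - X" using F(2)[of n] by (rule summable_on_subset_banach) auto
        show "(\<lambda>k. (1 / K) * (A k * f n k)) summable_on I - X"
          using F(3)[of n] by (intro summable_on_cmult_right) (rule summable_on_subset_banach, auto)
        fix k assume "k \<in> I - X"
        then have "K * f n k \<le> A k * f n k"
          using F(1)[of k n] by (intro mult_right_mono) (auto simp: X_def)
        then show "f n k \<le> 1 / K * (A k * f n k)" using K by (simp add: field_simps)
      qed
      also have "\<dots> = (1 / K) * infsum (\<lambda>k. A k * f n k) (I - X)"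
        by (intro infsum_cmult_right) (use F(3)[of n] in \<open>auto intro: summable_on_subset_banach\<close>)
      also have "infsum (\<lambda>k. A k * f n k) (I - X) \<le> infsum (\<lambda>k. A k * f n k) I"
        using AF F(3)[of n] by (intro infsum_mono2 summable_on_subset_banach[OF F(3)]) auto
      also have "\<dots> \<le> \<rho>" using F(4)[of n] .
      finally show ?thesis using X K by (simp add: divide_simps mult.commute)
    qed
    then have "s - \<rho> / K \<le> (\<Sum>k\<in>X. v k)"
      using X by (intro LIMSEQ_le_const[of "\<lambda>n. \<Sum>k\<in>X. f n k"] tendsto_sum v) auto
    also have "\<dots> \<le> infsum v I"
      using X v0 sumv by (intro finite_sum_le_infsum) auto
    finally show ?thesis .
  qed
  have "s \<le> infsum v I"
  proof (rule field_le_epsilon)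
    fix e :: real assume e: "0 < e"
    \<comment> \<open>\<open>\<rho> + 1\<close> rather than \<open>\<rho>\<close>, because the
      cutoff has to be positive even for \<open>\<rho> = 0\<close>.\<close>
    have "\<rho> / ((\<rho> + 1) / e) \<le> e" using \<rho> e by (simp add: field_simps)
    then show "s \<le> infsum v I + e" using mass[of "(\<rho> + 1) / e"] \<rho> e by simp
  qed
  then have vin: "v \<in> feasible" using v0 sumv sumA leA by (auto simp: feasible_def)
  have "form v v \<le> m"
    unfolding form_def
  proof (rule infsum_le_finite_sums)
    show "(\<lambda>k. c k * (v k * v k)) summable_on I" by (intro form_summable vin)
    fix X assume X: "finite X" "X \<subseteq> I"
    show "(\<Sum>k\<in>X. c k * (v k * v k)) \<le> m"
    proof (rule LIMSEQ_le)
      show "(\<lambda>n. \<Sum>k\<in>X. c k * (f n k * f n k)) \<longlonglongrightarrow> (\<Sum>k\<in>X. c k * (v k * v k))"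
        using X by (intro tendsto_sum tendsto_mult tendsto_const v) auto
      show "(\<lambda>n. m + 1 / real (Suc n)) \<longlonglongrightarrow> m"
        using tendsto_add[OF tendsto_const[of m] LIMSEQ_Suc[OF lim_1_over_n]] by simp
      have "(\<Sum>k\<in>X. c k * (f n k * f n k)) \<le> m + 1 / real (Suc n)" for n
      proof -
        have "(\<Sum>k\<in>X. c k * (f n k * f n k)) \<le> form (f n) (f n)"
          unfolding form_def using X c_pos by (intro finite_sum_le_infsum form_summable f) (auto simp: less_imp_le)
        with f(2)[of n] show ?thesis by linarith
      qed
      then show "\<exists>N. \<forall>n\<ge>N. (\<Sum>k\<in>X. c k * (f n k * f n k)) \<le> m + 1 / real (Suc n)" by blast
    qed
  qed
  with m vin that show ?thesis by force
qed

text \<open>First-order optimality: along the segment from \<open>v\<close> to \<open>w\<close> the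
  form has derivative \<open>2 * (form v w - form v v)\<close> at 0, which cannot be negative at a
  minimiser.\<close>

lemma variational_inequality:
  assumes v: "v \<in> feasible" and min: "\<And>w. w \<in> feasible \<Longrightarrow> form v v \<le> form w w" and w: "w \<in> feasible"
  shows "form v v \<le> form v w"
proof (rule ccontr)
  assume "\<not> ?thesis"
  define g where "g = form v v - form v w"
  define q where "q = form w w + form v v - 2 * form v w"
  have g: "0 < g" using \<open>\<not> _\<close> by (simp add: g_def)
  have key: "0 \<le> - 2 * t * g + t\<^sup>2 * q" if t: "0 \<le> t" "t \<le> 1" for t
    using min[OF feasible_convex[OF v w t]] unfolding form_convex_comb[OF v w] g_def q_def
    by (simp add: power2_eq_square algebra_simps)
  \<comment> \<open>So short a step that the quadratic term \<open>t\<^sup>2 * q\<close> is at most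
    half of the linear gain \<open>2 * t * g\<close>.\<close>
  define t where "t = min 1 (g / (\<bar>q\<bar> + 1))"
  have t: "0 < t" "t \<le> 1" "t \<le> g / (\<bar>q\<bar> + 1)" using g by (auto simp: t_def)
  have "t * q \<le> t * (\<bar>q\<bar> + 1)" using t by (intro mult_left_mono) auto
  also have "\<dots> \<le> g" using t(3) by (simp add: field_simps)
  finally have "t * (t * q) \<le> t * g" using t by (intro mult_left_mono) auto
  moreover have "0 < t * g" using t g by simp
  moreover have "0 \<le> - 2 * (t * g) + t * (t * q)"
    using key[of t] t by (simp add: power2_eq_square mult.assoc)
  ultimately show False by linarith
qed

text \<open>Moving mass \<open>\<eta>\<close> from \<open>i\<close> to \<open>j\<close> costs at most \<open>\<eta> * \<bar>A j - A i\<bar>\<close> of the budget, which is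
  recovered by moving a negligible mass from a far coordinate \<open>k\<close> of the support to \<open>j\<close>. If the
  support were infinite, the gradient \<open>c i * v i\<close> would thus be minimal at every support point \<open>i\<close>,
  and \<open>v\<close> would not be summable.\<close>

lemma minimiser_finite_support:
  assumes v: "v \<in> feasible" and min: "\<And>w. w \<in> feasible \<Longrightarrow> form v v \<le> form w w"
  shows "finite {k \<in> I. v k \<noteq> 0}"
proof (rule ccontr)
  assume inf: "infinite {k \<in> I. v k \<noteq> 0}"
  note V = feasibleD[OF v]
  from inf obtain i where i: "i \<in> I" "v i \<noteq> 0"
    using not_finite_existsD by blast
  then have vi: "0 < v i" using V(1) by (metis less_eq_real_def)
  have gmin: "c i * v i \<le> c j * v j" if j: "j \<in> I" "j \<noteq> i" for j
  proof (rule ccontr)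
    assume "\<not> ?thesis"
    then have lt: "c j * v j < c i * v i" by simp
    define C0 where "C0 = \<bar>A j - A i\<bar>"
    \<comment> \<open>Tolerated relative surcharge: \<open>(c j * v j + 1) * e\<close> is half the
      gap between the two gradients; the 1 covers the case \<open>v j = 0\<close>.\<close>
    define e where "e = (c i * v i - c j * v j) / (2 * (c j * v j + 1))"
    have gj: "0 \<le> c j * v j" using j V(1) c_pos by (simp add: less_imp_le)
    have e: "0 < e" using lt gj by (simp add: e_def)
    \<comment> \<open>Beyond this level \<open>A k - A j\<close> exceeds \<open>C0 / e\<close>, so
      the exchange rate \<open>q\<close> chosen below is at most \<open>e\<close>.\<close>
    define K where "K = A j + C0 / e + 1"
    have "infinite ({k \<in> I. v k \<noteq> 0} - ({k \<in> I. A k \<le> K} \<union> {i, j}))"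
      using inf A_fin[of K] by (intro Diff_infinite_finite) auto
    then have "{k \<in> I. v k \<noteq> 0} - ({k \<in> I. A k \<le> K} \<union> {i, j}) \<noteq> {}"
      by (rule infinite_imp_nonempty)
    then obtain k where k: "k \<in> I" "v k \<noteq> 0" "K < A k" "k \<noteq> i" "k \<noteq> j"
      by force
    have vk: "0 < v k" using k V(1)[of k] by simp
    define D where "D = A k - A j"
    have C0: "0 \<le> C0" by (simp add: C0_def)
    have D: "0 < D" "C0 / e < D" using k(3) C0 e by (auto simp: D_def K_def add_nonneg_pos intro: le_less_trans[of _ "C0/e"]) (smt (verit) divide_nonneg_pos)
    define q where "q = C0 / D"
    have q: "0 \<le> q" "q \<le> e" using C0 D e by (auto simp: q_def field_simps)
    \<comment> \<open>Small enough for \<open>i\<close> and \<open>k\<close>, which lose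
      \<open>\<eta>\<close> and \<open>\<eta> * q\<close>, to stay nonnegative.\<close>
    define \<eta> where "\<eta> = min (v i) (v k / (q + 1))"
    have \<eta>: "0 < \<eta>" "\<eta> \<le> v i" using vi vk q by (auto simp: \<eta>_def)
    have "\<eta> \<le> v k / (q + 1)" by (simp add: \<eta>_def)
    then have "\<eta> * (q + 1) \<le> v k" using q by (simp add: field_simps)
    then have \<eta>q: "\<eta> * q \<le> v k" using \<eta> by (simp add: algebra_simps)
    \<comment> \<open>Total mass is unchanged: \<open>i\<close> gives \<open>\<eta>\<close>,
      \<open>k\<close> gives \<open>\<eta> * q\<close>, and \<open>j\<close> receives both.\<close>
    define p where "p x = (if x = i then - \<eta> else if x = j then \<eta> * (1 + q) else if x = k then - \<eta> * q else 0)" for x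
    have p: "(h has_sum (F i * (- \<eta>) + F j * (\<eta> * (1 + q)) + F k * (- \<eta> * q))) I"
      if "h = (\<lambda>x. F x * p x)" for F h
    proof -
      have "(h has_sum (\<Sum>x\<in>{i,j,k}. h x)) {i,j,k}" by (rule has_sum_finite) auto
      then have "(h has_sum (\<Sum>x\<in>{i,j,k}. h x)) I"
        by (subst has_sum_cong_neutral[where T = "{i,j,k}" and g = h]) (use i j k that in \<open>auto simp: p_def\<close>)
      then show ?thesis using j k that by (simp add: p_def algebra_simps)
    qed
    define w where "w x = v x + p x" for x
    have w0: "0 \<le> w x" if "x \<in> I" for x
      using V(1)[OF that] \<eta> \<eta>q q by (auto simp: w_def p_def)
    have s1: "(w has_sum (infsum v I + 0)) I"
      unfolding w_def using V(2) p[of p "\<lambda>_. 1"]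
      by (intro has_sum_add) (auto simp: algebra_simps)
    have s2: "((\<lambda>x. A x * w x) has_sum ((\<Sum>\<^sub>\<infinity>x\<in>I. A x * v x) + (A i * (- \<eta>) + A j * (\<eta> * (1 + q)) + A k * (- \<eta> * q)))) I"
    proof -
      have "((\<lambda>x. A x * v x + A x * p x) has_sum
          ((\<Sum>\<^sub>\<infinity>x\<in>I. A x * v x) + (A i * (- \<eta>) + A j * (\<eta> * (1 + q)) + A k * (- \<eta> * q)))) I"
        by (intro has_sum_add has_sum_infsum V(3) p refl)
      then show ?thesis by (simp add: w_def distrib_left)
    qed
    \<comment> \<open>Since \<open>D * q = C0\<close>, the budget released by moving mass from
      \<open>k\<close> to \<open>j\<close> pays for the move from \<open>i\<close> to
      \<open>j\<close>.\<close>
    have "A i * (- \<eta>) + A j * (\<eta> * (1 + q)) + A k * (- \<eta> * q) = \<eta> * ((A j - A i) - D * q)"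
      by (simp add: D_def algebra_simps)
    also have "\<dots> \<le> 0" using \<eta> D by (simp add: q_def C0_def mult_le_0_iff)
    finally have wA: "(\<Sum>\<^sub>\<infinity>x\<in>I. A x * w x) \<le> \<rho>" using infsumI[OF s2] V(4) by linarith
    have w: "w \<in> feasible"
      using w0 wA V(5) s1 s2 infsumI[OF s1] by (auto simp: feasible_def summable_on_def)
    have "((\<lambda>x. c x * (v x * w x)) has_sum (form v v + (c i * v i * (- \<eta>) + c j * v j * (\<eta> * (1 + q)) + c k * v k * (- \<eta> * q)))) I"
    proof -
      have "((\<lambda>x. c x * (v x * v x) + c x * (v x * p x)) has_sum
          (form v v + (c i * v i * (- \<eta>) + c j * v j * (\<eta> * (1 + q)) + c k * v k * (- \<eta> * q)))) I"
        unfolding form_def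
        by (rule has_sum_add[OF has_sum_infsum[OF form_summable[OF v v]]], rule p) (simp add: mult.assoc)
      then show ?thesis by (simp add: w_def distrib_left)
    qed
    then have "form v w = form v v + (c i * v i * (- \<eta>) + c j * v j * (\<eta> * (1 + q)) + c k * v k * (- \<eta> * q))"
      unfolding form_def by (rule infsumI)
    with variational_inequality[OF v min w]
    have "0 \<le> \<eta> * (- (c i * v i) + c j * v j * (1 + q) - c k * v k * q)"
      by (simp add: algebra_simps)
    then have "c i * v i \<le> c j * v j * (1 + q) - c k * v k * q"
      using \<eta> by (simp add: zero_le_mult_iff)
    also have "\<dots> \<le> c j * v j * (1 + e)"
      using q gj vk c_pos[OF k(1)] mult_left_mono[OF q(2) gj] by (simp add: algebra_simps) (smt (verit) mult_nonneg_nonneg)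
    finally have "c i * v i - c j * v j \<le> (c j * v j + 1) * e" using e by (simp add: algebra_simps)
    also have "\<dots> = (c i * v i - c j * v j) / 2" using gj by (simp add: e_def field_simps)
    finally show False using lt by simp
  qed
  have Cpos: "0 < C" using c_pos[OF i(1)] c_le[OF i(1)] by linarith
  define m where "m = c i * v i / C"
  have m: "0 < m" using Cpos vi c_pos[OF i(1)] by (simp add: m_def)
  have "m \<le> v j" if j: "j \<in> I" for j
  proof -
    have "c i * v i \<le> c j * v j" using gmin[OF j] by (cases "j = i") auto
    also have "\<dots> \<le> C * v j" using c_le[OF j] V(1)[OF j] by (rule mult_right_mono)
    finally show ?thesis using Cpos by (simp add: m_def field_simps)
  qed
  note mv = this
  obtain N :: nat where N: "infsum v I < real N * m"
    using reals_Archimedean3[OF m] by blast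
  obtain X where X: "finite X" "card X = N" "X \<subseteq> I"
    using infinite_arbitrarily_large[OF infinite_I] by blast
  have "real N * m = (\<Sum>x\<in>X. m)" using X by simp
  also have "\<dots> \<le> sum v X" using X mv by (intro sum_mono) auto
  also have "\<dots> \<le> infsum v I" using X V(1,2) by (intro finite_sum_le_infsum) auto
  finally show False using N by simp
qed

end

section \<open>Independent Gaussian coordinates\<close>

abbreviation std_normal :: "real measure" where
  "std_normal \<equiv> std_normal_distribution"

section \<open>Moments, exponential moments and translations of a single Gaussian\<close>

lemma integrable_std_normal_iff:
  "f \<in> borel_measurable borel \<Longrightarrow>
    integrable std_normal f \<longleftrightarrow> integrable lborel (\<lambda>x. std_normal_density x * f x)" for f :: "real \<Rightarrow> real"
  by (subst integrable_density) auto

lemma integral_std_normal_eq: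
  "f \<in> borel_measurable borel \<Longrightarrow>
    integral\<^sup>L std_normal f = (\<integral>x. std_normal_density x * f x \<partial>lborel)" for f :: "real \<Rightarrow> real"
  by (subst integral_density) auto

text \<open>Completing the square: against the standard normal density the integrand becomes a
  multiple of the normal density with mean \<open>z / (1 - l)\<close> and variance
  \<open>1 / (1 - l)\<close>. The case \<open>l = 0\<close> is the Laplace transform.\<close>

lemma std_normal_exp_quadratic:
  fixes l z :: real
  assumes "l < 1"
  shows "integrable std_normal (\<lambda>x. exp (l * x\<^sup>2 / 2 + z * x))"
    and "(\<integral>x. exp (l * x\<^sup>2 / 2 + z * x) \<partial>std_normal) = exp (z\<^sup>2 / (2 * (1 - l))) / sqrt (1 - l)"
proof -
  let ?c = "exp (z\<^sup>2 / (2 * (1 - l))) / sqrt (1 - l)"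
  let ?n = "normal_density (z / (1 - l)) (1 / sqrt (1 - l))"
  have l: "0 < 1 - l" using assms by simp
  have e: "l * x\<^sup>2 / 2 + z * x - x\<^sup>2 / 2 = z\<^sup>2 / (2 * (1 - l)) - (x - z / (1 - l))\<^sup>2 * (1 - l) / 2" for x
  proof -
    define m where "m = 1 - l"
    have m: "m \<noteq> 0" "l = 1 - m" using l by (auto simp: m_def)
    have "(x - z / m)\<^sup>2 * m = x\<^sup>2 * m - 2 * x * z + z\<^sup>2 / m"
      using m(1) by (simp add: field_simps power2_eq_square)
    then show ?thesis unfolding m(2) by (simp add: field_simps)
  qed
  have eq: "std_normal_density x * exp (l * x\<^sup>2 / 2 + z * x) = ?c * ?n x" for x
  proof -
    have "std_normal_density x * exp (l * x\<^sup>2 / 2 + z * x) = exp (l * x\<^sup>2 / 2 + z * x - x\<^sup>2 / 2) / sqrt (2 * pi)"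
    proof -
      have "exp (- x\<^sup>2 / 2) * exp (l * x\<^sup>2 / 2 + z * x) = exp (l * x\<^sup>2 / 2 + z * x - x\<^sup>2 / 2)"
        by (simp flip: exp_add)
      then show ?thesis by (simp add: std_normal_density_def)
    qed
    also have "\<dots> = exp (z\<^sup>2 / (2 * (1 - l))) * exp (- ((x - z / (1 - l))\<^sup>2 * (1 - l) / 2)) / sqrt (2 * pi)"
      unfolding e by (simp flip: exp_add)
    also have "\<dots> = ?c * ?n x"
      using l by (simp add: normal_density_def real_sqrt_divide real_sqrt_mult power_divide field_simps)
    finally show ?thesis .
  qed
  have n: "0 < 1 / sqrt (1 - l)" using l by simp
  show "integrable std_normal (\<lambda>x. exp (l * x\<^sup>2 / 2 + z * x))"
    by (subst integrable_std_normal_iff) (auto simp: eq n intro!: integrable_mult_right integrable_normal_density[OF n])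
  show "(\<integral>x. exp (l * x\<^sup>2 / 2 + z * x) \<partial>std_normal) = ?c"
    by (subst integral_std_normal_eq) (auto simp: eq integral_normal_density[OF n])
qed

lemma std_normal_poly:
  "integrable std_normal (\<lambda>x. x)" "integrable std_normal (\<lambda>x. x\<^sup>2)"
  "(\<integral>x. x \<partial>std_normal) = 0" "(\<integral>x. x\<^sup>2 \<partial>std_normal) = 1"
  "(\<integral>x. x ^ 3 \<partial>std_normal) = 0" "(\<integral>x. x ^ 4 \<partial>std_normal) = 3"
  using integrable_std_normal_distribution_moment[of 1] integrable_std_normal_distribution_moment[of 2]
    integral_std_normal_distribution_moment_odd[of 1] integral_std_normal_distribution_moment_odd[of 3]
    std_normal_distribution_even_moments[of 1] std_normal_distribution_even_moments[of 2]
  by (auto simp: fact_numeral)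

lemma prob_space_std_normal: "prob_space std_normal"
  by (rule prob_space_normal_density) simp

lemma std_normal_sqminus1:
  "integrable std_normal (\<lambda>x. x\<^sup>2 - 1)" "(\<integral>x. x\<^sup>2 - 1 \<partial>std_normal) = 0"
proof -
  interpret prob_space std_normal by (rule prob_space_std_normal)
  show "integrable std_normal (\<lambda>x. x\<^sup>2 - 1)" using std_normal_poly by auto
  show "(\<integral>x. x\<^sup>2 - 1 \<partial>std_normal) = 0" using std_normal_poly prob_space by simp
qed

text \<open>\<open>x\<^sup>2 - 1\<close> and \<open>x\<close> are orthogonal Hermite polynomials
  with squared norms 2 and 1. One coordinate of the shifted and centred statistic has this
  form.\<close>

lemma std_normal_quadratic_sq:
  "integrable std_normal (\<lambda>x. (p * (x\<^sup>2 - 1) + q * x)\<^sup>2)"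
  "(\<integral>x. (p * (x\<^sup>2 - 1) + q * x)\<^sup>2 \<partial>std_normal) = 2 * p\<^sup>2 + q\<^sup>2"
proof -
  interpret prob_space std_normal by (rule prob_space_std_normal)
  note M = integrable_std_normal_distribution_moment
  have eq: "(\<lambda>x. (p * (x\<^sup>2 - 1) + q * x)\<^sup>2) = (\<lambda>x::real. p\<^sup>2 * x ^ 4 + 2 * p * q * x ^ 3 + (q\<^sup>2 - 2 * p\<^sup>2) * x\<^sup>2
      + (- 2 * p * q) * x ^ 1 + p\<^sup>2)"
    by (auto simp: power2_eq_square algebra_simps power4_eq_xxxx power3_eq_cube)
  show "integrable std_normal (\<lambda>x. (p * (x\<^sup>2 - 1) + q * x)\<^sup>2)"
    unfolding eq by (intro Bochner_Integration.integrable_add integrable_mult_right M integrable_const)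
  have "(\<integral>x. (p * (x\<^sup>2 - 1) + q * x)\<^sup>2 \<partial>std_normal) = p\<^sup>2 * 3 + (q\<^sup>2 - 2 * p\<^sup>2) + p\<^sup>2"
    unfolding eq using M[of 1] M[of 2] M[of 3] M[of 4] std_normal_poly prob_space by simp
  then show "(\<integral>x. (p * (x\<^sup>2 - 1) + q * x)\<^sup>2 \<partial>std_normal) = 2 * p\<^sup>2 + q\<^sup>2" by simp
qed

text \<open>Cameron-Martin formula on the line: the weight is the density of \<open>N(z, 1)\<close>
  with respect to \<open>N(0, 1)\<close>.\<close>

lemma std_normal_shift:
  assumes A[measurable]: "A \<in> sets borel"
  shows "(\<integral>\<^sup>+x. ennreal (exp (z * x - z\<^sup>2 / 2)) * indicator A x \<partial>std_normal)
    = emeasure std_normal ((\<lambda>x. z + x) -` A)"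
proof -
  have "(\<integral>\<^sup>+x. ennreal (exp (z * x - z\<^sup>2 / 2)) * indicator A x \<partial>std_normal)
    = (\<integral>\<^sup>+x. ennreal (std_normal_density x) * (ennreal (exp (z * x - z\<^sup>2 / 2)) * indicator A x) \<partial>lborel)"
    by (subst nn_integral_density) auto
  also have "\<dots> = (\<integral>\<^sup>+x. ennreal (std_normal_density (x - z)) * indicator A x \<partial>lborel)"
  proof (rule nn_integral_cong)
    fix x
    have "std_normal_density x * exp (z * x - z\<^sup>2 / 2) = std_normal_density (x - z)"
      by (simp add: std_normal_density_def power2_eq_square algebra_simps diff_divide_distrib add_divide_distrib flip: exp_add)
    then have "ennreal (std_normal_density x) * ennreal (exp (z * x - z\<^sup>2 / 2)) = ennreal (std_normal_density (x - z))"
      by (simp flip: ennreal_mult')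
    then show "ennreal (std_normal_density x) * (ennreal (exp (z * x - z\<^sup>2 / 2)) * indicator A x)
      = ennreal (std_normal_density (x - z)) * indicator A x"
      by (simp add: mult.assoc[symmetric])
  qed
  also have "\<dots> = (\<integral>\<^sup>+x. ennreal (std_normal_density x) * indicator A (z + x) \<partial>lborel)"
    by (subst nn_integral_real_affine[where c = 1 and t = z]) auto
  also have "\<dots> = (\<integral>\<^sup>+x. indicator ((\<lambda>x. z + x) -` A) x \<partial>std_normal)"
    by (subst nn_integral_density) (auto simp: indicator_def)
  also have "\<dots> = emeasure std_normal ((\<lambda>x. z + x) -` A)"
    using measurable_sets[of "\<lambda>x. z + x" borel borel A] by (subst nn_integral_indicator) auto
  finally show ?thesis .
qed

section \<open>The sequence of independent standard Gaussian coordinates\<close>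

locale gaussian_sequence =
  fixes I :: "'i set"

sublocale gaussian_sequence \<subseteq> product_prob_space "\<lambda>_. std_normal" I
  by (rule product_prob_spaceI[OF prob_space_std_normal])

context gaussian_sequence
begin

abbreviation "G \<equiv> Pi\<^sub>M I (\<lambda>_. std_normal)"

lemma sets_G: "sets G = sets (Pi\<^sub>M I (\<lambda>_. borel))"
  by (intro sets_PiM_cong) auto

lemma measurable_coord[measurable]: "k \<in> I \<Longrightarrow> (\<lambda>\<xi>. \<xi> k) \<in> borel_measurable G"
  using measurable_component_singleton[of k I "\<lambda>_. std_normal"] by simp

lemma distr_coord: "k \<in> I \<Longrightarrow> distr G borel (\<lambda>\<xi>. \<xi> k) = std_normal"
proof -
  assume "k \<in> I"
  have "distr G borel (\<lambda>\<xi>. \<xi> k) = distr G std_normal (\<lambda>\<xi>. \<xi> k)"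
    by (rule distr_cong) auto
  also have "\<dots> = std_normal" using \<open>k \<in> I\<close> by (rule PiM_component)
  finally show ?thesis .
qed

lemma indep_coords:
  assumes "S \<subseteq> I" "\<And>k. k \<in> S \<Longrightarrow> f k \<in> borel_measurable borel"
  shows "indep_vars (\<lambda>_. borel) (\<lambda>k \<xi>. f k (\<xi> k)) S"
proof (cases "I = {}")
  case True
  then have "S = {}" using assms by blast
  then show ?thesis by (simp add: indep_vars_def2 indep_sets_def)
next
  case False
  have "indep_vars (\<lambda>_. borel) (\<lambda>k \<xi>. \<xi> k) I"
  proof (subst indep_vars_iff_distr_eq_PiM'[OF False])
    have "distr G (Pi\<^sub>M I (\<lambda>_. borel)) (\<lambda>x. \<lambda>i\<in>I. x i) = distr G G (\<lambda>x. x)"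
      by (intro distr_cong) (auto simp: sets_G space_PiM)
    also have "\<dots> = Pi\<^sub>M I (\<lambda>i. distr G borel (\<lambda>x. x i))"
      by (auto simp: distr_coord cong: PiM_cong)
    finally show "distr G (Pi\<^sub>M I (\<lambda>_. borel)) (\<lambda>x. \<lambda>i\<in>I. x i) = Pi\<^sub>M I (\<lambda>i. distr G borel (\<lambda>x. x i))" .
  qed auto
  then have "indep_vars (\<lambda>_. borel) (\<lambda>k \<xi>. \<xi> k) S" using assms by (rule_tac indep_vars_subset)
  then show ?thesis using assms(2) by (rule indep_vars_compose2)
qed

lemma integral_coord:
  fixes f :: "real \<Rightarrow> real"
  assumes "k \<in> I" "f \<in> borel_measurable borel"
  shows "(\<integral>\<xi>. f (\<xi> k) \<partial>G) = integral\<^sup>L std_normal f"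
  using assms integral_distr[of "\<lambda>\<xi>. \<xi> k" G borel f] by (simp add: distr_coord)

lemma integrable_coord:
  fixes f :: "real \<Rightarrow> real"
  assumes "k \<in> I" "f \<in> borel_measurable borel" "integrable std_normal f"
  shows "integrable G (\<lambda>\<xi>. f (\<xi> k))"
  using assms integrable_distr_eq[of "\<lambda>\<xi>. \<xi> k" G borel f] by (simp add: distr_coord)

lemma nn_integral_coord:
  assumes "k \<in> I" "f \<in> borel_measurable borel"
  shows "(\<integral>\<^sup>+\<xi>. f (\<xi> k) \<partial>G) = integral\<^sup>N std_normal f"
  using assms nn_integral_distr[of "\<lambda>\<xi>. \<xi> k" G borel f] by (simp add: distr_coord)

lemma prod_coords:
  fixes f :: "'i \<Rightarrow> real \<Rightarrow> real"
  assumes "S \<subseteq> I" "finite S" and [measurable]: "\<And>k. k \<in> S \<Longrightarrow> f k \<in> borel_measurable borel"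
    and int: "\<And>k. k \<in> S \<Longrightarrow> integrable std_normal (f k)"
  shows "integrable G (\<lambda>\<xi>. \<Prod>k\<in>S. f k (\<xi> k))"
    and "(\<integral>\<xi>. (\<Prod>k\<in>S. f k (\<xi> k)) \<partial>G) = (\<Prod>k\<in>S. integral\<^sup>L std_normal (f k))"
proof -
  have i: "integrable G (\<lambda>\<xi>. f k (\<xi> k))" if "k \<in> S" for k
    using assms that by (intro integrable_coord) auto
  show "integrable G (\<lambda>\<xi>. \<Prod>k\<in>S. f k (\<xi> k))"
    using assms i by (intro indep_vars_integrable indep_coords)
  have "(\<integral>\<xi>. (\<Prod>k\<in>S. f k (\<xi> k)) \<partial>G) = (\<Prod>k\<in>S. \<integral>\<xi>. f k (\<xi> k) \<partial>G)"
    using assms i by (intro indep_vars_lebesgue_integral indep_coords)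
  also have "\<dots> = (\<Prod>k\<in>S. integral\<^sup>L std_normal (f k))"
    using assms by (intro prod.cong refl integral_coord) auto
  finally show "(\<integral>\<xi>. (\<Prod>k\<in>S. f k (\<xi> k)) \<partial>G) = (\<Prod>k\<in>S. integral\<^sup>L std_normal (f k))" .
qed

text \<open>Independence and centring annihilate the off-diagonal products.\<close>

lemma second_moment_sum:
  fixes f :: "'i \<Rightarrow> real \<Rightarrow> real"
  assumes S: "S \<subseteq> I" "finite S" and f[measurable]: "\<And>k. k \<in> S \<Longrightarrow> f k \<in> borel_measurable borel"
    and int: "\<And>k. k \<in> S \<Longrightarrow> integrable std_normal (f k)" "\<And>k. k \<in> S \<Longrightarrow> integral\<^sup>L std_normal (f k) = 0"
    and sq: "\<And>k. k \<in> S \<Longrightarrow> integrable std_normal (\<lambda>x. (f k x)\<^sup>2)"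
  shows "integrable G (\<lambda>\<xi>. (\<Sum>k\<in>S. f k (\<xi> k))\<^sup>2)"
    and "(\<integral>\<xi>. (\<Sum>k\<in>S. f k (\<xi> k))\<^sup>2 \<partial>G) = (\<Sum>k\<in>S. \<integral>x. (f k x)\<^sup>2 \<partial>std_normal)"
proof -
  have p: "integrable G (\<lambda>\<xi>. f j (\<xi> j) * f k (\<xi> k)) \<and>
     (\<integral>\<xi>. f j (\<xi> j) * f k (\<xi> k) \<partial>G) = (if j = k then \<integral>x. (f k x)\<^sup>2 \<partial>std_normal else 0)"
    if jk: "j \<in> S" "k \<in> S" for j k
  proof (cases "j = k")
    case True
    then show ?thesis
      using integrable_coord[of k "\<lambda>x. (f k x)\<^sup>2"] integral_coord[of k "\<lambda>x. (f k x)\<^sup>2"] S jk sq[of k]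
      by (auto simp: power2_eq_square)
  next
    case False
    then show ?thesis
      using prod_coords[of "{j,k}" f] jk S int by auto
  qed
  have eq: "(\<lambda>\<xi>. (\<Sum>k\<in>S. f k (\<xi> k))\<^sup>2) = (\<lambda>\<xi>. \<Sum>j\<in>S. \<Sum>k\<in>S. f j (\<xi> j) * f k (\<xi> k))"
    by (simp add: power2_eq_square sum_product)
  show "integrable G (\<lambda>\<xi>. (\<Sum>k\<in>S. f k (\<xi> k))\<^sup>2)"
    unfolding eq using p by (intro Bochner_Integration.integrable_sum) auto
  have "(\<integral>\<xi>. (\<Sum>k\<in>S. f k (\<xi> k))\<^sup>2 \<partial>G) = (\<Sum>j\<in>S. \<Sum>k\<in>S. if j = k then \<integral>x. (f k x)\<^sup>2 \<partial>std_normal else 0)"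
    unfolding eq using p by (simp add: Bochner_Integration.integral_sum Bochner_Integration.integrable_sum)
  also have "\<dots> = (\<Sum>k\<in>S. \<integral>x. (f k x)\<^sup>2 \<partial>std_normal)"
    using S by (simp add: sum.delta)
  finally show "(\<integral>\<xi>. (\<Sum>k\<in>S. f k (\<xi> k))\<^sup>2 \<partial>G) = (\<Sum>k\<in>S. \<integral>x. (f k x)\<^sup>2 \<partial>std_normal)" .
qed

lemma measurable_sum_coords[measurable]:
  fixes f :: "'i \<Rightarrow> real \<Rightarrow> real"
  assumes "S \<subseteq> I" "\<And>k. k \<in> S \<Longrightarrow> f k \<in> borel_measurable borel"
  shows "(\<lambda>\<xi>. \<Sum>k\<in>S. f k (\<xi> k)) \<in> borel_measurable G"
  using assms by (intro borel_measurable_sum) auto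

lemma measurable_prod_coords[measurable]:
  fixes f :: "'i \<Rightarrow> real \<Rightarrow> real"
  assumes "S \<subseteq> I" "\<And>k. k \<in> S \<Longrightarrow> f k \<in> borel_measurable borel"
  shows "(\<lambda>\<xi>. \<Prod>k\<in>S. f k (\<xi> k)) \<in> borel_measurable G"
  using assms by (intro borel_measurable_prod) auto

lemma chebyshev_sum:
  fixes f :: "'i \<Rightarrow> real \<Rightarrow> real"
  assumes S: "S \<subseteq> I" "finite S" and f[measurable]: "\<And>k. k \<in> S \<Longrightarrow> f k \<in> borel_measurable borel"
    and int: "\<And>k. k \<in> S \<Longrightarrow> integrable std_normal (f k)" "\<And>k. k \<in> S \<Longrightarrow> integral\<^sup>L std_normal (f k) = 0"
    and sq: "\<And>k. k \<in> S \<Longrightarrow> integrable std_normal (\<lambda>x. (f k x)\<^sup>2)" and \<eta>: "0 < \<eta>"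
  shows "prob {\<xi> \<in> space G. \<eta> \<le> \<bar>\<Sum>k\<in>S. f k (\<xi> k)\<bar>} \<le> (\<Sum>k\<in>S. \<integral>x. (f k x)\<^sup>2 \<partial>std_normal) / \<eta>\<^sup>2"
proof -
  have "prob {\<xi> \<in> space G. \<eta>\<^sup>2 \<le> (\<Sum>k\<in>S. f k (\<xi> k))\<^sup>2} \<le> (\<integral>\<xi>. (\<Sum>k\<in>S. f k (\<xi> k))\<^sup>2 \<partial>G) / \<eta>\<^sup>2"
    using second_moment_sum(1)[of S f] assms
    by (intro integral_Markov_inequality_measure[where A = "{}"]) auto
  moreover have "\<eta>\<^sup>2 \<le> x\<^sup>2 \<longleftrightarrow> \<eta> \<le> \<bar>x\<bar>" for x
    using \<eta> abs_le_square_iff[of \<eta> x] by simp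
  ultimately show ?thesis using second_moment_sum(2)[of S f] assms by simp
qed

end

section \<open>Shifts and the central limit theorem\<close>

context gaussian_sequence
begin

text \<open>Cameron-Martin formula for shifts in finitely many coordinates. It suffices to compare
  the two measures on cylinder rectangles, where both factorise and the formula on the line applies
  to each coordinate.\<close>

lemma shift_density:
  fixes z :: "'i \<Rightarrow> real"
  assumes S: "S \<subseteq> I" "finite S" and z: "\<And>k. k \<in> I - S \<Longrightarrow> z k = 0"
  shows "distr G G (\<lambda>\<xi>. \<lambda>k\<in>I. z k + \<xi> k)
    = density G (\<lambda>\<xi>. ennreal (\<Prod>k\<in>S. exp (z k * \<xi> k - (z k)\<^sup>2 / 2)))"
proof (rule measure_eqI_PiM_infinite)
  have meas[measurable]: "(\<lambda>\<xi>. \<lambda>k\<in>I. z k + \<xi> k) \<in> G \<rightarrow>\<^sub>M G"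
    by (rule measurable_restrict) simp
  have [measurable]: "(\<lambda>\<xi>. \<Prod>k\<in>S. exp (z k * \<xi> k - (z k)\<^sup>2 / 2)) \<in> borel_measurable G"
    using S by (intro measurable_prod_coords) auto
  show "finite_measure (distr G G (\<lambda>\<xi>. \<lambda>k\<in>I. z k + \<xi> k))"
    by (intro finite_measure_distr meas)
  fix A J assume J: "finite J" "J \<subseteq> I" and A: "\<And>i. i \<in> J \<Longrightarrow> A i \<in> sets std_normal"
  have A'[measurable]: "A i \<in> sets borel" if "i \<in> J" for i using A[OF that] by simp
  let ?E = "prod_emb I (\<lambda>_. std_normal) J (Pi\<^sub>E J A)"
  have E[measurable]: "?E \<in> sets G" using J A by (intro sets_PiM_I) auto
  have vim: "(\<lambda>x. z i + x) -` A i \<in> sets borel" if "i \<in> J" for i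
    using measurable_sets[of "\<lambda>x. z i + x" borel borel "A i"] A'[OF that] by simp
  have "emeasure (distr G G (\<lambda>\<xi>. \<lambda>k\<in>I. z k + \<xi> k)) ?E
    = emeasure G (prod_emb I (\<lambda>_. std_normal) J (Pi\<^sub>E J (\<lambda>i. (\<lambda>x. z i + x) -` A i)))"
    using J by (subst emeasure_distr[OF meas E]) (auto simp: prod_emb_def space_PiM PiE_iff subset_iff intro!: arg_cong[where f = "emeasure G"])
  also have "\<dots> = (\<Prod>i\<in>J. emeasure std_normal ((\<lambda>x. z i + x) -` A i))"
    using J vim by (intro emeasure_PiM_emb) auto
  finally have 1: "emeasure (distr G G (\<lambda>\<xi>. \<lambda>k\<in>I. z k + \<xi> k)) ?E
    = (\<Prod>i\<in>J. emeasure std_normal ((\<lambda>x. z i + x) -` A i))" .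
  \<comment> \<open>One factor per coordinate of \<open>J \<union> S\<close>: the indicator is
    dropped outside the base \<open>J\<close> of the cylinder, and the density factor is 1 outside
    \<open>S\<close>, where \<open>z\<close> vanishes.\<close>
  define h where "h k x = ennreal (exp (z k * x - (z k)\<^sup>2 / 2)) * (if k \<in> J then indicator (A k) x else 1)" for k x
  have h[measurable]: "h k \<in> borel_measurable borel" for k
    unfolding h_def by (cases "k \<in> J") auto
  have "emeasure (density G (\<lambda>\<xi>. ennreal (\<Prod>k\<in>S. exp (z k * \<xi> k - (z k)\<^sup>2 / 2)))) ?E
    = (\<integral>\<^sup>+\<xi>. ennreal (\<Prod>k\<in>S. exp (z k * \<xi> k - (z k)\<^sup>2 / 2)) * indicator ?E \<xi> \<partial>G)"
    by (subst emeasure_density) auto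
  also have "\<dots> = (\<integral>\<^sup>+\<xi>. (\<Prod>k\<in>J \<union> S. h k (\<xi> k)) \<partial>G)"
  proof (rule nn_integral_cong)
    fix \<xi> assume \<xi>: "\<xi> \<in> space G"
    have "indicator ?E \<xi> = (\<Prod>k\<in>J. indicator (A k) (\<xi> k) :: ennreal)"
    proof (cases "\<forall>k\<in>J. \<xi> k \<in> A k")
      case True
      then show ?thesis using \<xi> J by (auto simp: prod_emb_def space_PiM PiE_iff)
    next
      case False
      then have "(\<Prod>k\<in>J. indicator (A k) (\<xi> k) :: ennreal) = 0"
        using J by (auto simp: prod_zero_iff indicator_eq_0_iff)
      moreover have "\<xi> \<notin> ?E" using False by (auto simp: prod_emb_def PiE_iff)
      ultimately show ?thesis by simp
    qed
    also have "\<dots> = (\<Prod>k\<in>J \<union> S. if k \<in> J then indicator (A k) (\<xi> k) else 1)"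
      using J S by (intro prod.mono_neutral_cong_left) auto
    finally have i: "indicator ?E \<xi> = (\<Prod>k\<in>J \<union> S. if k \<in> J then indicator (A k) (\<xi> k) else 1 :: ennreal)" .
    have "(\<Prod>k\<in>S. exp (z k * \<xi> k - (z k)\<^sup>2 / 2)) = (\<Prod>k\<in>J \<union> S. exp (z k * \<xi> k - (z k)\<^sup>2 / 2))"
      using J S z by (intro prod.mono_neutral_left) auto
    then have "ennreal (\<Prod>k\<in>S. exp (z k * \<xi> k - (z k)\<^sup>2 / 2)) = (\<Prod>k\<in>J \<union> S. ennreal (exp (z k * \<xi> k - (z k)\<^sup>2 / 2)))"
      by (simp add: prod_ennreal)
    then show "ennreal (\<Prod>k\<in>S. exp (z k * \<xi> k - (z k)\<^sup>2 / 2)) * indicator ?E \<xi> = (\<Prod>k\<in>J \<union> S. h k (\<xi> k))"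
      unfolding i h_def by (simp add: prod.distrib)
  qed
  also have "\<dots> = (\<Prod>k\<in>J \<union> S. \<integral>\<^sup>+\<xi>. h k (\<xi> k) \<partial>G)"
  proof -
    have "indep_vars (\<lambda>_. borel) (\<lambda>k \<xi>. \<xi> k) (J \<union> S)"
      using indep_coords[of "J \<union> S" "\<lambda>_ x. x"] J S by auto
    then have "indep_vars (\<lambda>_. borel) (\<lambda>k \<xi>. h k (\<xi> k)) (J \<union> S)"
      by (rule indep_vars_compose2) auto
    then show ?thesis using J S by (intro indep_vars_nn_integral) auto
  qed
  also have "\<dots> = (\<Prod>k\<in>J \<union> S. if k \<in> J then emeasure std_normal ((\<lambda>x. z k + x) -` A k) else 1)"
  proof (rule prod.cong[OF refl])
    fix k assume k: "k \<in> J \<union> S"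
    have "(\<integral>\<^sup>+\<xi>. h k (\<xi> k) \<partial>G) = integral\<^sup>N std_normal (h k)"
      using k J S by (intro nn_integral_coord) auto
    also have "\<dots> = (if k \<in> J then emeasure std_normal ((\<lambda>x. z k + x) -` A k) else 1)"
    proof (cases "k \<in> J")
      case True
      then show ?thesis using std_normal_shift[of "A k" "z k"] A' by (simp add: h_def[abs_def])
    next
      case False
      then show ?thesis
        using std_normal_shift[of UNIV "z k"] prob_space.emeasure_space_1[OF prob_space_std_normal]
        by (simp add: h_def[abs_def])
    qed
    finally show "(\<integral>\<^sup>+\<xi>. h k (\<xi> k) \<partial>G) = (if k \<in> J then emeasure std_normal ((\<lambda>x. z k + x) -` A k) else 1)" .
  qed
  also have "\<dots> = (\<Prod>i\<in>J. emeasure std_normal ((\<lambda>x. z i + x) -` A i))"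
    using J S by (intro prod.mono_neutral_cong_right) auto
  finally show "emeasure (distr G G (\<lambda>\<xi>. \<lambda>k\<in>I. z k + \<xi> k)) ?E
    = emeasure (density G (\<lambda>\<xi>. ennreal (\<Prod>k\<in>S. exp (z k * \<xi> k - (z k)\<^sup>2 / 2)))) ?E"
    using 1 by simp
qed simp_all

lemma prob_shift:
  fixes z :: "'i \<Rightarrow> real"
  assumes S: "S \<subseteq> I" "finite S" and z: "\<And>k. k \<in> I - S \<Longrightarrow> z k = 0" and B: "B \<in> sets G"
  shows "prob {\<xi> \<in> space G. (\<lambda>k\<in>I. z k + \<xi> k) \<in> B}
    = (\<integral>\<xi>. (\<Prod>k\<in>S. exp (z k * \<xi> k - (z k)\<^sup>2 / 2)) * indicator B \<xi> \<partial>G)"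
proof -
  have [measurable]: "(\<lambda>\<xi>. \<lambda>k\<in>I. z k + \<xi> k) \<in> G \<rightarrow>\<^sub>M G"
    by (rule measurable_restrict) simp
  have m[measurable]: "(\<lambda>\<xi>. \<Prod>k\<in>S. exp (z k * \<xi> k - (z k)\<^sup>2 / 2)) \<in> borel_measurable G"
    using S by (intro measurable_prod_coords) auto
  have "prob {\<xi> \<in> space G. (\<lambda>k\<in>I. z k + \<xi> k) \<in> B} = measure (distr G G (\<lambda>\<xi>. \<lambda>k\<in>I. z k + \<xi> k)) B"
    using B by (subst measure_distr) (auto intro!: arg_cong[where f = prob])
  also have "\<dots> = measure (density G (\<lambda>\<xi>. ennreal (\<Prod>k\<in>S. exp (z k * \<xi> k - (z k)\<^sup>2 / 2)))) B"
    using shift_density[OF S z] by simp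
  also have "\<dots> = (\<integral>\<xi>. (\<Prod>k\<in>S. exp (z k * \<xi> k - (z k)\<^sup>2 / 2)) * indicator B \<xi> \<partial>G)"
    using B by (simp add: measure_def emeasure_density integral_eq_nn_integral prod_nonneg flip: ennreal_indicator ennreal_mult')
  finally show ?thesis .
qed

end

section \<open>The standard normal distribution function\<close>

lemma Phi_eq: "Phi x = measure std_normal {..x}"
  by (simp add: Phi_def cdf_def)

lemma Phi_mono: "x \<le> y \<Longrightarrow> Phi x \<le> Phi y"
proof -
  interpret N: real_distribution std_normal by (rule real_dist_normal_dist)
  show "x \<le> y \<Longrightarrow> Phi x \<le> Phi y"
    unfolding Phi_def by (rule N.cdf_nondecreasing)
qed

lemma Phi_diff:
  assumes "x \<le> y"
  shows "Phi y - Phi x = (\<integral>t. std_normal_density t * indicator {x<..y} t \<partial>lborel)"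
proof -
  interpret N: real_distribution std_normal by (rule real_dist_normal_dist)
  have "Phi y - Phi x = measure std_normal {x<..y}"
    using assms unfolding Phi_def by (cases "x = y") (auto simp: N.cdf_diff_eq)
  also have "\<dots> = (\<integral>t. indicator {x<..y} t \<partial>std_normal)"
    by simp
  also have "\<dots> = (\<integral>t. std_normal_density t * indicator {x<..y} t \<partial>lborel)"
    by (subst integral_std_normal_eq) auto
  finally show ?thesis .
qed

lemma std_normal_density_le_1: "std_normal_density t \<le> 1"
proof -
  have "1 \<le> sqrt (2 * pi)" using pi_gt3 by (simp add: real_le_rsqrt)
  then have "1 / sqrt (2 * pi) * exp (- t\<^sup>2 / 2) \<le> 1 * 1"
    by (intro mult_mono) auto
  then show ?thesis by (simp add: std_normal_density_def)
qed

lemma Phi_lipschitz: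
  assumes "x \<le> y"
  shows "Phi y - Phi x \<le> y - x"
proof -
  have "Phi y - Phi x \<le> (\<integral>t. indicator {x<..y} t \<partial>lborel)"
    unfolding Phi_diff[OF assms]
  proof (rule integral_mono)
    show "integrable lborel (\<lambda>t. std_normal_density t * indicator {x<..y} t)"
      by (rule integrable_real_mult_indicator[simplified mult.commute]) auto
    show "integrable lborel (indicator {x<..y} :: real \<Rightarrow> real)"
      using assms by (auto simp: emeasure_lborel_Ioc)
    show "std_normal_density t * indicator {x<..y} t \<le> (indicator {x<..y} t :: real)" for t
      using std_normal_density_le_1[of t] by (simp add: indicator_def)
  qed
  then show ?thesis using assms by simp
qed

lemma Phi_strict:
  assumes "x < y"
  shows "Phi x < Phi y"
proof -
  have "0 < Phi y - Phi x"
  proof -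
    have i: "integrable lborel (\<lambda>t. std_normal_density t * indicator {x<..y} t)"
      by (rule integrable_real_mult_indicator[simplified mult.commute]) auto
    have "0 \<le> Phi y - Phi x" using Phi_mono[of x y] assms by simp
    moreover have "Phi y - Phi x \<noteq> 0"
    proof
      assume "Phi y - Phi x = 0"
      then have "AE t in lborel. std_normal_density t * indicator {x<..y} t = 0"
        using integral_nonneg_eq_0_iff_AE[OF i] Phi_diff[of x y] assms by simp
      then have "AE t in lborel. t \<notin> {x<..y}"
        by (rule AE_mp) (auto intro!: AE_I2 simp: indicator_def normal_density_pos less_imp_neq[OF normal_density_pos, symmetric])
      then have "emeasure lborel {x<..y} = 0"
        by (subst (asm) AE_iff_measurable[of "{x<..y}"]) auto
      then show False using assms by simp
    qed
    ultimately show ?thesis by linarith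
  qed
  then show ?thesis by simp
qed

lemma isCont_Phi: "isCont Phi x"
proof -
  have "\<bar>Phi y - Phi x\<bar> \<le> \<bar>y - x\<bar>" for y
    using Phi_lipschitz[of x y] Phi_lipschitz[of y x] Phi_mono[of x y] Phi_mono[of y x] by linarith
  then show ?thesis
    unfolding continuous_at_eps_delta by (auto simp: dist_real_def intro: le_less_trans)
qed

lemma Phi_lim: "(Phi \<longlongrightarrow> 1) at_top" "(Phi \<longlongrightarrow> 0) at_bot"
proof -
  interpret N: real_distribution std_normal by (rule real_dist_normal_dist)
  have "Phi = cdf std_normal" by (simp add: fun_eq_iff Phi_def)
  then show "(Phi \<longlongrightarrow> 1) at_top" "(Phi \<longlongrightarrow> 0) at_bot"
    using N.cdf_lim_at_top_prob N.cdf_lim_at_bot by auto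
qed

text \<open>Continuity gives a preimage of \<open>p\<close>, and strict monotonicity makes it the
  least point of the set in the definition.\<close>

lemma Phi_quantile_eq:
  assumes "0 < p" "p < 1"
  shows "Phi (Phi_quantile p) = p"
proof -
  obtain x where x: "Phi x < p"
    using order_tendstoD(2)[OF Phi_lim(2) assms(1)] by (auto simp: eventually_at_bot_linorder)
  obtain y where y: "p < Phi y"
    using order_tendstoD(1)[OF Phi_lim(1) assms(2)] by (auto simp: eventually_at_top_linorder)
  have "x \<le> y" using Phi_mono[of y x] x y by force
  then obtain q where q: "Phi q = p"
    using IVT[of Phi x p y] x y isCont_Phi by auto
  have "{x. p \<le> Phi x} = {q..}"
    using q Phi_mono Phi_strict by (auto simp: not_less[symmetric])
  then show ?thesis using q by (simp add: Phi_quantile_def)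
qed

text \<open>Polya's theorem: for monotone functions, pointwise convergence to a continuous
  distribution function is uniform. This permits evaluation points that vary with
  \<open>n\<close>.\<close>

lemma Phi_uniform_convergence:
  fixes F :: "nat \<Rightarrow> real \<Rightarrow> real"
  assumes mono: "\<And>n. mono (F n)" and F01: "\<And>n x. 0 \<le> F n x" "\<And>n x. F n x \<le> 1"
    and lim: "\<And>x. (\<lambda>n. F n x) \<longlonglongrightarrow> Phi x" and \<eta>: "0 < \<eta>"
  shows "\<forall>\<^sub>F n in sequentially. \<forall>x. \<bar>F n x - Phi x\<bar> \<le> \<eta>"
proof -
  obtain a where a: "Phi a < \<eta> / 2"
    using order_tendstoD(2)[OF Phi_lim(2), of "\<eta> / 2"] \<eta> by (auto simp: eventually_at_bot_linorder)
  obtain b where b: "1 - \<eta> / 2 < Phi b"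
    using order_tendstoD(1)[OF Phi_lim(1), of "1 - \<eta> / 2"] \<eta> by (auto simp: eventually_at_top_linorder)
  \<comment> \<open>A grid of mesh \<open>\<eta> / 2\<close>: as \<open>Phi\<close> has Lipschitz
    constant 1, it gains at most \<open>\<eta> / 2\<close> on a cell, and the other half is left for
    the error at the grid points.\<close>
  define y where "y i = a + real i * (\<eta> / 2)" for i :: nat
  obtain m :: nat where m: "(b - a) / (\<eta> / 2) \<le> real m"
    using real_arch_simple by blast
  define P where "P = insert b (y ` {..m + 1})"
  have "\<forall>p\<in>P. \<forall>\<^sub>F n in sequentially. \<bar>F n p - Phi p\<bar> < \<eta> / 2"
    using tendstoD[OF lim, of "\<eta> / 2"] \<eta> by (auto simp: dist_real_def)
  then have "\<forall>\<^sub>F n in sequentially. \<forall>p\<in>P. \<bar>F n p - Phi p\<bar> < \<eta> / 2"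
    by (intro eventually_ball_finite) (auto simp: P_def)
  then show ?thesis
  proof eventually_elim
    case (elim n)
    show ?case
    proof
      fix x
      have P01: "0 \<le> Phi x" "Phi x \<le> 1" by (auto simp: Phi_eq intro: prob_space.prob_le_1 prob_space_std_normal)
      consider "x < a" | "b < x" | "a \<le> x" "x \<le> b" by linarith
      then show "\<bar>F n x - Phi x\<bar> \<le> \<eta>"
      proof cases
        case 1
        have "a \<in> P" by (auto simp: P_def y_def image_iff intro!: bexI[of _ 0])
        then have "\<bar>F n a - Phi a\<bar> < \<eta> / 2" using elim by blast
        moreover have "F n x \<le> F n a" using mono 1 by (auto simp: mono_def)
        moreover have "Phi x \<le> Phi a" using Phi_mono 1 by simp
        ultimately show ?thesis using a F01(1)[of n x] P01 by linarith
      next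
        case 2
        have "\<bar>F n b - Phi b\<bar> < \<eta> / 2" using elim by (simp add: P_def)
        moreover have "F n b \<le> F n x" using mono 2 by (auto simp: mono_def)
        moreover have "Phi b \<le> Phi x" using Phi_mono 2 by simp
        ultimately show ?thesis using b F01(2)[of n x] P01 by linarith
      next
        case 3
        define i where "i = nat \<lfloor>(x - a) / (\<eta> / 2)\<rfloor>"
        have q: "0 \<le> (x - a) / (\<eta> / 2)" using 3 \<eta> by simp
        have i: "real i \<le> (x - a) / (\<eta> / 2)" "(x - a) / (\<eta> / 2) < real i + 1"
          using q by (auto simp: i_def of_nat_nat le_floor_iff floor_correct)
        have xy: "y i \<le> x" "x \<le> y (Suc i)" "y (Suc i) - y i = \<eta> / 2"
          using i \<eta> by (auto simp: y_def field_simps)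
        have "(x - a) / (\<eta> / 2) \<le> (b - a) / (\<eta> / 2)" using 3 \<eta> by (intro divide_right_mono) auto
        then have "real i \<le> real m" using i m by linarith
        then have "y i \<in> P" "y (Suc i) \<in> P" by (auto simp: P_def)
        then have "\<bar>F n (y i) - Phi (y i)\<bar> < \<eta> / 2" "\<bar>F n (y (Suc i)) - Phi (y (Suc i))\<bar> < \<eta> / 2"
          using elim by auto
        moreover have "F n (y i) \<le> F n x" "F n x \<le> F n (y (Suc i))" using mono xy by (auto simp: mono_def)
        moreover have "Phi (y i) \<le> Phi x" "Phi x \<le> Phi (y (Suc i))" using Phi_mono xy by auto
        moreover have "Phi (y (Suc i)) - Phi (y i) \<le> \<eta> / 2"
          using Phi_lipschitz[of "y i" "y (Suc i)"] xy by linarith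
        ultimately show ?thesis by linarith
      qed
    qed
  qed
qed

section \<open>Normal approximation of weighted centred chi-square sums\<close>

lemma integrable_sqminus1_cube: "integrable std_normal (\<lambda>x. \<bar>x\<^sup>2 - 1\<bar> ^ 3)"
proof -
  interpret prob_space std_normal by (rule prob_space_std_normal)
  have "integrable std_normal (\<lambda>x. (x\<^sup>2 + 1) ^ 3)"
  proof -
    have "(\<lambda>x::real. (x\<^sup>2 + 1) ^ 3) = (\<lambda>x. x ^ 6 + 3 * x ^ 4 + 3 * x ^ 2 + 1)"
      by (auto simp: algebra_simps power3_eq_cube simp flip: power_add)
    then show ?thesis
      using integrable_std_normal_distribution_moment by simp
  qed
  then show ?thesis
  proof (rule Bochner_Integration.integrable_bound)
    show "AE x in std_normal. norm (\<bar>x\<^sup>2 - 1\<bar> ^ 3) \<le> norm ((x\<^sup>2 + 1) ^ 3)"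
    proof (intro AE_I2)
      fix x :: real
      have "\<bar>x\<^sup>2 - 1\<bar> \<le> x\<^sup>2 + 1" by (auto simp: abs_le_iff)
      then have "\<bar>x\<^sup>2 - 1\<bar> ^ 3 \<le> (x\<^sup>2 + 1) ^ 3" by (intro power_mono) auto
      then show "norm (\<bar>x\<^sup>2 - 1\<bar> ^ 3) \<le> norm ((x\<^sup>2 + 1) ^ 3)" by simp
    qed
  qed auto
qed

context gaussian_sequence
begin

text \<open>The test statistic read in the rescaled data \<open>y / \<epsilon>\<close>, over a
  finite index set.\<close>

definition chi_sum :: "'i set \<Rightarrow> ('i \<Rightarrow> real) \<Rightarrow> ('i \<Rightarrow> real) \<Rightarrow> real" where
  "chi_sum S w \<xi> = (\<Sum>k\<in>S. w k * ((\<xi> k)\<^sup>2 - 1))"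

lemma measurable_chi_sum[measurable]: "S \<subseteq> I \<Longrightarrow> chi_sum S w \<in> borel_measurable G"
  unfolding chi_sum_def by (intro measurable_sum_coords) auto

text \<open>Lindeberg's comparison: each factor is replaced by the characteristic function of a
  centred Gaussian with the same variance \<open>2 * (w k)\<^sup>2\<close>, at a cost of order three
  and higher in \<open>w k\<close>, and a sum of cubes is at most \<open>\<kappa>\<close> times the
  sum of squares. The normalisation \<open>1 / 2\<close> means unit variance.\<close>

lemma char_chi_sum:
  assumes S: "S \<subseteq> I" "finite S" and w: "\<And>k. k \<in> S \<Longrightarrow> 0 \<le> w k" "\<And>k. k \<in> S \<Longrightarrow> w k \<le> \<kappa>"
    and w2: "(\<Sum>k\<in>S. (w k)\<^sup>2) = 1 / 2"
  shows "cmod (char (distr G borel (chi_sum S w)) t - char std_normal t)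
    \<le> (\<bar>t\<bar> ^ 3 * (\<integral>x. \<bar>x\<^sup>2 - 1\<bar> ^ 3 \<partial>std_normal) * \<kappa> + t ^ 4 * \<kappa>\<^sup>2) / 2"
proof -
  let ?K = "\<integral>x. \<bar>x\<^sup>2 - 1\<bar> ^ 3 \<partial>std_normal"
  let ?X = "\<lambda>k \<xi>. w k * ((\<xi> k)\<^sup>2 - 1)"
  let ?c = "\<lambda>k. char (distr G borel (?X k)) t"
  let ?e = "\<lambda>k. complex_of_real (exp (- t\<^sup>2 * (w k)\<^sup>2))"
  have K: "0 \<le> ?K" by (intro integral_nonneg_AE) auto
  have X[measurable]: "?X k \<in> borel_measurable G" if "k \<in> S" for k
    proof -
    have [measurable]: "(\<lambda>\<xi>. \<xi> k) \<in> borel_measurable G" using that S by auto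
    show ?thesis by measurable
  qed
  have "char (distr G borel (chi_sum S w)) t = (\<Prod>k\<in>S. ?c k)"
    unfolding chi_sum_def[abs_def] using S by (intro char_distr_sum indep_coords) auto
  moreover have "char std_normal t = (\<Prod>k\<in>S. ?e k)"
  proof -
    have "(\<Prod>k\<in>S. ?e k) = complex_of_real (exp (\<Sum>k\<in>S. - t\<^sup>2 * (w k)\<^sup>2))"
      using S by (simp add: exp_sum)
    also have "(\<Sum>k\<in>S. - t\<^sup>2 * (w k)\<^sup>2) = - t\<^sup>2 / 2"
      using w2 by (simp add: sum_negf flip: sum_distrib_left)
    finally show ?thesis by (simp add: char_std_normal_distribution)
  qed
  ultimately have "cmod (char (distr G borel (chi_sum S w)) t - char std_normal t) = cmod ((\<Prod>k\<in>S. ?c k) - (\<Prod>k\<in>S. ?e k))"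
    by simp
  \<comment> \<open>Factors of modulus at most 1 can be exchanged one at a time, the others never
    enlarging the error.\<close>
  also have "\<dots> \<le> (\<Sum>k\<in>S. cmod (?c k - ?e k))"
  proof (rule norm_prod_diff)
    fix k assume k: "k \<in> S"
    interpret D: real_distribution "distr G borel (?X k)"
      using k by (intro real_distribution_distr X)
    show "cmod (?c k) \<le> 1" by (rule D.cmod_char_le_1)
    show "cmod (?e k) \<le> 1" by simp
  qed
  also have "\<dots> \<le> (\<Sum>k\<in>S. (\<bar>t\<bar> ^ 3 * ?K * \<kappa> + t ^ 4 * \<kappa>\<^sup>2) * (w k)\<^sup>2)"
  proof (rule sum_mono)
    fix k assume k: "k \<in> S"
    have kI: "k \<in> I" using k S by auto
    let ?f = "\<lambda>x. w k * (x\<^sup>2 - 1)"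
    have i1: "integrable G (?X k)" "(\<integral>\<xi>. ?X k \<xi> \<partial>G) = 0"
      using integrable_coord[OF kI, of ?f] integral_coord[OF kI, of ?f] std_normal_sqminus1 by auto
    have i2: "integrable G (\<lambda>\<xi>. (?X k \<xi>)\<^sup>2)" "(\<integral>\<xi>. (?X k \<xi>)\<^sup>2 \<partial>G) = 2 * (w k)\<^sup>2"
      using integrable_coord[OF kI, of "\<lambda>x. (?f x)\<^sup>2"] integral_coord[OF kI, of "\<lambda>x. (?f x)\<^sup>2"]
        std_normal_quadratic_sq[of "w k" 0] by auto
    have i3: "integrable G (\<lambda>\<xi>. \<bar>?X k \<xi>\<bar> ^ 3)" "(\<integral>\<xi>. \<bar>?X k \<xi>\<bar> ^ 3 \<partial>G) = (w k) ^ 3 * ?K"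
    proof -
      have eq: "(\<lambda>x. \<bar>?f x\<bar> ^ 3) = (\<lambda>x. (w k) ^ 3 * \<bar>x\<^sup>2 - 1\<bar> ^ 3)"
        using w(1)[OF k] by (simp add: abs_mult power_mult_distrib)
      have "integrable std_normal (\<lambda>x. \<bar>?f x\<bar> ^ 3)"
        unfolding eq using integrable_sqminus1_cube by simp
      then show "integrable G (\<lambda>\<xi>. \<bar>?X k \<xi>\<bar> ^ 3)"
        using integrable_coord[OF kI, of "\<lambda>x. \<bar>?f x\<bar> ^ 3"] by simp
      show "(\<integral>\<xi>. \<bar>?X k \<xi>\<bar> ^ 3 \<partial>G) = (w k) ^ 3 * ?K"
        using integral_coord[OF kI, of "\<lambda>x. \<bar>?f x\<bar> ^ 3"] unfolding eq by simp
    qed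
    have wk: "0 \<le> w k" "w k \<le> \<kappa>" using w k by auto
    have "cmod (?c k - (1 - t\<^sup>2 * (2 * (w k)\<^sup>2) / 2))
        \<le> (t\<^sup>2 / 6) * expectation (\<lambda>\<xi>. min (6 * (?X k \<xi>)\<^sup>2) (\<bar>t\<bar> * \<bar>?X k \<xi>\<bar> ^ 3))"
      using i1 i2 k by (intro char_approx3') auto
    also have "\<dots> \<le> (t\<^sup>2 / 6) * expectation (\<lambda>\<xi>. \<bar>t\<bar> * \<bar>?X k \<xi>\<bar> ^ 3)"
    proof (intro mult_left_mono integral_mono)
      show i4: "integrable G (\<lambda>\<xi>. \<bar>t\<bar> * \<bar>?X k \<xi>\<bar> ^ 3)" using i3 by simp
      show "integrable G (\<lambda>\<xi>. min (6 * (?X k \<xi>)\<^sup>2) (\<bar>t\<bar> * \<bar>?X k \<xi>\<bar> ^ 3))"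
        using i2 i4 by (intro integrable_min) auto
    qed auto
    also have "\<dots> = \<bar>t\<bar> ^ 3 * ?K * (w k) ^ 3 / 6"
    proof -
      have "\<bar>t\<bar> ^ 3 = t\<^sup>2 * \<bar>t\<bar>" by (simp add: power3_eq_cube power2_eq_square)
      then show ?thesis using i3 by simp
    qed
    also have "\<dots> \<le> \<bar>t\<bar> ^ 3 * ?K * (\<kappa> * (w k)\<^sup>2)"
    proof -
      have "(w k) ^ 3 = w k * (w k)\<^sup>2" by (simp add: power3_eq_cube power2_eq_square)
      also have "\<dots> \<le> \<kappa> * (w k)\<^sup>2" using wk by (intro mult_right_mono) auto
      finally have "\<bar>t\<bar> ^ 3 * ?K * (w k) ^ 3 \<le> \<bar>t\<bar> ^ 3 * ?K * (\<kappa> * (w k)\<^sup>2)"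
        using K by (intro mult_left_mono) auto
      moreover have "0 \<le> \<bar>t\<bar> ^ 3 * ?K * (w k) ^ 3" using K wk by simp
      ultimately show ?thesis by linarith
    qed
    finally have 1: "cmod (?c k - (1 - t\<^sup>2 * (w k)\<^sup>2)) \<le> \<bar>t\<bar> ^ 3 * ?K * (\<kappa> * (w k)\<^sup>2)" by simp
    have 2: "cmod ((1 - t\<^sup>2 * (w k)\<^sup>2) - ?e k) \<le> t ^ 4 * (\<kappa>\<^sup>2 * (w k)\<^sup>2)"
    proof -
      define x where "x = t\<^sup>2 * (w k)\<^sup>2"
      have x: "0 \<le> x" by (simp add: x_def)
      have "\<bar>(1 - x) - exp (- x)\<bar> \<le> x\<^sup>2"
      proof -
        have "1 - x \<le> exp (- x)" using exp_ge_add_one_self[of "- x"] by simp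
        moreover have "exp (- x) \<le> 1 - x + x\<^sup>2"
        proof -
          have "exp (- x) \<le> 1 / (1 + x)"
            using exp_ge_add_one_self[of x] x by (simp add: exp_minus field_simps)
          also have "\<dots> \<le> 1 - x + x\<^sup>2"
            using x by (simp add: field_simps power2_eq_square)
          finally show ?thesis .
        qed
        ultimately show ?thesis by linarith
      qed
      also have "x\<^sup>2 = t ^ 4 * ((w k)\<^sup>2 * (w k)\<^sup>2)"
        by (simp add: x_def power_mult_distrib power2_eq_square power4_eq_xxxx)
      also have "\<dots> \<le> t ^ 4 * (\<kappa>\<^sup>2 * (w k)\<^sup>2)"
        using wk by (intro mult_left_mono mult_right_mono power_mono) auto
      finally have "norm (complex_of_real ((1 - x) - exp (- x))) \<le> t ^ 4 * (\<kappa>\<^sup>2 * (w k)\<^sup>2)"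
        unfolding norm_of_real .
      then show ?thesis
        by (simp only: x_def of_real_diff of_real_1 of_real_mult of_real_power mult_minus_left)
    qed
    have "cmod (?c k - ?e k) \<le> cmod (?c k - (1 - t\<^sup>2 * (w k)\<^sup>2)) + cmod ((1 - t\<^sup>2 * (w k)\<^sup>2) - ?e k)"
      using norm_triangle_ineq[of "?c k - (1 - t\<^sup>2 * (w k)\<^sup>2)" "(1 - t\<^sup>2 * (w k)\<^sup>2) - ?e k"] by simp
    with 1 2 show "cmod (?c k - ?e k) \<le> (\<bar>t\<bar> ^ 3 * ?K * \<kappa> + t ^ 4 * \<kappa>\<^sup>2) * (w k)\<^sup>2"
      by (simp add: algebra_simps)
  qed
  also have "\<dots> = (\<bar>t\<bar> ^ 3 * ?K * \<kappa> + t ^ 4 * \<kappa>\<^sup>2) / 2"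
    using w2 by (simp flip: sum_distrib_left)
  finally show ?thesis .
qed

text \<open>Uniform in the index set, the weights and the threshold, because the extremal solution
  and its support change with \<open>\<epsilon>\<close>.\<close>

definition clt_bound :: "real \<Rightarrow> real \<Rightarrow> bool" where
  "clt_bound \<eta> \<kappa> \<longleftrightarrow> (\<forall>S w x. S \<subseteq> I \<and> finite S \<and> (\<forall>k\<in>S. 0 \<le> w k \<and> w k \<le> \<kappa>) \<and>
    (\<Sum>k\<in>S. (w k)\<^sup>2) = 1 / 2 \<longrightarrow> \<bar>prob {\<xi> \<in> space G. chi_sum S w \<xi> \<le> x} - Phi x\<bar> \<le> \<eta>)"

text \<open>By contradiction, which avoids any rate: if every \<open>\<kappa>\<close> failed, there
  would be counterexamples with weights at most \<open>1 / Suc n\<close>. Levy's continuity theorem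
  makes their laws converge, and uniformity of the convergence rules out the offending thresholds
  \<open>x n\<close>.\<close>

lemma chi_sum_clt:
  assumes \<eta>: "0 < \<eta>"
  shows "\<exists>\<kappa>>0. clt_bound \<eta> \<kappa>"
proof -
  define bad where "bad \<kappa> S w x \<longleftrightarrow> S \<subseteq> I \<and> finite S \<and> (\<forall>k\<in>S. 0 \<le> w k \<and> w k \<le> \<kappa>) \<and>
    (\<Sum>k\<in>S. (w k)\<^sup>2) = 1 / 2 \<and> \<not> \<bar>prob {\<xi> \<in> space G. chi_sum S w \<xi> \<le> x} - Phi x\<bar> \<le> \<eta>" for \<kappa> S w x
  have "\<exists>\<kappa>>0. \<forall>S w x. \<not> bad \<kappa> S w x"
  proof (rule ccontr)
    assume neg: "\<not> ?thesis"
    then have "\<exists>S w x. bad \<kappa> S w x" if "0 < \<kappa>" for \<kappa>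
      using that by blast
    then have "\<forall>n. \<exists>S w x. bad (1 / real (Suc n)) S w x" by simp
    then obtain S w x where bad: "\<And>n. bad (1 / real (Suc n)) (S n) (w n) (x n)"
      by metis
    have S: "\<And>n. S n \<subseteq> I" "\<And>n. finite (S n)"
      and w: "\<And>n k. k \<in> S n \<Longrightarrow> 0 \<le> w n k" "\<And>n k. k \<in> S n \<Longrightarrow> w n k \<le> 1 / real (Suc n)"
      and w2: "\<And>n. (\<Sum>k\<in>S n. (w n k)\<^sup>2) = 1 / 2"
      and far: "\<And>n. \<not> \<bar>prob {\<xi> \<in> space G. chi_sum (S n) (w n) \<xi> \<le> x n} - Phi (x n)\<bar> \<le> \<eta>"
      using bad by (simp_all add: bad_def)
    define M where "M n = distr G borel (chi_sum (S n) (w n))" for n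
    define F where "F n x = prob {\<xi> \<in> space G. chi_sum (S n) (w n) \<xi> \<le> x}" for n x
    have M: "real_distribution (M n)" for n
      unfolding M_def using S by (intro real_distribution_distr) auto
    have cdfM: "cdf (M n) = F n" for n
      unfolding M_def F_def cdf_def using S
      by (auto simp: fun_eq_iff measure_distr vimage_def Int_def conj_commute)
    have "weak_conv_m M std_normal"
    proof (rule levy_continuity[OF M real_dist_normal_dist])
      fix t
      let ?K = "\<integral>x. \<bar>x\<^sup>2 - 1\<bar> ^ 3 \<partial>std_normal"
      have lim: "(\<lambda>n. 1 / real (Suc n)) \<longlonglongrightarrow> 0" by (rule LIMSEQ_Suc[OF lim_1_over_n])
      have "(\<lambda>n. char (M n) t - char std_normal t) \<longlonglongrightarrow> 0"
      proof (rule Lim_null_comparison)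
        show "\<forall>\<^sub>F n in sequentially. norm (char (M n) t - char std_normal t)
          \<le> (\<bar>t\<bar> ^ 3 * ?K * (1 / real (Suc n)) + t ^ 4 * (1 / real (Suc n))\<^sup>2) / 2"
          unfolding M_def by (intro always_eventually allI char_chi_sum S w w2)
        have "(\<lambda>n. (\<bar>t\<bar> ^ 3 * ?K * (1 / real (Suc n)) + t ^ 4 * (1 / real (Suc n))\<^sup>2) / 2)
          \<longlonglongrightarrow> (\<bar>t\<bar> ^ 3 * ?K * 0 + t ^ 4 * 0\<^sup>2) / 2"
          by (intro tendsto_intros lim) auto
        then show "(\<lambda>n. (\<bar>t\<bar> ^ 3 * ?K * (1 / real (Suc n)) + t ^ 4 * (1 / real (Suc n))\<^sup>2) / 2) \<longlonglongrightarrow> 0"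
          by simp
      qed
      then show "(\<lambda>n. char (M n) t) \<longlonglongrightarrow> char std_normal t" by (simp add: LIM_zero_iff)
    qed
    then have lim: "(\<lambda>n. F n x) \<longlonglongrightarrow> Phi x" for x
      using isCont_Phi[of x] by (simp add: weak_conv_m_def weak_conv_def cdfM Phi_def[abs_def])
    have "\<forall>\<^sub>F n in sequentially. \<forall>x. \<bar>F n x - Phi x\<bar> \<le> \<eta>"
    proof (rule Phi_uniform_convergence[OF _ _ _ lim \<eta>])
      fix n
      interpret Mn: real_distribution "M n" by (rule M)
      show "mono (F n)" unfolding cdfM[symmetric] by (auto simp: mono_def Mn.cdf_nondecreasing)
    qed (auto simp: F_def)
    then obtain n where "\<forall>x. \<bar>F n x - Phi x\<bar> \<le> \<eta>"
      unfolding eventually_sequentially by blast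
    then show False using far[of n] by (simp add: F_def)
  qed
  then obtain \<kappa> where \<kappa>: "0 < \<kappa>" "\<And>S w x. \<not> bad \<kappa> S w x" by blast
  have "clt_bound \<eta> \<kappa>"
    unfolding clt_bound_def
  proof (intro allI impI)
    fix S :: "'i set" and w x
    assume "S \<subseteq> I \<and> finite S \<and> (\<forall>k\<in>S. 0 \<le> w k \<and> w k \<le> \<kappa>) \<and> (\<Sum>k\<in>S. (w k)\<^sup>2) = 1 / 2"
    then show "\<bar>prob {\<xi> \<in> space G. chi_sum S w \<xi> \<le> x} - Phi x\<bar> \<le> \<eta>"
      using \<kappa>(2)[of S w x] by (simp add: bad_def)
  qed
  with \<kappa>(1) show ?thesis by blast
qed

end

section \<open>Likelihood ratios\<close>

text \<open>The quotient of the two sides decreases on the half-line, its derivative having the sign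
  of \<open>sinh y - y * cosh y\<close>. Needed because \<open>cosh l\<close> is the second moment
  of the two-point likelihood ratio.\<close>

lemma cosh_le_exp_half_square:
  fixes x :: real
  assumes "0 \<le> x"
  shows "cosh x \<le> exp (x\<^sup>2 / 2)"
proof -
  have s: "sinh y \<le> y * cosh y" if "0 \<le> y" for y :: real
  proof -
    have "(\<lambda>y. y * cosh y - sinh y) 0 \<le> (\<lambda>y. y * cosh y - sinh y) y"
    proof (rule DERIV_nonneg_imp_nondecreasing[OF that])
      fix u :: real assume u: "0 \<le> u" "u \<le> y"
      have "((\<lambda>y. y * cosh y - sinh y) has_real_derivative u * sinh u) (at u)"
        by (auto intro!: derivative_eq_intros)
      then show "\<exists>D. ((\<lambda>y. y * cosh y - sinh y) has_real_derivative D) (at u) \<and> 0 \<le> D"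
        using u by (intro exI[of _ "u * sinh u"]) auto
    qed
    then show ?thesis by simp
  qed
  have "(\<lambda>y. exp (- (y\<^sup>2 / 2)) * cosh y) x \<le> (\<lambda>y. exp (- (y\<^sup>2 / 2)) * cosh y) 0"
  proof (rule DERIV_nonpos_imp_nonincreasing[OF assms])
    fix u :: real assume u: "0 \<le> u" "u \<le> x"
    have "((\<lambda>y. exp (- (y\<^sup>2 / 2)) * cosh y) has_real_derivative exp (- (u\<^sup>2 / 2)) * (sinh u - u * cosh u)) (at u)"
      by (auto intro!: derivative_eq_intros simp: algebra_simps)
    then show "\<exists>D. ((\<lambda>y. exp (- (y\<^sup>2 / 2)) * cosh y) has_real_derivative D) (at u) \<and> D \<le> 0"
      using u s[of u] by (intro exI conjI) (auto simp: mult_le_0_iff)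
  qed
  then show ?thesis by (simp add: exp_minus field_simps)
qed

text \<open>Likelihood ratios against \<open>N(0, 1)\<close>: of the two-point mixture at \<open>\<plusminus> sqrt l\<close>, and of
  \<open>N(0, 1 / (1 - l))\<close>.\<close>

definition sym_lr :: "real \<Rightarrow> real \<Rightarrow> real" where
  "sym_lr l x = exp (- l / 2) * cosh (sqrt l * x)"

definition gauss_lr :: "real \<Rightarrow> real \<Rightarrow> real" where
  "gauss_lr l x = sqrt (1 - l) * exp (l * x\<^sup>2 / 2)"

lemma borel_measurable_lr[measurable]:
  "sym_lr l \<in> borel_measurable borel" "gauss_lr l \<in> borel_measurable borel"
  unfolding sym_lr_def[abs_def] gauss_lr_def[abs_def] cosh_field_def by measurable

lemma sym_lr_moments:
  assumes "0 \<le> l"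
  shows "integrable std_normal (sym_lr l)" "integral\<^sup>L std_normal (sym_lr l) = 1"
    "integrable std_normal (\<lambda>x. (sym_lr l x)\<^sup>2)" "(\<integral>x. (sym_lr l x)\<^sup>2 \<partial>std_normal) = cosh l"
proof -
  interpret prob_space std_normal by (rule prob_space_std_normal)
  note E = std_normal_exp_quadratic[of 0, simplified]
  have 1: "sym_lr l = (\<lambda>x. exp (- l / 2) / 2 * exp (sqrt l * x) + exp (- l / 2) / 2 * exp (- sqrt l * x))"
    by (auto simp: sym_lr_def cosh_field_def algebra_simps add_divide_distrib)
  have E2: "(\<integral>x. c * exp (y * x) + c * exp (z * x) \<partial>std_normal) = c * exp (y\<^sup>2 / 2) + c * exp (z\<^sup>2 / 2)" for c y z
    by (simp add: E)
  have e1: "(exp (sqrt l * x))\<^sup>2 = exp (2 * sqrt l * x)" "(exp (- (sqrt l * x)))\<^sup>2 = exp (- 2 * sqrt l * x)"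
    "exp (sqrt l * x) * exp (- (sqrt l * x)) = 1" "(exp (- l / 2))\<^sup>2 = exp (- l)" for x
    by (auto simp: power2_eq_square simp flip: exp_add)
  have 2: "(\<lambda>x. (sym_lr l x)\<^sup>2) = (\<lambda>x. exp (- l) / 4 * exp (2 * sqrt l * x) + exp (- l) / 4 * exp (- 2 * sqrt l * x) + exp (- l) / 2)"
  proof
    fix x
    have "(sym_lr l x)\<^sup>2 = (exp (- l / 2))\<^sup>2 * ((exp (sqrt l * x))\<^sup>2 + (exp (- (sqrt l * x)))\<^sup>2 + 2 * (exp (sqrt l * x) * exp (- (sqrt l * x)))) / 4"
      by (simp add: sym_lr_def cosh_field_def power_mult_distrib power_divide power2_sum)
    then show "(sym_lr l x)\<^sup>2 = exp (- l) / 4 * exp (2 * sqrt l * x) + exp (- l) / 4 * exp (- 2 * sqrt l * x) + exp (- l) / 2"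
      unfolding e1 by (simp add: algebra_simps add_divide_distrib)
  qed
  show "integrable std_normal (sym_lr l)"
    unfolding 1 by (intro Bochner_Integration.integrable_add integrable_mult_right E)
  have "integral\<^sup>L std_normal (sym_lr l) = exp (- l / 2) / 2 * exp ((sqrt l)\<^sup>2 / 2) + exp (- l / 2) / 2 * exp ((- sqrt l)\<^sup>2 / 2)"
    unfolding 1 by (rule E2)
  also have "\<dots> = 1" using assms by (simp flip: exp_add)
  finally show "integral\<^sup>L std_normal (sym_lr l) = 1" .
  show "integrable std_normal (\<lambda>x. (sym_lr l x)\<^sup>2)"
    unfolding 2 by (intro Bochner_Integration.integrable_add integrable_mult_right E integrable_const)
  have "(\<integral>x. (sym_lr l x)\<^sup>2 \<partial>std_normal) = exp (- l) / 4 * exp ((2 * sqrt l)\<^sup>2 / 2) + exp (- l) / 4 * exp ((- 2 * sqrt l)\<^sup>2 / 2) + exp (- l) / 2"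
    unfolding 2 using E(1)[of "2 * sqrt l"] E(1)[of "- 2 * sqrt l"] E(2)[of "2 * sqrt l"] E(2)[of "- 2 * sqrt l"] prob_space
    by simp
  also have "\<dots> = (exp (- l) * exp (2 * l) + exp (- l)) / 2"
    using assms by (simp add: power_mult_distrib add_divide_distrib)
  also have "\<dots> = cosh l" by (simp add: cosh_field_def flip: exp_add)
  finally show "(\<integral>x. (sym_lr l x)\<^sup>2 \<partial>std_normal) = cosh l" .
qed

text \<open>The square of \<open>gauss_lr\<close> contains \<open>exp (l * x\<^sup>2)\<close>, which
  the Gaussian density dominates when \<open>2 * l < 1\<close>. The mixed moment is at least
  \<open>exp (l\<^sup>2 / 2)\<close>, the direction on which the later cancellation rests.\<close>

lemma gauss_lr_moments:
  assumes "0 \<le> l" "l < 1 / 2"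
  shows "integrable std_normal (\<lambda>x. (gauss_lr l x)\<^sup>2)" "(\<integral>x. (gauss_lr l x)\<^sup>2 \<partial>std_normal) = (1 - l) / sqrt (1 - 2 * l)"
    "integrable std_normal (\<lambda>x. sym_lr l x * gauss_lr l x)" "(\<integral>x. sym_lr l x * gauss_lr l x \<partial>std_normal) = exp (l\<^sup>2 / (2 * (1 - l)))"
proof -
  have 1: "(\<lambda>x. (gauss_lr l x)\<^sup>2) = (\<lambda>x. (1 - l) * exp (2 * l * x\<^sup>2 / 2 + 0 * x))"
    using assms by (auto simp: gauss_lr_def power_mult_distrib simp flip: exp_double)
  have l: "2 * l < 1" "l < 1" using assms by auto
  show "integrable std_normal (\<lambda>x. (gauss_lr l x)\<^sup>2)"
    unfolding 1 by (intro integrable_mult_right std_normal_exp_quadratic l)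
  show "(\<integral>x. (gauss_lr l x)\<^sup>2 \<partial>std_normal) = (1 - l) / sqrt (1 - 2 * l)"
    unfolding 1 using std_normal_exp_quadratic(2)[OF l(1), of 0] by simp
  let ?c = "exp (- l / 2) * sqrt (1 - l) / 2"
  have 2: "(\<lambda>x. sym_lr l x * gauss_lr l x) = (\<lambda>x. ?c * exp (l * x\<^sup>2 / 2 + sqrt l * x) + ?c * exp (l * x\<^sup>2 / 2 + (- sqrt l) * x))"
  proof
    fix x
    have "exp (l * x\<^sup>2 / 2 + sqrt l * x) = exp (l * x\<^sup>2 / 2) * exp (sqrt l * x)"
      "exp (l * x\<^sup>2 / 2 + (- sqrt l) * x) = exp (l * x\<^sup>2 / 2) * exp (- (sqrt l * x))"
      by (simp_all flip: exp_add)
    then show "sym_lr l x * gauss_lr l x = ?c * exp (l * x\<^sup>2 / 2 + sqrt l * x) + ?c * exp (l * x\<^sup>2 / 2 + (- sqrt l) * x)"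
      by (simp add: sym_lr_def gauss_lr_def cosh_field_def algebra_simps add_divide_distrib)
  qed
  have E2: "(\<integral>x. c * exp (l * x\<^sup>2 / 2 + y * x) + c * exp (l * x\<^sup>2 / 2 + z * x) \<partial>std_normal)
    = c * (exp (y\<^sup>2 / (2 * (1 - l))) / sqrt (1 - l)) + c * (exp (z\<^sup>2 / (2 * (1 - l))) / sqrt (1 - l))" for c y z
    using std_normal_exp_quadratic[OF l(2), of y] std_normal_exp_quadratic[OF l(2), of z] by simp
  note E = std_normal_exp_quadratic[OF l(2), of "sqrt l"] std_normal_exp_quadratic[OF l(2), of "- sqrt l"]
  show "integrable std_normal (\<lambda>x. sym_lr l x * gauss_lr l x)"
    unfolding 2 by (intro Bochner_Integration.integrable_add integrable_mult_right E)
  have "(\<integral>x. sym_lr l x * gauss_lr l x \<partial>std_normal) = ?c * (exp ((sqrt l)\<^sup>2 / (2 * (1 - l))) / sqrt (1 - l)) + ?c * (exp ((- sqrt l)\<^sup>2 / (2 * (1 - l))) / sqrt (1 - l))"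
    unfolding 2 by (rule E2)
  also have "\<dots> = exp (- l / 2) * exp (l / (2 * (1 - l)))"
    using assms by simp
  also have "\<dots> = exp (l\<^sup>2 / (2 * (1 - l)))"
  proof -
    have "- l / 2 + l / (2 * (1 - l)) = l\<^sup>2 / (2 * (1 - l))"
      using l by (simp add: field_simps power2_eq_square)
    then show ?thesis by (simp flip: exp_add)
  qed
  finally show "(\<integral>x. sym_lr l x * gauss_lr l x \<partial>std_normal) = exp (l\<^sup>2 / (2 * (1 - l)))" .
qed

text \<open>The square of the left side is \<open>1 + l\<^sup>2 / (1 - 2 * l)\<close>, so its
  logarithm is at most \<open>l\<^sup>2 / (1 - 2 * l)\<close>. For \<open>l \<le> 1 / 4\<close> this
  is at most \<open>l\<^sup>2 + 4 * l ^ 3\<close>, and taking the root halves the exponent.\<close>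

lemma gauss_lr_second_moment_le:
  fixes l :: real
  assumes "0 \<le> l" "l \<le> 1 / 4"
  shows "(1 - l) / sqrt (1 - 2 * l) \<le> exp (l\<^sup>2 / 2 + 2 * l ^ 3)"
proof (rule power2_le_imp_le)
  have "((1 - l) / sqrt (1 - 2 * l))\<^sup>2 = (1 - l)\<^sup>2 / (1 - 2 * l)"
    using assms by (simp add: power_divide)
  also have "\<dots> = 1 + l\<^sup>2 / (1 - 2 * l)"
    using assms by (simp add: field_simps power2_eq_square)
  also have "\<dots> \<le> exp (l\<^sup>2 / (1 - 2 * l))" by (rule exp_ge_add_one_self)
  also have "\<dots> \<le> exp (l\<^sup>2 + 4 * l ^ 3)"
  proof -
    have "l\<^sup>2 \<le> (l\<^sup>2 + 4 * l ^ 3) * (1 - 2 * l)"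
    proof -
      have "(l\<^sup>2 + 4 * l ^ 3) * (1 - 2 * l) - l\<^sup>2 = 2 * l ^ 3 * (1 - 4 * l)"
        by (simp add: algebra_simps power2_eq_square power3_eq_cube)
      also have "\<dots> \<ge> 0" using assms by simp
      finally show ?thesis by simp
    qed
    then show ?thesis using assms by (simp add: field_simps)
  qed
  also have "\<dots> = (exp (l\<^sup>2 / 2 + 2 * l ^ 3))\<^sup>2" by (simp flip: exp_double)
  finally show "((1 - l) / sqrt (1 - 2 * l))\<^sup>2 \<le> (exp (l\<^sup>2 / 2 + 2 * l ^ 3))\<^sup>2" .
qed simp

lemma (in prob_space) expectation_abs_le_sqrt:
  assumes "X \<in> borel_measurable M" "integrable M (\<lambda>x. (X x)\<^sup>2)"
  shows "integrable M X" "expectation (\<lambda>x. \<bar>X x\<bar>) \<le> sqrt (expectation (\<lambda>x. (X x)\<^sup>2))"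
proof -
  show i: "integrable M X" using assms by (rule square_integrable_imp_integrable)
  have "(expectation (\<lambda>x. \<bar>X x\<bar>))\<^sup>2 \<le> expectation (\<lambda>x. \<bar>X x\<bar>\<^sup>2)"
  proof -
    have "0 \<le> variance (\<lambda>x. \<bar>X x\<bar>)" by (rule variance_positive)
    also have "\<dots> = expectation (\<lambda>x. \<bar>X x\<bar>\<^sup>2) - (expectation (\<lambda>x. \<bar>X x\<bar>))\<^sup>2"
      using assms i by (intro variance_eq) auto
    finally show ?thesis by simp
  qed
  then show "expectation (\<lambda>x. \<bar>X x\<bar>) \<le> sqrt (expectation (\<lambda>x. (X x)\<^sup>2))"
    by (intro real_le_rsqrt) simp
qed

section \<open>Product likelihood ratios and their distances\<close>

context gaussian_sequence
begin

definition mixture_lr :: "'i set \<Rightarrow> ('i \<Rightarrow> real) \<Rightarrow> ('i \<Rightarrow> real) \<Rightarrow> real" where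
  "mixture_lr S l \<xi> = (\<Prod>k\<in>S. sym_lr (l k) (\<xi> k))"

text \<open>With \<open>l k = 2 * u * w k\<close> this is a constant times
  \<open>exp (u * chi_sum S w \<xi>)\<close>, hence the name.\<close>

definition monotone_lr :: "'i set \<Rightarrow> ('i \<Rightarrow> real) \<Rightarrow> ('i \<Rightarrow> real) \<Rightarrow> real" where
  "monotone_lr S l \<xi> = (\<Prod>k\<in>S. gauss_lr (l k) (\<xi> k))"

lemma measurable_lr[measurable]:
  assumes "S \<subseteq> I"
  shows "mixture_lr S l \<in> borel_measurable G" "monotone_lr S l \<in> borel_measurable G"
  using assms unfolding mixture_lr_def[abs_def] monotone_lr_def[abs_def]
  by (auto intro!: measurable_prod_coords)

lemma mixture_lr_moments:
  assumes S: "S \<subseteq> I" "finite S" and l: "\<And>k. k \<in> S \<Longrightarrow> 0 \<le> l k"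
  shows "integrable G (mixture_lr S l)" "expectation (mixture_lr S l) = 1"
    "integrable G (\<lambda>\<xi>. (mixture_lr S l \<xi>)\<^sup>2)"
    "expectation (\<lambda>\<xi>. (mixture_lr S l \<xi>)\<^sup>2) \<le> exp (\<Sum>k\<in>S. (l k)\<^sup>2 / 2)"
proof -
  have sq: "(\<lambda>\<xi>. (mixture_lr S l \<xi>)\<^sup>2) = (\<lambda>\<xi>. \<Prod>k\<in>S. (sym_lr (l k) (\<xi> k))\<^sup>2)"
    by (simp add: mixture_lr_def prod_power_distrib)
  show "integrable G (mixture_lr S l)"
    unfolding mixture_lr_def[abs_def] using S l by (intro prod_coords) (auto intro: sym_lr_moments)
  have "expectation (mixture_lr S l) = (\<Prod>k\<in>S. integral\<^sup>L std_normal (sym_lr (l k)))"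
    unfolding mixture_lr_def[abs_def] using S l by (intro prod_coords) (auto intro: sym_lr_moments)
  then show "expectation (mixture_lr S l) = 1" using l by (simp add: sym_lr_moments)
  show "integrable G (\<lambda>\<xi>. (mixture_lr S l \<xi>)\<^sup>2)"
    unfolding sq using S l by (intro prod_coords(1)[where f = "\<lambda>k x. (sym_lr (l k) x)\<^sup>2"]) (auto intro: sym_lr_moments)
  have "expectation (\<lambda>\<xi>. (mixture_lr S l \<xi>)\<^sup>2) = (\<Prod>k\<in>S. \<integral>x. (sym_lr (l k) x)\<^sup>2 \<partial>std_normal)"
    unfolding sq using S l by (intro prod_coords(2)[where f = "\<lambda>k x. (sym_lr (l k) x)\<^sup>2"]) (auto intro: sym_lr_moments)
  also have "\<dots> \<le> (\<Prod>k\<in>S. exp ((l k)\<^sup>2 / 2))"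
    using l by (intro prod_mono) (auto simp: sym_lr_moments intro!: cosh_le_exp_half_square cosh_real_nonneg)
  also have "\<dots> = exp (\<Sum>k\<in>S. (l k)\<^sup>2 / 2)" using S by (simp add: exp_sum)
  finally show "expectation (\<lambda>\<xi>. (mixture_lr S l \<xi>)\<^sup>2) \<le> exp (\<Sum>k\<in>S. (l k)\<^sup>2 / 2)" .
qed

text \<open>As the mean is 1, the second moment minus 1 is the chi-square divergence from
  \<open>G\<close>; its square root dominates the \<open>L\<^sup>1\<close> distance.\<close>

lemma mixture_lr_minus_1:
  assumes S: "S \<subseteq> I" "finite S" and l: "\<And>k. k \<in> S \<Longrightarrow> 0 \<le> l k"
  shows "expectation (\<lambda>\<xi>. \<bar>mixture_lr S l \<xi> - 1\<bar>) \<le> sqrt (exp (\<Sum>k\<in>S. (l k)\<^sup>2 / 2) - 1)"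
proof -
  note M = mixture_lr_moments[OF assms]
  have eq: "(\<lambda>\<xi>. (mixture_lr S l \<xi> - 1)\<^sup>2) = (\<lambda>\<xi>. (mixture_lr S l \<xi>)\<^sup>2 - 2 * mixture_lr S l \<xi> + 1)"
    by (auto simp: power2_eq_square algebra_simps)
  have "expectation (\<lambda>\<xi>. \<bar>mixture_lr S l \<xi> - 1\<bar>) \<le> sqrt (expectation (\<lambda>\<xi>. (mixture_lr S l \<xi> - 1)\<^sup>2))"
  proof (rule expectation_abs_le_sqrt)
    show "(\<lambda>\<xi>. mixture_lr S l \<xi> - 1) \<in> borel_measurable G" using S by measurable
    show "integrable G (\<lambda>\<xi>. (mixture_lr S l \<xi> - 1)\<^sup>2)"
      unfolding eq by (intro Bochner_Integration.integrable_add Bochner_Integration.integrable_diff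
        integrable_mult_right M(1,3) integrable_const)
  qed
  also have "expectation (\<lambda>\<xi>. (mixture_lr S l \<xi> - 1)\<^sup>2) = expectation (\<lambda>\<xi>. (mixture_lr S l \<xi>)\<^sup>2) - 1"
    unfolding eq by (simp add: M(1,2,3) P.prob_space)
  also have "\<dots> \<le> exp (\<Sum>k\<in>S. (l k)\<^sup>2 / 2) - 1" using M by simp
  finally show ?thesis by simp
qed

text \<open>Put \<open>Q = exp (\<Sum> l\<^sup>2 / 2)\<close>. In the expanded square of the
  difference, the two second moments are at most \<open>Q\<close> and
  \<open>Q * exp (\<Sum> 2 * l ^ 3)\<close>, while the mixed moment is at least \<open>Q\<close>;
  the quadratic orders cancel and the cubic one remains.\<close>

lemma mixture_lr_monotone_lr:
  assumes S: "S \<subseteq> I" "finite S" and l: "\<And>k. k \<in> S \<Longrightarrow> 0 \<le> l k" "\<And>k. k \<in> S \<Longrightarrow> l k \<le> 1 / 4"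
  shows "integrable G (monotone_lr S l)"
    "expectation (\<lambda>\<xi>. \<bar>mixture_lr S l \<xi> - monotone_lr S l \<xi>\<bar>)
      \<le> sqrt (exp (\<Sum>k\<in>S. (l k)\<^sup>2 / 2) * (exp (\<Sum>k\<in>S. 2 * (l k) ^ 3) - 1))"
proof -
  note M = mixture_lr_moments[of S l, OF S l(1)]
  have l': "0 \<le> l k" "l k < 1 / 2" if "k \<in> S" for k using l[OF that] by auto
  have sq: "(\<lambda>\<xi>. (monotone_lr S l \<xi>)\<^sup>2) = (\<lambda>\<xi>. \<Prod>k\<in>S. (gauss_lr (l k) (\<xi> k))\<^sup>2)"
    by (simp add: monotone_lr_def prod_power_distrib)
  have pr: "(\<lambda>\<xi>. mixture_lr S l \<xi> * monotone_lr S l \<xi>) = (\<lambda>\<xi>. \<Prod>k\<in>S. sym_lr (l k) (\<xi> k) * gauss_lr (l k) (\<xi> k))"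
    by (simp add: monotone_lr_def mixture_lr_def prod.distrib)
  have i2: "integrable G (\<lambda>\<xi>. (monotone_lr S l \<xi>)\<^sup>2)"
    unfolding sq using S l' by (intro prod_coords(1)[where f = "\<lambda>k x. (gauss_lr (l k) x)\<^sup>2"]) (auto intro: gauss_lr_moments)
  have i1: "integrable G (\<lambda>\<xi>. mixture_lr S l \<xi> * monotone_lr S l \<xi>)"
    unfolding pr using S l' by (intro prod_coords(1)[where f = "\<lambda>k x. sym_lr (l k) x * gauss_lr (l k) x"]) (auto intro: gauss_lr_moments)
  show "integrable G (monotone_lr S l)"
    by (rule expectation_abs_le_sqrt(1)[OF measurable_lr(2)[OF S(1)] i2])
  have "expectation (\<lambda>\<xi>. (monotone_lr S l \<xi>)\<^sup>2) = (\<Prod>k\<in>S. \<integral>x. (gauss_lr (l k) x)\<^sup>2 \<partial>std_normal)"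
    unfolding sq using S l' by (intro prod_coords(2)[where f = "\<lambda>k x. (gauss_lr (l k) x)\<^sup>2"]) (auto intro: gauss_lr_moments)
  also have "\<dots> \<le> (\<Prod>k\<in>S. exp ((l k)\<^sup>2 / 2 + 2 * (l k) ^ 3))"
  proof (intro prod_mono conjI)
    fix k assume k: "k \<in> S"
    show "0 \<le> (\<integral>x. (gauss_lr (l k) x)\<^sup>2 \<partial>std_normal)" by simp
    show "(\<integral>x. (gauss_lr (l k) x)\<^sup>2 \<partial>std_normal) \<le> exp ((l k)\<^sup>2 / 2 + 2 * (l k) ^ 3)"
      using gauss_lr_second_moment_le[OF l[OF k]] l'[OF k] by (simp add: gauss_lr_moments)
  qed
  also have "\<dots> = exp (\<Sum>k\<in>S. (l k)\<^sup>2 / 2) * exp (\<Sum>k\<in>S. 2 * (l k) ^ 3)"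
    unfolding exp_sum[OF S(2)] exp_add prod.distrib ..
  finally have b2: "expectation (\<lambda>\<xi>. (monotone_lr S l \<xi>)\<^sup>2) \<le> exp (\<Sum>k\<in>S. (l k)\<^sup>2 / 2) * exp (\<Sum>k\<in>S. 2 * (l k) ^ 3)" .
  have "exp (\<Sum>k\<in>S. (l k)\<^sup>2 / 2) = (\<Prod>k\<in>S. exp ((l k)\<^sup>2 / 2))" using S by (simp add: exp_sum)
  also have "\<dots> \<le> (\<Prod>k\<in>S. exp ((l k)\<^sup>2 / (2 * (1 - l k))))"
  proof (intro prod_mono conjI)
    fix k assume "k \<in> S"
    then have "(l k)\<^sup>2 / 2 \<le> (l k)\<^sup>2 / (2 * (1 - l k))"
      using l'[of k] by (intro divide_left_mono) auto
    then show "exp ((l k)\<^sup>2 / 2) \<le> exp ((l k)\<^sup>2 / (2 * (1 - l k)))" by simp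
  qed auto
  also have "\<dots> = (\<Prod>k\<in>S. \<integral>x. sym_lr (l k) x * gauss_lr (l k) x \<partial>std_normal)"
    using l' by (intro prod.cong) (auto simp: gauss_lr_moments)
  also have "\<dots> = expectation (\<lambda>\<xi>. mixture_lr S l \<xi> * monotone_lr S l \<xi>)"
    unfolding pr using S l' by (intro prod_coords(2)[where f = "\<lambda>k x. sym_lr (l k) x * gauss_lr (l k) x", symmetric]) (auto intro: gauss_lr_moments)
  finally have b1: "exp (\<Sum>k\<in>S. (l k)\<^sup>2 / 2) \<le> expectation (\<lambda>\<xi>. mixture_lr S l \<xi> * monotone_lr S l \<xi>)" .
  have eq: "(\<lambda>\<xi>. (mixture_lr S l \<xi> - monotone_lr S l \<xi>)\<^sup>2)
    = (\<lambda>\<xi>. (mixture_lr S l \<xi>)\<^sup>2 - 2 * (mixture_lr S l \<xi> * monotone_lr S l \<xi>) + (monotone_lr S l \<xi>)\<^sup>2)"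
    by (auto simp: power2_eq_square algebra_simps)
  have "expectation (\<lambda>\<xi>. \<bar>mixture_lr S l \<xi> - monotone_lr S l \<xi>\<bar>)
      \<le> sqrt (expectation (\<lambda>\<xi>. (mixture_lr S l \<xi> - monotone_lr S l \<xi>)\<^sup>2))"
  proof (rule expectation_abs_le_sqrt)
    show "(\<lambda>\<xi>. mixture_lr S l \<xi> - monotone_lr S l \<xi>) \<in> borel_measurable G" using S by measurable
    show "integrable G (\<lambda>\<xi>. (mixture_lr S l \<xi> - monotone_lr S l \<xi>)\<^sup>2)"
      unfolding eq by (intro Bochner_Integration.integrable_add Bochner_Integration.integrable_diff
        integrable_mult_right M(3) i1 i2)
  qed
  also have "expectation (\<lambda>\<xi>. (mixture_lr S l \<xi> - monotone_lr S l \<xi>)\<^sup>2) =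
      expectation (\<lambda>\<xi>. (mixture_lr S l \<xi>)\<^sup>2) - 2 * expectation (\<lambda>\<xi>. mixture_lr S l \<xi> * monotone_lr S l \<xi>)
      + expectation (\<lambda>\<xi>. (monotone_lr S l \<xi>)\<^sup>2)"
    unfolding eq by (simp add: M(3) i1 i2)
  also have "\<dots> \<le> exp (\<Sum>k\<in>S. (l k)\<^sup>2 / 2) * (exp (\<Sum>k\<in>S. 2 * (l k) ^ 3) - 1)"
    using M(4) b1 b2 by (simp add: algebra_simps)
  finally show "expectation (\<lambda>\<xi>. \<bar>mixture_lr S l \<xi> - monotone_lr S l \<xi>\<bar>)
      \<le> sqrt (exp (\<Sum>k\<in>S. (l k)\<^sup>2 / 2) * (exp (\<Sum>k\<in>S. 2 * (l k) ^ 3) - 1))" by simp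
qed

end

section \<open>Bounds for mixtures and for shifted statistics\<close>

context gaussian_sequence
begin

definition sign_shift :: "'i set \<Rightarrow> ('i \<Rightarrow> real) \<Rightarrow> ('i \<Rightarrow> real) \<Rightarrow> 'i \<Rightarrow> real" where
  "sign_shift S l \<sigma> k = (if k \<in> S then \<sigma> k * sqrt (l k) else 0)"

abbreviation sign_shift_prob where
  "sign_shift_prob S l \<sigma> B \<equiv> prob {\<xi> \<in> space G. (\<lambda>k\<in>I. sign_shift S l \<sigma> k + \<xi> k) \<in> B}"

abbreviation mixture_prob where
  "mixture_prob S l B \<equiv> expectation (\<lambda>\<xi>. mixture_lr S l \<xi> * indicator B \<xi>)"

text \<open>Expanding the product of \<open>cosh\<close> factors over all sign patterns yields the
  average of the Cameron-Martin densities of the shifts by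
  \<open>\<plusminus> sqrt (l k)\<close>.\<close>

lemma mixture_lr_average:
  assumes S: "S \<subseteq> I" "finite S" and l: "\<And>k. k \<in> S \<Longrightarrow> 0 \<le> l k" and B: "B \<in> sets G"
  shows "mixture_prob S l B =
    (\<Sum>\<sigma>\<in>PiE S (\<lambda>_. {-1, 1}). sign_shift_prob S l \<sigma> B) / 2 ^ card S"
proof -
  let ?sg = "PiE S (\<lambda>_. {-1, 1 :: real})"
  let ?D = "\<lambda>\<sigma> \<xi>. \<Prod>k\<in>S. exp (sign_shift S l \<sigma> k * \<xi> k - (sign_shift S l \<sigma> k)\<^sup>2 / 2)"
  have fin: "finite ?sg" using S by (intro finite_PiE) auto
  have "mixture_lr S l \<xi> = (\<Sum>\<sigma>\<in>?sg. ?D \<sigma> \<xi>) / 2 ^ card S" for \<xi>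
  proof -
    have "mixture_lr S l \<xi> = (\<Prod>k\<in>S. (\<Sum>s\<in>{-1, 1}. exp (s * sqrt (l k) * \<xi> k - (s * sqrt (l k))\<^sup>2 / 2)) / 2)"
      unfolding mixture_lr_def
    proof (rule prod.cong[OF refl])
      fix k assume "k \<in> S"
      then have "(sqrt (l k))\<^sup>2 = l k" using l by simp
      then show "sym_lr (l k) (\<xi> k) = (\<Sum>s\<in>{-1, 1}. exp (s * sqrt (l k) * \<xi> k - (s * sqrt (l k))\<^sup>2 / 2)) / 2"
        by (simp add: sym_lr_def cosh_field_def distrib_left flip: exp_add)
    qed
    also have "\<dots> = (\<Prod>k\<in>S. \<Sum>s\<in>{-1, 1}. exp (s * sqrt (l k) * \<xi> k - (s * sqrt (l k))\<^sup>2 / 2)) / 2 ^ card S"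
      by (simp add: prod_dividef)
    also have "(\<Prod>k\<in>S. \<Sum>s\<in>{-1, 1}. exp (s * sqrt (l k) * \<xi> k - (s * sqrt (l k))\<^sup>2 / 2))
      = (\<Sum>\<sigma>\<in>?sg. \<Prod>k\<in>S. exp (\<sigma> k * sqrt (l k) * \<xi> k - (\<sigma> k * sqrt (l k))\<^sup>2 / 2))"
      using S by (intro prod_sum_PiE) auto
    also have "\<dots> = (\<Sum>\<sigma>\<in>?sg. ?D \<sigma> \<xi>)"
      by (intro sum.cong prod.cong) (auto simp: sign_shift_def)
    finally show ?thesis .
  qed
  then have eq: "(\<lambda>\<xi>. mixture_lr S l \<xi> * indicator B \<xi>) = (\<lambda>\<xi>. (\<Sum>\<sigma>\<in>?sg. ?D \<sigma> \<xi> * indicator B \<xi>) / 2 ^ card S)"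
    by (simp add: sum_distrib_right)
  have int: "integrable G (\<lambda>\<xi>. ?D \<sigma> \<xi> * indicator B \<xi>)" for \<sigma>
  proof (rule integrable_real_mult_indicator[OF B])
    have "integrable std_normal (\<lambda>x. exp (z * x - z\<^sup>2 / 2))" for z
      using integrable_mult_left[OF std_normal_exp_quadratic(1)[of 0 z], of "exp (- (z\<^sup>2 / 2))"]
      by (simp flip: exp_add)
    then show "integrable G (?D \<sigma>)"
      using S by (intro prod_coords(1)[where f = "\<lambda>k x. exp (sign_shift S l \<sigma> k * x - (sign_shift S l \<sigma> k)\<^sup>2 / 2)"]) auto
  qed
  have "mixture_prob S l B = (\<Sum>\<sigma>\<in>?sg. \<integral>\<xi>. ?D \<sigma> \<xi> * indicator B \<xi> \<partial>G) / 2 ^ card S"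
    unfolding eq using int by (simp add: Bochner_Integration.integral_sum)
  also have "(\<Sum>\<sigma>\<in>?sg. \<integral>\<xi>. ?D \<sigma> \<xi> * indicator B \<xi> \<partial>G)
    = (\<Sum>\<sigma>\<in>?sg. sign_shift_prob S l \<sigma> B)"
    by (intro sum.cong refl prob_shift[symmetric] S B) (auto simp: sign_shift_def)
  finally show ?thesis .
qed

lemma card_signs: "finite S \<Longrightarrow> card (PiE S (\<lambda>_. {-1, 1 :: real})) = 2 ^ card S"
  by (simp add: card_PiE numeral_2_eq_2)

text \<open>A bound valid for all sign patterns survives averaging; this is how a Bayes risk is
  compared with a worst-case risk.\<close>

lemma mixture_lr_le:
  assumes S: "S \<subseteq> I" "finite S" and l: "\<And>k. k \<in> S \<Longrightarrow> 0 \<le> l k" and B: "B \<in> sets G"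
    and le: "\<And>\<sigma>. \<sigma> \<in> PiE S (\<lambda>_. {-1, 1}) \<Longrightarrow> sign_shift_prob S l \<sigma> B \<le> m"
  shows "mixture_prob S l B \<le> m"
proof -
  let ?sg = "PiE S (\<lambda>_. {-1, 1 :: real})"
  have "(\<Sum>\<sigma>\<in>?sg. sign_shift_prob S l \<sigma> B) \<le> real (card ?sg) * m"
    by (rule sum_bounded_above) (rule le)
  moreover have "mixture_prob S l B =
    (\<Sum>\<sigma>\<in>?sg. sign_shift_prob S l \<sigma> B) / 2 ^ card S"
    by (rule mixture_lr_average[OF S l B])
  ultimately show ?thesis
    unfolding card_signs[OF S(2)] by (simp add: divide_le_eq mult.commute)
qed

lemma mixture_lr_ge:
  assumes S: "S \<subseteq> I" "finite S" and l: "\<And>k. k \<in> S \<Longrightarrow> 0 \<le> l k" and B: "B \<in> sets G"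
    and ge: "\<And>\<sigma>. \<sigma> \<in> PiE S (\<lambda>_. {-1, 1}) \<Longrightarrow> m \<le> sign_shift_prob S l \<sigma> B"
  shows "m \<le> mixture_prob S l B"
proof -
  let ?sg = "PiE S (\<lambda>_. {-1, 1 :: real})"
  have "real (card ?sg) * m \<le> (\<Sum>\<sigma>\<in>?sg. sign_shift_prob S l \<sigma> B)"
    by (rule sum_bounded_below) (rule ge)
  moreover have "mixture_prob S l B =
    (\<Sum>\<sigma>\<in>?sg. sign_shift_prob S l \<sigma> B) / 2 ^ card S"
    by (rule mixture_lr_average[OF S l B])
  ultimately show ?thesis
    unfolding card_signs[OF S(2)] by (simp add: le_divide_eq mult.commute)
qed

lemma mixture_lr_total_variation:
  assumes S: "S \<subseteq> I" "finite S" and l: "\<And>k. k \<in> S \<Longrightarrow> 0 \<le> l k" and A[measurable]: "A \<in> sets G"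
  shows "prob A - sqrt (exp (\<Sum>k\<in>S. (l k)\<^sup>2 / 2) - 1) \<le> mixture_prob S l A"
proof -
  note M = mixture_lr_moments(1)[OF S l]
  have i: "integrable G (\<lambda>\<xi>. mixture_lr S l \<xi> * indicator A \<xi>)"
    using A M by (rule integrable_real_mult_indicator)
  have i1: "integrable G (\<lambda>\<xi>. \<bar>mixture_lr S l \<xi> - 1\<bar>)" using M by auto
  have i2: "integrable G (indicator A :: _ \<Rightarrow> real)" by (simp add: emeasure_eq_measure)
  have "prob A - sqrt (exp (\<Sum>k\<in>S. (l k)\<^sup>2 / 2) - 1) \<le> prob A - expectation (\<lambda>\<xi>. \<bar>mixture_lr S l \<xi> - 1\<bar>)"
    using mixture_lr_minus_1[OF S l] by simp
  also have "\<dots> = expectation (\<lambda>\<xi>. indicator A \<xi> - \<bar>mixture_lr S l \<xi> - 1\<bar>)"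
    using i1 i2 A by simp
  also have "\<dots> \<le> mixture_prob S l A"
  proof (intro integral_mono i Bochner_Integration.integrable_diff i1 i2)
    fix \<xi>
    show "indicator A \<xi> - \<bar>mixture_lr S l \<xi> - 1\<bar> \<le> mixture_lr S l \<xi> * indicator A \<xi>"
      by (cases "\<xi> \<in> A") auto
  qed
  finally show ?thesis .
qed

text \<open>On \<open>B\<close> the function \<open>monotone_lr\<close> is at most a constant
  \<open>c\<close>, off \<open>B\<close> at least \<open>c\<close>, so under it \<open>B\<close>
  outweighs \<open>A\<close> by at most \<open>c * (prob B - prob A)\<close>. Passing to
  \<open>mixture_lr\<close> costs the \<open>L\<^sup>1\<close> distance once, not twice, since the
  pointwise comparison uses it only on the symmetric difference of \<open>A\<close> and
  \<open>B\<close>.\<close>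

lemma mixture_lr_neyman_pearson:
  fixes t :: real
  assumes S: "S \<subseteq> I" "finite S" and l: "\<And>k. k \<in> S \<Longrightarrow> l k = 2 * u * w k"
    "\<And>k. k \<in> S \<Longrightarrow> 0 \<le> l k" "\<And>k. k \<in> S \<Longrightarrow> l k \<le> 1 / 4" and u: "0 \<le> u" and A[measurable]: "A \<in> sets G"
  defines "B \<equiv> {\<xi> \<in> space G. chi_sum S w \<xi> \<le> t}"
  shows "mixture_prob S l B
      - sqrt (exp (\<Sum>k\<in>S. (l k)\<^sup>2 / 2) * (exp (\<Sum>k\<in>S. 2 * (l k) ^ 3) - 1))
      - exp (u * t) * max 0 (prob B - prob A)
    \<le> mixture_prob S l A"
proof -
  \<comment> \<open>The normalising constant of the exponential family in \<open>chi_sum\<close>;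
    \<open>1 - l \<le> exp (- l)\<close> gives \<open>K \<le> 1\<close>, so the critical value is at
    most \<open>exp (u * t)\<close>.\<close>
  define K where "K = (\<Prod>k\<in>S. sqrt (1 - l k) * exp (l k / 2))"
  have K: "0 \<le> K" "K \<le> 1"
  proof -
    have l1: "0 \<le> sqrt (1 - l k) * exp (l k / 2)" if "k \<in> S" for k
      using l(3)[OF that] by simp
    then show "0 \<le> K" unfolding K_def by (intro prod_nonneg) auto
    have "sqrt (1 - l k) * exp (l k / 2) \<le> 1" for k
    proof -
      have "sqrt (1 - l k) \<le> sqrt (exp (- l k))"
        using exp_ge_add_one_self[of "- l k"] by simp
      also have "\<dots> = exp (- (l k / 2))"
        by (rule real_sqrt_unique) (auto simp flip: exp_double)
      finally show ?thesis by (simp add: exp_minus field_simps)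
    qed
    then show "K \<le> 1" unfolding K_def using l1 by (intro prod_le_1) auto
  qed
  have mono: "monotone_lr S l \<xi> = K * exp (u * chi_sum S w \<xi>)" for \<xi>
  proof -
    have "monotone_lr S l \<xi> = (\<Prod>k\<in>S. (sqrt (1 - l k) * exp (l k / 2)) * exp (u * (w k * ((\<xi> k)\<^sup>2 - 1))))"
      unfolding monotone_lr_def
    proof (rule prod.cong[OF refl])
      fix k assume k: "k \<in> S"
      have e: "l k * (\<xi> k)\<^sup>2 / 2 = l k / 2 + u * (w k * ((\<xi> k)\<^sup>2 - 1))"
        using l(1)[OF k] by (simp add: algebra_simps)
      show "gauss_lr (l k) (\<xi> k) = (sqrt (1 - l k) * exp (l k / 2)) * exp (u * (w k * ((\<xi> k)\<^sup>2 - 1)))"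
        unfolding gauss_lr_def e exp_add by simp
    qed
    also have "\<dots> = K * exp (u * chi_sum S w \<xi>)"
      unfolding K_def chi_sum_def sum_distrib_left exp_sum[OF S(2)] prod.distrib ..
    finally show ?thesis .
  qed
  have [measurable]: "chi_sum S w \<in> borel_measurable G" using S by measurable
  have B[measurable]: "B \<in> sets G" unfolding B_def by measurable
  define c where "c = K * exp (u * t)"
  have c: "0 \<le> c" "c \<le> exp (u * t)" using K by (auto simp: c_def mult_left_le_one_le)
  note M = mixture_lr_moments(1)[of S l, OF S l(2)]
  note N = mixture_lr_monotone_lr[of S l, OF S l(2,3)]
  have iA: "integrable G (\<lambda>\<xi>. mixture_lr S l \<xi> * indicator A \<xi>)"
    using A M by (rule integrable_real_mult_indicator)
  have iB: "integrable G (\<lambda>\<xi>. mixture_lr S l \<xi> * indicator B \<xi>)"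
    using B M by (rule integrable_real_mult_indicator)
  have i1: "integrable G (\<lambda>\<xi>. \<bar>mixture_lr S l \<xi> - monotone_lr S l \<xi>\<bar>)" using M N by auto
  have i2: "integrable G (\<lambda>\<xi>. c * indicator A \<xi>)" "integrable G (\<lambda>\<xi>. c * indicator B \<xi>)"
    by (auto simp: emeasure_eq_measure)
  have "expectation (\<lambda>\<xi>. mixture_lr S l \<xi> * indicator B \<xi> - \<bar>mixture_lr S l \<xi> - monotone_lr S l \<xi>\<bar>
      + c * indicator A \<xi> - c * indicator B \<xi>) \<le> mixture_prob S l A"
  proof (intro integral_mono iA iB i1 i2 Bochner_Integration.integrable_add Bochner_Integration.integrable_diff)
    fix \<xi> assume \<xi>: "\<xi> \<in> space G"
    have 1: "\<xi> \<in> B \<Longrightarrow> monotone_lr S l \<xi> \<le> c"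
      unfolding mono c_def B_def using K u by (auto intro!: mult_left_mono)
    have 2: "\<xi> \<notin> B \<Longrightarrow> c \<le> monotone_lr S l \<xi>"
      unfolding mono c_def B_def using K u \<xi> by (auto intro!: mult_left_mono)
    show "mixture_lr S l \<xi> * indicator B \<xi> - \<bar>mixture_lr S l \<xi> - monotone_lr S l \<xi>\<bar>
      + c * indicator A \<xi> - c * indicator B \<xi> \<le> mixture_lr S l \<xi> * indicator A \<xi>"
      using 1 2 by (cases "\<xi> \<in> A"; cases "\<xi> \<in> B") auto
  qed
  moreover have "expectation (\<lambda>\<xi>. mixture_lr S l \<xi> * indicator B \<xi> - \<bar>mixture_lr S l \<xi> - monotone_lr S l \<xi>\<bar>
      + c * indicator A \<xi> - c * indicator B \<xi>) = mixture_prob S l B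
      - expectation (\<lambda>\<xi>. \<bar>mixture_lr S l \<xi> - monotone_lr S l \<xi>\<bar>) + c * prob A - c * prob B"
  proof -
    note d = Bochner_Integration.integrable_diff[OF iB i1]
    have "(\<integral>\<xi>. c * indicator A \<xi> \<partial>G) = c * prob A" "(\<integral>\<xi>. c * indicator B \<xi> \<partial>G) = c * prob B"
      using sets.sets_into_space[OF A] sets.sets_into_space[OF B] by (simp_all add: Int_absorb2)
    then show ?thesis
      by (simp only: Bochner_Integration.integral_diff[OF Bochner_Integration.integrable_add[OF d i2(1)] i2(2)]
        Bochner_Integration.integral_add[OF d i2(1)] Bochner_Integration.integral_diff[OF iB i1])
  qed
  \<comment> \<open>The constant \<open>c\<close> is to be replaced by an upper bound, so a negative
    difference is cut off at 0 beforehand.\<close>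
  moreover have "c * (prob B - prob A) \<le> exp (u * t) * max 0 (prob B - prob A)"
  proof -
    have "c * (prob B - prob A) \<le> c * max 0 (prob B - prob A)" using c(1) by (intro mult_left_mono) auto
    also have "\<dots> \<le> exp (u * t) * max 0 (prob B - prob A)" using c(2) by (intro mult_right_mono) auto
    finally show ?thesis .
  qed
  ultimately show ?thesis using N(2) unfolding right_diff_distrib[of c] by linarith
qed

lemma chi_sum_shift:
  assumes S: "S \<subseteq> I" "finite S"
  shows "chi_sum S w (\<lambda>k\<in>I. z k + \<xi> k)
    = chi_sum S w \<xi> + (\<Sum>k\<in>S. w k * (z k)\<^sup>2) + (\<Sum>k\<in>S. 2 * w k * z k * \<xi> k)"
proof -
  have "chi_sum S w (\<lambda>k\<in>I. z k + \<xi> k)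
    = (\<Sum>k\<in>S. w k * ((\<xi> k)\<^sup>2 - 1) + w k * (z k)\<^sup>2 + 2 * w k * z k * \<xi> k)"
    unfolding chi_sum_def using S by (intro sum.cong) (auto simp: power2_sum algebra_simps)
  then show ?thesis by (simp add: chi_sum_def sum.distrib)
qed

lemma prob_linear_part:
  assumes S: "S \<subseteq> I" "finite S" and \<eta>: "0 < \<eta>"
  shows "prob {\<xi> \<in> space G. \<eta> \<le> \<bar>\<Sum>k\<in>S. 2 * w k * z k * \<xi> k\<bar>} \<le> 4 * (\<Sum>k\<in>S. (w k)\<^sup>2 * (z k)\<^sup>2) / \<eta>\<^sup>2"
proof -
  have "prob {\<xi> \<in> space G. \<eta> \<le> \<bar>\<Sum>k\<in>S. 2 * w k * z k * \<xi> k\<bar>}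
    \<le> (\<Sum>k\<in>S. \<integral>x. (2 * w k * z k * x)\<^sup>2 \<partial>std_normal) / \<eta>\<^sup>2"
    by (rule chebyshev_sum[where f = "\<lambda>k x. 2 * w k * z k * x", OF S _ _ _ _ \<eta>])
      (simp_all add: std_normal_poly power_mult_distrib)
  also have "(\<Sum>k\<in>S. \<integral>x. (2 * w k * z k * x)\<^sup>2 \<partial>std_normal) = (\<Sum>k\<in>S. 4 * ((w k)\<^sup>2 * (z k)\<^sup>2))"
    by (intro sum.cong) (simp_all add: std_normal_poly power_mult_distrib)
  also have "\<dots> = 4 * (\<Sum>k\<in>S. (w k)\<^sup>2 * (z k)\<^sup>2)" by (simp add: sum_distrib_left)
  finally show ?thesis .
qed

text \<open>The shift adds to the statistic the constant \<open>h\<close> and a term linear in the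
  noise; by Chebyshev's inequality the latter stays below \<open>\<eta>\<close> outside an event of
  probability at most \<open>v\<close>.\<close>

lemma prob_chi_sum_shift:
  fixes w z :: "'i \<Rightarrow> real"
  assumes S: "S \<subseteq> I" "finite S" and \<eta>: "0 < \<eta>"
  defines "h \<equiv> \<Sum>k\<in>S. w k * (z k)\<^sup>2" and "v \<equiv> 4 * (\<Sum>k\<in>S. (w k)\<^sup>2 * (z k)\<^sup>2) / \<eta>\<^sup>2"
  shows "prob {\<xi> \<in> space G. chi_sum S w (\<lambda>k\<in>I. z k + \<xi> k) \<le> t} \<le> prob {\<xi> \<in> space G. chi_sum S w \<xi> \<le> t - h + \<eta>} + v"
    and "prob {\<xi> \<in> space G. chi_sum S w \<xi> \<le> t - h - \<eta>} - v \<le> prob {\<xi> \<in> space G. chi_sum S w (\<lambda>k\<in>I. z k + \<xi> k) \<le> t}"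
proof -
  let ?Y = "\<lambda>\<xi>. \<Sum>k\<in>S. 2 * w k * z k * \<xi> k"
  let ?X = "chi_sum S w"
  let ?E = "{\<xi> \<in> space G. \<eta> \<le> \<bar>?Y \<xi>\<bar>}"
  have [measurable]: "?Y \<in> borel_measurable G" "?X \<in> borel_measurable G"
    using S measurable_sum_coords[of S "\<lambda>k x. 2 * w k * z k * x"] measurable_chi_sum[of S w] by simp_all
  have E: "?E \<in> sets G" "prob ?E \<le> v"
    using prob_linear_part[OF S \<eta>] by (auto simp: v_def)
  have eq: "{\<xi> \<in> space G. ?X (\<lambda>k\<in>I. z k + \<xi> k) \<le> t} = {\<xi> \<in> space G. ?X \<xi> + h + ?Y \<xi> \<le> t}"
    by (simp add: chi_sum_shift[OF S] h_def)
  have m: "{\<xi> \<in> space G. ?X \<xi> + h + ?Y \<xi> \<le> t} \<in> sets G" "{\<xi> \<in> space G. ?X \<xi> \<le> y} \<in> sets G" for y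
    by measurable
  have "prob {\<xi> \<in> space G. ?X \<xi> + h + ?Y \<xi> \<le> t} \<le> prob ({\<xi> \<in> space G. ?X \<xi> \<le> t - h + \<eta>} \<union> ?E)"
    using m E by (intro finite_measure_mono) auto
  also have "\<dots> \<le> prob {\<xi> \<in> space G. ?X \<xi> \<le> t - h + \<eta>} + prob ?E"
    using m E by (intro measure_Un_le) auto
  finally show "prob {\<xi> \<in> space G. ?X (\<lambda>k\<in>I. z k + \<xi> k) \<le> t} \<le> prob {\<xi> \<in> space G. ?X \<xi> \<le> t - h + \<eta>} + v"
    unfolding eq using E by linarith
  have "prob {\<xi> \<in> space G. ?X \<xi> \<le> t - h - \<eta>} \<le> prob ({\<xi> \<in> space G. ?X \<xi> + h + ?Y \<xi> \<le> t} \<union> ?E)"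
    using m E by (intro finite_measure_mono) auto
  also have "\<dots> \<le> prob {\<xi> \<in> space G. ?X \<xi> + h + ?Y \<xi> \<le> t} + prob ?E"
    using m E by (intro measure_Un_le) auto
  finally show "prob {\<xi> \<in> space G. ?X \<xi> \<le> t - h - \<eta>} - v \<le> prob {\<xi> \<in> space G. ?X (\<lambda>k\<in>I. z k + \<xi> k) \<le> t}"
    unfolding eq using E by linarith
qed

text \<open>Chebyshev's inequality for the whole centred statistic. It serves the case of
  \<open>u\<close> tending to infinity, where the weights are not assumed small and no normal
  approximation is at hand.\<close>

lemma prob_chi_sum_shift_chebyshev:
  fixes w z :: "'i \<Rightarrow> real"
  assumes S: "S \<subseteq> I" "finite S"
  defines "h \<equiv> \<Sum>k\<in>S. w k * (z k)\<^sup>2"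
  assumes t: "t < h"
  shows "prob {\<xi> \<in> space G. chi_sum S w (\<lambda>k\<in>I. z k + \<xi> k) \<le> t}
    \<le> (2 * (\<Sum>k\<in>S. (w k)\<^sup>2) + 4 * (\<Sum>k\<in>S. (w k)\<^sup>2 * (z k)\<^sup>2)) / (h - t)\<^sup>2"
proof -
  let ?f = "\<lambda>k x. w k * (x\<^sup>2 - 1) + 2 * w k * z k * x"
  have sum: "(\<Sum>k\<in>S. ?f k (\<xi> k)) = chi_sum S w (\<lambda>k\<in>I. z k + \<xi> k) - h" for \<xi>
    unfolding chi_sum_shift[OF S] h_def by (simp add: chi_sum_def sum.distrib)
  have [measurable]: "(\<lambda>\<xi>. \<Sum>k\<in>S. ?f k (\<xi> k)) \<in> borel_measurable G"
    using S by (intro measurable_sum_coords) auto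
  have "prob {\<xi> \<in> space G. chi_sum S w (\<lambda>k\<in>I. z k + \<xi> k) \<le> t} \<le> prob {\<xi> \<in> space G. h - t \<le> \<bar>\<Sum>k\<in>S. ?f k (\<xi> k)\<bar>}"
  proof (rule finite_measure_mono)
    show "{\<xi> \<in> space G. chi_sum S w (\<lambda>k\<in>I. z k + \<xi> k) \<le> t} \<subseteq> {\<xi> \<in> space G. h - t \<le> \<bar>\<Sum>k\<in>S. ?f k (\<xi> k)\<bar>}"
      unfolding sum by auto
  qed measurable
  also have "\<dots> \<le> (\<Sum>k\<in>S. \<integral>x. (?f k x)\<^sup>2 \<partial>std_normal) / (h - t)\<^sup>2"
    using t by (intro chebyshev_sum[where f = ?f, OF S])
      (simp_all add: std_normal_poly std_normal_sqminus1 std_normal_quadratic_sq(1))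
  also have "(\<Sum>k\<in>S. \<integral>x. (?f k x)\<^sup>2 \<partial>std_normal) = (\<Sum>k\<in>S. 2 * (w k)\<^sup>2 + 4 * ((w k)\<^sup>2 * (z k)\<^sup>2))"
    by (intro sum.cong refl) (simp add: std_normal_quadratic_sq(2) power_mult_distrib)
  also have "\<dots> = 2 * (\<Sum>k\<in>S. (w k)\<^sup>2) + 4 * (\<Sum>k\<in>S. (w k)\<^sup>2 * (z k)\<^sup>2)"
    by (simp add: sum.distrib sum_distrib_left)
  finally show ?thesis .
qed

end

section \<open>The testing model\<close>

lemma Nstar_infinite: "infinite (Nstar :: ('d::finite \<Rightarrow> nat) set)"
proof
  assume "finite (Nstar :: ('d \<Rightarrow> nat) set)"
  moreover have "inj (\<lambda>n (_::'d). Suc n)" by (auto simp: inj_def fun_eq_iff)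
  moreover have "range (\<lambda>n (_::'d). Suc n) \<subseteq> Nstar" by (auto simp: Nstar_def)
  ultimately show False using finite_subset finite_imageD infinite_UNIV_nat by metis
qed

lemma finite_Nstar_bounded:
  assumes "\<And>l j. l \<in> X \<Longrightarrow> l j \<le> (n :: 'd::finite \<Rightarrow> nat) j"
  shows "finite X"
proof (rule finite_subset)
  show "X \<subseteq> (\<Pi>\<^sub>E j\<in>UNIV. {..n j})" using assms by (auto simp: PiE_def)
  show "finite (\<Pi>\<^sub>E j\<in>UNIV. {..n j})" by (intro finite_PiE) auto
qed

text \<open>Both types of \<open>a\<close> satisfy \<open>a l ^ 2 \<ge> g j (l j)\<close> for every \<open>j\<close>, where \<open>g j\<close> tends to infinity.\<close>

lemma coercive_weights:
  fixes A :: "('d::finite \<Rightarrow> nat) \<Rightarrow> real" and g :: "'d \<Rightarrow> nat \<Rightarrow> real"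
  assumes g1: "\<And>j n. 1 \<le> n \<Longrightarrow> 1 \<le> g j n" and lim: "\<And>j. filterlim (g j) at_top sequentially"
    and A: "(\<forall>l\<in>Nstar. A l = (\<Sum>j\<in>UNIV. g j (l j))) \<or> (\<forall>l\<in>Nstar. A l = (\<Prod>j\<in>UNIV. g j (l j)))"
  shows "\<And>l. l \<in> Nstar \<Longrightarrow> 1 \<le> A l" "\<And>K. finite {l \<in> Nstar. A l \<le> K}"
proof -
  have ge: "g j (l j) \<le> A l" if l: "l \<in> Nstar" for l j
  proof -
    have g: "1 \<le> g i (l i)" for i using g1 l by (auto simp: Nstar_def)
    have g0: "0 \<le> g i (l i)" for i using g[of i] by linarith
    have "g j (l j) \<le> (\<Sum>j\<in>UNIV. g j (l j))" using g0 by (intro member_le_sum) auto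
    moreover have "g j (l j) \<le> (\<Prod>j\<in>UNIV. g j (l j))"
    proof -
      have "1 \<le> (\<Prod>i\<in>UNIV - {j}. g i (l i))" using g by (intro prod_ge_1) auto
      then have "g j (l j) * 1 \<le> g j (l j) * (\<Prod>i\<in>UNIV - {j}. g i (l i))" using g0[of j] by (intro mult_left_mono)
      also have "\<dots> = (\<Prod>j\<in>UNIV. g j (l j))" by (simp add: prod.remove[of UNIV j])
      finally show ?thesis by simp
    qed
    ultimately show ?thesis using A l by auto
  qed
  show "1 \<le> A l" if "l \<in> Nstar" for l
    \<comment> \<open>Any coordinate serves for the lower bound; \<open>undefined\<close> names
      one.\<close>
    using ge[OF that, of undefined] g1[of "l undefined" undefined] that by (auto simp: Nstar_def)
  fix K
  have "\<exists>N. \<forall>n\<ge>N. K < g j n" for j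
    using lim[of j] by (simp add: filterlim_at_top_dense eventually_sequentially)
  then obtain N where N: "\<And>j n. N j \<le> n \<Longrightarrow> K < g j n" by metis
  show "finite {l \<in> Nstar. A l \<le> K}"
  proof (rule finite_Nstar_bounded)
    fix l j assume "l \<in> {l \<in> Nstar. A l \<le> K}"
    then have "g j (l j) \<le> K" using ge[of l j] by auto
    then show "l j \<le> N j" using N[of j "l j"] by (cases "N j \<le> l j") auto
  qed
qed

lemma sobolev_or_tensor_coercive:
  fixes a :: "('d::finite \<Rightarrow> nat) \<Rightarrow> real"
  assumes "sobolev_type a \<or> tensor_product_type a"
  shows "\<And>l. l \<in> Nstar \<Longrightarrow> 1 \<le> (a l)\<^sup>2" "\<And>K. finite {l \<in> Nstar. (a l)\<^sup>2 \<le> K}"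
proof -
  have "\<exists>s. (\<forall>j. 0 < s j) \<and>
    (\<exists>g\<in>{\<lambda>j n. real n powr (2 * s j), \<lambda>j n. exp (2 * s j * real n)}.
      (\<forall>l\<in>Nstar. (a l)\<^sup>2 = (\<Sum>j\<in>UNIV. g j (l j))) \<or> (\<forall>l\<in>Nstar. (a l)\<^sup>2 = (\<Prod>j\<in>UNIV. g j (l j))))"
    using assms unfolding sobolev_type_def tensor_product_type_def by auto
  then obtain s g where s: "\<And>j. 0 < s j"
    and g: "g = (\<lambda>j n. real n powr (2 * s j)) \<or> g = (\<lambda>j n. exp (2 * s j * real n))"
    and A: "(\<forall>l\<in>Nstar. (a l)\<^sup>2 = (\<Sum>j\<in>UNIV. g j (l j))) \<or> (\<forall>l\<in>Nstar. (a l)\<^sup>2 = (\<Prod>j\<in>UNIV. g j (l j)))"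
    by blast
  have g1: "1 \<le> g j n" if "1 \<le> n" for j n
    using g
  proof
    assume "g = (\<lambda>j n. real n powr (2 * s j))"
    then show ?thesis using that s[of j] by (simp add: ge_one_powr_ge_zero)
  next
    assume "g = (\<lambda>j n. exp (2 * s j * real n))"
    then show ?thesis using s[of j] by simp
  qed
  have lim: "filterlim (g j) at_top sequentially" for j
    using g
  proof
    have "0 < s j" by (rule s)
    then have "filterlim (\<lambda>n. real n powr (2 * s j)) at_top sequentially" by real_asymp
    moreover assume "g = (\<lambda>j n. real n powr (2 * s j))"
    ultimately show ?thesis by simp
  next
    have "0 < s j" by (rule s)
    then have "filterlim (\<lambda>n. exp (2 * s j * real n)) at_top sequentially" by real_asymp
    moreover assume "g = (\<lambda>j n. exp (2 * s j * real n))"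
    ultimately show ?thesis by simp
  qed
  show "\<And>l. l \<in> Nstar \<Longrightarrow> 1 \<le> (a l)\<^sup>2" "\<And>K. finite {l \<in> Nstar. (a l)\<^sup>2 \<le> K}"
    using coercive_weights[of g "\<lambda>l. (a l)\<^sup>2", OF g1 lim A] by auto
qed

text \<open>All factors lie in \<open>(0, 1]\<close> because \<open>t j \<ge> 0\<close>, so
  \<open>c1\<close> is an upper bound and the lower estimate is positive.\<close>

lemma ill_posed_bounded:
  fixes b :: "('d::finite \<Rightarrow> nat) \<Rightarrow> real"
  assumes "mildly_ill_posed b \<or> severely_ill_posed b"
  obtains B where "\<And>l. l \<in> Nstar \<Longrightarrow> b l \<noteq> 0" "\<And>l. l \<in> Nstar \<Longrightarrow> \<bar>b l\<bar> \<le> B"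
proof -
  have "\<exists>c0 c1 t. 0 < c0 \<and> c0 \<le> c1 \<and> (\<forall>j. 0 \<le> t j) \<and>
    (\<exists>g\<in>{\<lambda>j n. real n powr (- t j), \<lambda>j n. exp (- t j * real n)}.
      \<forall>l\<in>Nstar. c0 * (\<Prod>j\<in>UNIV. g j (l j)) \<le> \<bar>b l\<bar> \<and> \<bar>b l\<bar> \<le> c1 * (\<Prod>j\<in>UNIV. g j (l j)))"
    using assms unfolding mildly_ill_posed_def severely_ill_posed_def by auto
  then obtain c0 c1 t g where c: "0 < c0" "c0 \<le> c1" and t: "\<And>j. 0 \<le> t j"
    and g: "g = (\<lambda>j n. real n powr (- t j)) \<or> g = (\<lambda>j n. exp (- t j * real n))"
    and b: "\<And>l. l \<in> Nstar \<Longrightarrow> c0 * (\<Prod>j\<in>UNIV. g j (l j)) \<le> \<bar>b l\<bar>"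
      "\<And>l. l \<in> Nstar \<Longrightarrow> \<bar>b l\<bar> \<le> c1 * (\<Prod>j\<in>UNIV. g j (l j))"
    by blast
  have g01: "0 < g j n \<and> g j n \<le> 1" if "1 \<le> n" for j n
    using g
  proof
    assume "g = (\<lambda>j n. real n powr (- t j))"
    then show ?thesis using that t[of j] powr_mono[of "- t j" 0 "real n"] by simp
  next
    assume "g = (\<lambda>j n. exp (- t j * real n))"
    then show ?thesis using t[of j] by simp
  qed
  have P: "0 < (\<Prod>j\<in>UNIV. g j (l j))" "(\<Prod>j\<in>UNIV. g j (l j)) \<le> 1" if "l \<in> Nstar" for l
  proof -
    have g: "0 < g j (l j)" "g j (l j) \<le> 1" for j using g01 that by (auto simp: Nstar_def)
    then show "0 < (\<Prod>j\<in>UNIV. g j (l j))" "(\<Prod>j\<in>UNIV. g j (l j)) \<le> 1"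
      by (auto intro!: prod_pos prod_le_1 simp: less_imp_le)
  qed
  show ?thesis
  proof
    fix l :: "'d \<Rightarrow> nat" assume l: "l \<in> Nstar"
    have "0 < c0 * (\<Prod>j\<in>UNIV. g j (l j))" using P(1)[OF l] c by simp
    then show "b l \<noteq> 0" using b(1)[OF l] by auto
    have "\<bar>b l\<bar> \<le> c1 * (\<Prod>j\<in>UNIV. g j (l j))" by (rule b(2)[OF l])
    also have "\<dots> \<le> c1 * 1" using P[OF l] c by (intro mult_left_mono) auto
    finally show "\<bar>b l\<bar> \<le> c1" by simp
  qed
qed

text \<open>What is retained of ill-posedness and smoothness: \<open>b\<close> has no zeros and is
  bounded, and \<open>a\<close> is coercive.\<close>

locale testing_model =
  fixes a b :: "('d::finite \<Rightarrow> nat) \<Rightarrow> real" and B R :: real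
  assumes b_nonzero: "\<And>l. l \<in> Nstar \<Longrightarrow> b l \<noteq> 0" and b_bounded: "\<And>l. l \<in> Nstar \<Longrightarrow> \<bar>b l\<bar> \<le> B"
    and a_ge1: "\<And>l. l \<in> Nstar \<Longrightarrow> 1 \<le> (a l)\<^sup>2" and a_fin: "\<And>K. finite {l \<in> Nstar. (a l)\<^sup>2 \<le> K}"

locale testing_model_radius = testing_model a b B R for a b :: "('d::finite \<Rightarrow> nat) \<Rightarrow> real" and B R +
  fixes r :: real
  assumes r_pos: "0 < r"

sublocale testing_model_radius \<subseteq> ex: extremal_problem "Nstar :: ('d::finite \<Rightarrow> nat) set"
    "\<lambda>l. (b l) ^ 4" "\<lambda>l. (a l)\<^sup>2" "B ^ 4" "R\<^sup>2" "r\<^sup>2"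
proof
  show "infinite (Nstar :: ('d \<Rightarrow> nat) set)" by (rule Nstar_infinite)
  show "0 < (b l) ^ 4" if "l \<in> Nstar" for l using b_nonzero[OF that] by simp
  show "(b l) ^ 4 \<le> B ^ 4" if "l \<in> Nstar" for l
    using power_mono[OF b_bounded[OF that], of 4] by simp
qed (use a_ge1 a_fin in auto)

context testing_model_radius
begin

abbreviation "sol \<equiv> extremal_solution a b R r"

definition supp :: "('d \<Rightarrow> nat) set" where
  "supp = {l \<in> Nstar. sol l \<noteq> 0}"

lemma alternative_iff_feasible: "\<theta> \<in> alternative a R r \<longleftrightarrow> (\<lambda>l. (\<theta> l)\<^sup>2) \<in> ex.feasible"
proof -
  have "r \<le> sqrt x \<longleftrightarrow> r\<^sup>2 \<le> x" for x
    using r_pos real_le_rsqrt[of r x] real_sqrt_le_iff[of "r\<^sup>2" x] by auto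
  then show ?thesis by (auto simp: alternative_def ellipsoid_def ex.feasible_def)
qed

lemma energy_eq_form: "energy b \<theta> = ex.form (\<lambda>l. (\<theta> l)\<^sup>2) (\<lambda>l. (\<theta> l)\<^sup>2)"
  by (simp add: energy_def ex.form_def flip: power_add)

text \<open>Gives meaning to the \<open>SOME\<close> in the definition: the square roots of a
  minimiser in the squared parameters minimise the energy.\<close>

lemma extremal_solution:
  assumes "alternative a R r \<noteq> {}"
  shows "sol \<in> alternative a R r" "\<And>\<theta>. \<theta> \<in> alternative a R r \<Longrightarrow> energy b sol \<le> energy b \<theta>"
proof -
  from assms have "ex.feasible \<noteq> {}" using alternative_iff_feasible by blast
  then obtain v where v: "v \<in> ex.feasible" "\<And>w. w \<in> ex.feasible \<Longrightarrow> ex.form v v \<le> ex.form w w"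
    by (rule ex.minimiser_exists) blast
  define \<theta> where "\<theta> l = (if l \<in> Nstar then sqrt (v l) else 0)" for l
  have eq: "(\<theta> l)\<^sup>2 = v l" if "l \<in> Nstar" for l
    using ex.feasibleD(1)[OF v(1) that] that by (simp add: \<theta>_def)
  have f: "(\<lambda>l. (\<theta> l)\<^sup>2) \<in> ex.feasible"
    using v(1) unfolding ex.feasible_def by (simp add: eq cong: infsum_cong summable_on_cong)
  have "ex.form (\<lambda>l. (\<theta> l)\<^sup>2) (\<lambda>l. (\<theta> l)\<^sup>2) = ex.form v v"
    unfolding ex.form_def by (intro infsum_cong) (simp add: eq)
  then have "\<theta> \<in> alternative a R r \<and> (\<forall>\<theta>'\<in>alternative a R r. energy b \<theta> \<le> energy b \<theta>')"
    using f v(2) by (simp add: alternative_iff_feasible energy_eq_form)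
  then have "sol \<in> alternative a R r \<and> (\<forall>\<theta>'\<in>alternative a R r. energy b sol \<le> energy b \<theta>')"
    unfolding extremal_solution_def by (rule someI[of "\<lambda>\<theta>. \<theta> \<in> alternative a R r \<and> (\<forall>\<theta>'\<in>alternative a R r. energy b \<theta> \<le> energy b \<theta>')"])
  then show "sol \<in> alternative a R r" "\<And>\<theta>. \<theta> \<in> alternative a R r \<Longrightarrow> energy b sol \<le> energy b \<theta>"
    by auto
qed

end

locale nonempty_alternative = testing_model_radius a b B R r for a b :: "('d::finite \<Rightarrow> nat) \<Rightarrow> real" and B R r +
  assumes nonempty: "alternative a R r \<noteq> {}"
begin

abbreviation "w \<equiv> weight a b R r"
abbreviation "E \<equiv> energy b sol"

lemma sol_feasible: "(\<lambda>l. (sol l)\<^sup>2) \<in> ex.feasible"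
  using extremal_solution(1)[OF nonempty] by (simp add: alternative_iff_feasible)

lemma sol_minimal:
  assumes f: "f \<in> ex.feasible"
  shows "ex.form (\<lambda>l. (sol l)\<^sup>2) (\<lambda>l. (sol l)\<^sup>2) \<le> ex.form f f"
proof -
  define \<theta> where "\<theta> l = (if l \<in> Nstar then sqrt (f l) else 0)" for l
  have eq: "(\<theta> l)\<^sup>2 = f l" if "l \<in> Nstar" for l
    using ex.feasibleD(1)[OF f that] that by (simp add: \<theta>_def)
  have "(\<lambda>l. (\<theta> l)\<^sup>2) \<in> ex.feasible"
    using f unfolding ex.feasible_def by (simp add: eq cong: infsum_cong summable_on_cong)
  moreover have "ex.form (\<lambda>l. (\<theta> l)\<^sup>2) (\<lambda>l. (\<theta> l)\<^sup>2) = ex.form f f"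
    unfolding ex.form_def by (intro infsum_cong) (simp add: eq)
  ultimately show ?thesis
    using extremal_solution(2)[OF nonempty, of \<theta>] by (simp add: alternative_iff_feasible energy_eq_form)
qed

lemma supp: "supp \<subseteq> Nstar" "finite supp"
  using ex.minimiser_finite_support[OF sol_feasible sol_minimal] by (auto simp: supp_def)

lemma infsum_supp:
  fixes f :: "('d \<Rightarrow> nat) \<Rightarrow> real"
  assumes "\<And>l. l \<in> Nstar \<Longrightarrow> sol l = 0 \<Longrightarrow> f l = 0"
  shows "infsum f Nstar = (\<Sum>l\<in>supp. f l)"
proof -
  have "infsum f Nstar = infsum f supp"
    using assms by (intro infsum_cong_neutral) (auto simp: supp_def)
  then show ?thesis using supp by simp
qed

lemma energy_sum: "E = (\<Sum>l\<in>supp. (b l) ^ 4 * (sol l) ^ 4)"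
  unfolding energy_def by (rule infsum_supp) simp

text \<open>Mass at least \<open>r\<^sup>2 > 0\<close> forces a nonempty support, on which every
  term is positive. The weights divide by \<open>sqrt (2 * E)\<close>.\<close>

lemma energy_pos: "0 < E"
proof -
  have "supp \<noteq> {}"
  proof
    assume "supp = {}"
    then have "infsum (\<lambda>l. (sol l)\<^sup>2) Nstar = 0" using infsum_supp[of "\<lambda>l. (sol l)\<^sup>2"] by simp
    then show False using ex.feasibleD(5)[OF sol_feasible] r_pos by simp
  qed
  then show ?thesis
    unfolding energy_sum using supp b_nonzero by (intro sum_pos) (auto simp: supp_def)
qed

lemma weight_eq: "w l = (b l)\<^sup>2 * (sol l)\<^sup>2 / sqrt (2 * E)"
  by (simp add: weight_def)

lemma weight_nonneg: "0 \<le> w l"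
  using energy_pos by (simp add: weight_eq)

lemma weight_zero: "sol l = 0 \<Longrightarrow> w l = 0"
  by (simp add: weight_eq)

text \<open>Unit variance of the statistic under the null hypothesis, as
  \<open>x\<^sup>2 - 1\<close> has variance 2; it matches the normalisation in
  \<open>clt_bound\<close>.\<close>

lemma sum_weight_sq: "(\<Sum>l\<in>supp. (w l)\<^sup>2) = 1 / 2"
proof -
  have "(w l)\<^sup>2 = (b l) ^ 4 * (sol l) ^ 4 / (2 * E)" for l
    using energy_pos by (simp add: weight_eq power_divide power_mult_distrib flip: power_mult)
  then have "(\<Sum>l\<in>supp. (w l)\<^sup>2) = E / (2 * E)" by (simp add: energy_sum flip: sum_divide_distrib)
  then show ?thesis using energy_pos by simp
qed

lemma weight_le_1: "l \<in> supp \<Longrightarrow> w l \<le> 1"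
proof -
  assume l: "l \<in> supp"
  have "(w l)\<^sup>2 \<le> (\<Sum>l\<in>supp. (w l)\<^sup>2)" using l supp by (intro member_le_sum) auto
  then have "(w l)\<^sup>2 \<le> 1\<^sup>2" using sum_weight_sq by simp
  then show ?thesis by (rule power2_le_imp_le) simp
qed

lemma weight_le_max: "l \<in> supp \<Longrightarrow> w l \<le> max_weight a b R r"
proof -
  assume l: "l \<in> supp"
  have "w l \<le> 1" if "l \<in> Nstar" for l
    using weight_le_1[of l] weight_zero[of l] that by (cases "sol l = 0") (auto simp: supp_def)
  \<comment> \<open>Without an upper bound the real supremum in \<open>max_weight\<close> would be
    an unspecified value.\<close>
  then have "bdd_above (w ` Nstar)" by (auto intro!: bdd_aboveI2)
  then show ?thesis unfolding max_weight_def using l supp by (intro cSUP_upper) auto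
qed

lemma max_weight_nonneg: "0 \<le> max_weight a b R r"
proof -
  have "supp \<noteq> {}" using sum_weight_sq by auto
  then show ?thesis using weight_le_max weight_nonneg by (metis all_not_in_conv order_trans)
qed

lemma test_statistic_eq:
  "test_statistic a b R \<epsilon> r y = (\<Sum>l\<in>supp. w l * ((y l / \<epsilon>)\<^sup>2 - 1))"
  unfolding test_statistic_def by (rule infsum_supp) (simp add: weight_zero)

end

locale noise_level = nonempty_alternative a b B R r for a b :: "('d::finite \<Rightarrow> nat) \<Rightarrow> real" and B R r +
  fixes \<epsilon> :: real
  assumes eps_pos: "0 < \<epsilon>"
begin

text \<open>The real counterpart of \<open>extremal\<close>, which is finite here because the
  alternative is nonempty.\<close>

definition u :: real where
  "u = sqrt (E / 2) / \<epsilon>\<^sup>2"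

lemma u_pos: "0 < u"
  using energy_pos eps_pos by (simp add: u_def)

lemma u_sq: "u\<^sup>2 = E / (2 * \<epsilon> ^ 4)"
  using energy_pos by (simp add: u_def power_divide flip: power_mult)

lemma extremal_eq: "extremal a b R \<epsilon> r = ereal u"
proof -
  have "extremal_sq a b R \<epsilon> r = ereal (1 / (2 * \<epsilon> ^ 4) * E)"
    unfolding extremal_sq_def
  proof (rule antisym)
    show "(INF \<theta>\<in>alternative a R r. ereal (1 / (2 * \<epsilon> ^ 4) * energy b \<theta>)) \<le> ereal (1 / (2 * \<epsilon> ^ 4) * E)"
      by (rule INF_lower) (rule extremal_solution(1)[OF nonempty])
    show "ereal (1 / (2 * \<epsilon> ^ 4) * E) \<le> (INF \<theta>\<in>alternative a R r. ereal (1 / (2 * \<epsilon> ^ 4) * energy b \<theta>))"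
    proof (rule INF_greatest)
      fix \<theta> assume "\<theta> \<in> alternative a R r"
      then have "E \<le> energy b \<theta>" by (rule extremal_solution(2)[OF nonempty])
      then show "ereal (1 / (2 * \<epsilon> ^ 4) * E) \<le> ereal (1 / (2 * \<epsilon> ^ 4) * energy b \<theta>)"
        using eps_pos by (simp add: divide_right_mono)
    qed
  qed
  moreover have "sqrt (1 / (2 * \<epsilon> ^ 4) * E) = u"
    using u_sq u_pos by (intro real_sqrt_unique) auto
  ultimately show ?thesis unfolding extremal_def by simp
qed

text \<open>The squared signal-to-noise ratio of the extremal solution in one coordinate; this
  identity is the origin of the parameter \<open>2 * u * w l\<close> of the likelihood
  ratios.\<close>

lemma scaled_sol: "((b l * sol l) / \<epsilon>)\<^sup>2 = 2 * u * w l"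
proof -
  have s: "sqrt (2 * E) = 2 * sqrt (E / 2)"
    using real_sqrt_mult[of 4 "E / 2"] by simp
  have "0 < sqrt (E / 2)" using energy_pos by simp
  then show ?thesis unfolding u_def weight_eq s by (simp add: power_divide power_mult_distrib)
qed

definition shift :: "(('d \<Rightarrow> nat) \<Rightarrow> real) \<Rightarrow> ('d \<Rightarrow> nat) \<Rightarrow> real" where
  "shift \<theta> l = b l * \<theta> l / \<epsilon>"

text \<open>The variational inequality: the extremal solution is the hardest alternative for the statistic.\<close>

lemma mean_shift_ge:
  assumes \<theta>: "\<theta> \<in> alternative a R r"
  shows "u \<le> (\<Sum>l\<in>supp. w l * (shift \<theta> l)\<^sup>2)"
proof -
  let ?s = "\<lambda>l. (sol l)\<^sup>2" and ?t = "\<lambda>l. (\<theta> l)\<^sup>2"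
  have "E \<le> ex.form ?s ?t"
    unfolding energy_eq_form
    using ex.variational_inequality[OF sol_feasible sol_minimal] \<theta> by (simp add: alternative_iff_feasible)
  also have "\<dots> = (\<Sum>l\<in>supp. (b l) ^ 4 * ((sol l)\<^sup>2 * (\<theta> l)\<^sup>2))"
    unfolding ex.form_def by (rule infsum_supp) simp
  also have "\<dots> = (\<Sum>l\<in>supp. (sqrt (2 * E) * \<epsilon>\<^sup>2) * (w l * (shift \<theta> l)\<^sup>2))"
  proof (intro sum.cong refl)
    fix l
    have "sqrt (2 * E) \<noteq> 0" using energy_pos by simp
    then show "(b l) ^ 4 * ((sol l)\<^sup>2 * (\<theta> l)\<^sup>2) = (sqrt (2 * E) * \<epsilon>\<^sup>2) * (w l * (shift \<theta> l)\<^sup>2)"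
      using eps_pos by (simp add: weight_eq shift_def power_divide power_mult_distrib power4_eq_xxxx power2_eq_square)
  qed
  also have "\<dots> = sqrt (2 * E) * \<epsilon>\<^sup>2 * (\<Sum>l\<in>supp. w l * (shift \<theta> l)\<^sup>2)" by (simp add: sum_distrib_left)
  finally have "E / (sqrt (2 * E) * \<epsilon>\<^sup>2) \<le> (\<Sum>l\<in>supp. w l * (shift \<theta> l)\<^sup>2)"
    using energy_pos eps_pos by (simp add: divide_le_eq mult.commute)
  moreover have "E / (sqrt (2 * E) * \<epsilon>\<^sup>2) = u"
  proof -
    have s: "sqrt (2 * E) = 2 * sqrt (E / 2)"
      using real_sqrt_mult[of 4 "E / 2"] by simp
    have "sqrt (E / 2) * sqrt (E / 2) = \<bar>E / 2\<bar>" by (rule real_sqrt_mult_self)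
    moreover have "\<bar>E / 2\<bar> = E / 2" using energy_pos by simp
    ultimately have "0 < sqrt (E / 2)" "sqrt (E / 2) * (2 * sqrt (E / 2)) = E"
      using energy_pos by (auto simp only: mult.left_commute[of _ 2] real_sqrt_gt_0_iff)
    then have "E / (2 * sqrt (E / 2)) = sqrt (E / 2)" by (subst divide_eq_eq) simp
    then show ?thesis unfolding u_def s by (metis divide_divide_eq_left)
  qed
  ultimately show ?thesis by simp
qed

text \<open>The parameters with the same absolute values as the extremal solution carry the prior of
  the lower bound.\<close>

definition sign_change :: "(('d \<Rightarrow> nat) \<Rightarrow> real) \<Rightarrow> ('d \<Rightarrow> nat) \<Rightarrow> real" where
  "sign_change \<sigma> l = (if l \<in> supp then \<sigma> l * \<bar>b l * sol l\<bar> / b l else 0)"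

lemma sign_change_alternative:
  assumes \<sigma>: "\<sigma> \<in> PiE supp (\<lambda>_. {-1, 1})"
  shows "sign_change \<sigma> \<in> alternative a R r"
proof -
  have eq: "(sign_change \<sigma> l)\<^sup>2 = (sol l)\<^sup>2" if l: "l \<in> Nstar" for l
  proof (cases "l \<in> supp")
    case True
    then have "\<sigma> l = - 1 \<or> \<sigma> l = 1" using \<sigma> by auto
    then show ?thesis
      using True b_nonzero[OF l] by (auto simp: sign_change_def power_divide power_mult_distrib)
  next
    case False
    then show ?thesis using l by (simp add: sign_change_def supp_def)
  qed
  show ?thesis
    using sol_feasible unfolding alternative_iff_feasible ex.feasible_def
    by (simp add: eq cong: infsum_cong summable_on_cong)
qed

text \<open>The absolute value and the division by \<open>b l\<close> in \<open>sign_change\<close>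
  remove the signs of \<open>b\<close> and of the solution, so the shift carries exactly the sign
  \<open>\<sigma> l\<close>.\<close>

lemma shift_sign_change:
  assumes l: "l \<in> Nstar"
  shows "shift (sign_change \<sigma>) l = (if l \<in> supp then \<sigma> l * sqrt (2 * u * w l) else 0)"
proof -
  have "sqrt (2 * u * w l) = \<bar>b l * sol l\<bar> / \<epsilon>"
    unfolding scaled_sol[symmetric] real_sqrt_abs using eps_pos by simp
  then show ?thesis using b_nonzero[OF l] by (simp add: shift_def sign_change_def)
qed

end

section \<open>Errors of tests at a fixed noise level\<close>

lemma infsum_eq_integral_count_space:
  fixes f :: "'i \<Rightarrow> real"
  shows "infsum f I = integral\<^sup>L (count_space I) f"
proof (cases "f summable_on I")
  case True
  then have "Infinite_Set_Sum.abs_summable_on f I"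
    using summable_on_iff_abs_summable_on_real abs_summable_equivalent by blast
  then show ?thesis using infsetsum_infsum by (metis infsetsum_def)
next
  case False
  then have "\<not> Infinite_Set_Sum.abs_summable_on f I"
    using summable_on_iff_abs_summable_on_real abs_summable_equivalent by blast
  then have "\<not> integrable (count_space I) f" by (simp add: Infinite_Set_Sum.abs_summable_on_def)
  then show ?thesis using False by (simp add: infsum_not_exists not_integrable_integral_eq)
qed

text \<open>An infinite sum is the integral against counting measure, both being 0 where summability
  fails. Measurability of integrals in a parameter then covers convergent and divergent points
  alike.\<close>

lemma borel_measurable_infsum:
  fixes f :: "'i \<Rightarrow> 'a \<Rightarrow> real"
  assumes I: "countable I" and f: "\<And>k. k \<in> I \<Longrightarrow> f k \<in> borel_measurable M"
  shows "(\<lambda>x. \<Sum>\<^sub>\<infinity>k\<in>I. f k x) \<in> borel_measurable M"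
proof -
  interpret sigma_finite_measure "count_space I"
    using I by (rule sigma_finite_measure_count_space_countable)
  have "(\<lambda>p. f (fst p) (snd p)) \<in> borel_measurable (count_space I \<Otimes>\<^sub>M M)"
    using I f by (intro measurable_pair_measure_countable1) auto
  then have "(\<lambda>p. f (fst p) (snd p)) \<circ> (\<lambda>(x, k). (k, x)) \<in> borel_measurable (M \<Otimes>\<^sub>M count_space I)"
    by (rule measurable_comp[OF measurable_pair_swap'])
  then have "case_prod (\<lambda>x k. f k x) \<in> borel_measurable (M \<Otimes>\<^sub>M count_space I)"
    by (simp add: comp_def case_prod_unfold)
  then show ?thesis
    unfolding infsum_eq_integral_count_space by (rule borel_measurable_lebesgue_integral)
qed

text \<open>This includes empty alternatives, where \<open>extremal_solution\<close> is an
  unspecified sequence and the statistic may be a genuinely infinite sum.\<close>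

lemma is_test_Psi_test: "is_test (Psi_test a b R \<epsilon> r t)"
proof -
  have "(\<lambda>y. \<Sum>\<^sub>\<infinity>k\<in>Nstar. weight a b R r k * ((y k / \<epsilon>)\<^sup>2 - 1)) \<in> borel_measurable obs_space"
    unfolding obs_space_def by (intro borel_measurable_infsum) auto
  then have [measurable]: "test_statistic a b R \<epsilon> r \<in> borel_measurable obs_space"
    by (simp add: test_statistic_def[abs_def])
  show ?thesis unfolding is_test_def Psi_test_def[abs_def] by measurable
qed

interpretation gs: gaussian_sequence "Nstar :: ('d::finite \<Rightarrow> nat) set" .

text \<open>The acceptance region transported to pure noise by
  \<open>y = \<epsilon> * \<xi>\<close>: the null law becomes \<open>G\<close>, and an alternative
  becomes the shift by \<open>b * \<theta> / \<epsilon>\<close>.\<close>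

definition accept_set :: "real \<Rightarrow> ((('d::finite \<Rightarrow> nat) \<Rightarrow> real) \<Rightarrow> nat) \<Rightarrow> (('d \<Rightarrow> nat) \<Rightarrow> real) set" where
  "accept_set \<epsilon> \<psi> = {\<xi> \<in> space gs.G. \<psi> (\<lambda>l\<in>Nstar. \<epsilon> * \<xi> l) = 0}"

abbreviation accept_prob where
  "accept_prob b \<epsilon> \<theta> \<psi> \<equiv> gs.P.prob {\<xi> \<in> space gs.G. (\<lambda>l\<in>Nstar. b l * \<theta> l / \<epsilon> + \<xi> l) \<in> accept_set \<epsilon> \<psi>}"

lemma measurable_observation[measurable]:
  "(\<lambda>\<xi>. \<lambda>l\<in>Nstar. x l + \<epsilon> * \<xi> l) \<in> gs.G \<rightarrow>\<^sub>M obs_space"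
  unfolding obs_space_def by (rule measurable_restrict) measurable

lemma test_values:
  assumes "is_test \<psi>" "y \<in> space obs_space"
  shows "\<psi> y = 0 \<or> \<psi> y = 1"
  using measurable_space[OF assms(1)[unfolded is_test_def] assms(2)] by simp

lemma test_level_sets:
  assumes "is_test \<psi>"
  shows "{y \<in> space obs_space. \<psi> y = 0} \<in> sets obs_space"
proof -
  have "{y \<in> space obs_space. \<psi> y = 0} = \<psi> -` {0} \<inter> space obs_space" by blast
  then show ?thesis
    using measurable_sets[OF assms(1)[unfolded is_test_def], of "{0}"] by simp
qed

lemma observation_in_space: "(\<lambda>l\<in>Nstar. x l) \<in> space obs_space"
  by (simp add: obs_space_def space_PiM)

lemma observation_in_space_G: "(\<lambda>l\<in>Nstar. x l) \<in> space gs.G"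
  by (simp add: space_PiM)

lemma accept_set_measurable:
  assumes "is_test \<psi>"
  shows "accept_set \<epsilon> \<psi> \<in> sets gs.G"
proof -
  have "accept_set \<epsilon> \<psi> = (\<lambda>\<xi>. \<lambda>l\<in>Nstar. 0 + \<epsilon> * \<xi> l) -` {y \<in> space obs_space. \<psi> y = 0} \<inter> space gs.G"
    unfolding accept_set_def vimage_def mem_Collect_eq by (simp add: observation_in_space Int_def conj_commute)
  also have "\<dots> \<in> sets gs.G"
    by (rule measurable_sets[OF measurable_observation test_level_sets[OF assms]])
  finally show ?thesis .
qed

lemma prob_space_obs_law: "prob_space (obs_law b \<epsilon> \<theta>)"
  unfolding obs_law_def by (rule gs.P.prob_space_distr) (rule measurable_observation)

lemma emeasure_obs_law_accept:
  assumes t: "is_test \<psi>" and \<epsilon>: "0 < \<epsilon>"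
  shows "emeasure (obs_law b \<epsilon> \<theta>) {y \<in> space obs_space. \<psi> y = 0}
    = ennreal (accept_prob b \<epsilon> \<theta> \<psi>)"
proof -
  have "emeasure (obs_law b \<epsilon> \<theta>) {y \<in> space obs_space. \<psi> y = 0} = emeasure gs.G
    ((\<lambda>\<xi>. \<lambda>l\<in>Nstar. b l * \<theta> l + \<epsilon> * \<xi> l) -` {y \<in> space obs_space. \<psi> y = 0} \<inter> space gs.G)"
    unfolding obs_law_def by (rule emeasure_distr[OF measurable_observation test_level_sets[OF t]])
  also have "(\<lambda>\<xi>. \<lambda>l\<in>Nstar. b l * \<theta> l + \<epsilon> * \<xi> l) -` {y \<in> space obs_space. \<psi> y = 0} \<inter> space gs.G
    = {\<xi> \<in> space gs.G. (\<lambda>l\<in>Nstar. b l * \<theta> l / \<epsilon> + \<xi> l) \<in> accept_set \<epsilon> \<psi>}"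
  proof -
    have "(\<lambda>l\<in>Nstar. \<epsilon> * (\<lambda>l\<in>Nstar. b l * \<theta> l / \<epsilon> + \<xi> l) l) = (\<lambda>l\<in>Nstar. b l * \<theta> l + \<epsilon> * \<xi> l)" for \<xi> :: "('a \<Rightarrow> nat) \<Rightarrow> real"
      using \<epsilon> by (auto simp: fun_eq_iff distrib_left)
    then show ?thesis
      unfolding accept_set_def vimage_def mem_Collect_eq
      by (simp add: observation_in_space observation_in_space_G Int_def conj_commute)
  qed
  finally show ?thesis by (simp add: gs.P.emeasure_eq_measure)
qed

lemma type1_error_eq:
  assumes t: "is_test \<psi>" and \<epsilon>: "0 < \<epsilon>"
  shows "measure (obs_law b \<epsilon> (\<lambda>_. 0)) {y \<in> space obs_space. \<psi> y = 1} = 1 - gs.P.prob (accept_set \<epsilon> \<psi>)"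
proof -
  interpret P: prob_space "obs_law b \<epsilon> (\<lambda>_. 0)" by (rule prob_space_obs_law)
  have s: "sets (obs_law b \<epsilon> (\<lambda>_. 0)) = sets obs_space" "space (obs_law b \<epsilon> (\<lambda>_. 0)) = space obs_space"
    by (simp_all add: obs_law_def)
  have "{y \<in> space obs_space. \<psi> y = 1} = space obs_space - {y \<in> space obs_space. \<psi> y = 0}"
    using test_values[OF t] by fastforce
  then have "measure (obs_law b \<epsilon> (\<lambda>_. 0)) {y \<in> space obs_space. \<psi> y = 1}
    = 1 - measure (obs_law b \<epsilon> (\<lambda>_. 0)) {y \<in> space obs_space. \<psi> y = 0}"
    using P.prob_compl[of "{y \<in> space obs_space. \<psi> y = 0}"] test_level_sets[OF t] by (simp add: s)
  also have "measure (obs_law b \<epsilon> (\<lambda>_. 0)) {y \<in> space obs_space. \<psi> y = 0}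
    = gs.P.prob {\<xi> \<in> space gs.G. (\<lambda>l\<in>Nstar. 0 + \<xi> l) \<in> accept_set \<epsilon> \<psi>}"
    using emeasure_obs_law_accept[OF t \<epsilon>, of b "\<lambda>_. 0"] by (simp add: measure_def)
  also have "{\<xi> \<in> space gs.G. (\<lambda>l\<in>Nstar. 0 + \<xi> l) \<in> accept_set \<epsilon> \<psi>} = accept_set \<epsilon> \<psi>"
  proof -
    have "(\<lambda>l\<in>Nstar. 0 + \<xi> l) = \<xi>" if "\<xi> \<in> space gs.G" for \<xi> :: "('a \<Rightarrow> nat) \<Rightarrow> real"
      using that by (auto simp: space_PiM PiE_def extensional_def fun_eq_iff)
    then have "{\<xi> \<in> space gs.G. (\<lambda>l\<in>Nstar. 0 + \<xi> l) \<in> accept_set \<epsilon> \<psi>} = {\<xi> \<in> space gs.G. \<xi> \<in> accept_set \<epsilon> \<psi>}"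
      by (intro Collect_cong conj_cong refl) (simp only:)
    then show ?thesis by (auto simp: accept_set_def)
  qed
  finally show ?thesis .
qed

lemma type2_error_bounds:
  assumes t: "is_test \<psi>" and \<epsilon>: "0 < \<epsilon>"
  shows type2_error_ge: "\<theta> \<in> \<Theta> \<Longrightarrow>
      accept_prob b \<epsilon> \<theta> \<psi> \<le> type2_error b \<epsilon> \<Theta> \<psi>"
    and type2_error_le: "0 \<le> m \<Longrightarrow> (\<And>\<theta>. \<theta> \<in> \<Theta> \<Longrightarrow>
      accept_prob b \<epsilon> \<theta> \<psi> \<le> m) \<Longrightarrow> type2_error b \<epsilon> \<Theta> \<psi> \<le> m"
proof -
  let ?p = "\<lambda>\<theta>. accept_prob b \<epsilon> \<theta> \<psi>"
  have eq: "type2_error b \<epsilon> \<Theta> \<psi> = enn2real (SUP \<theta>\<in>\<Theta>. ennreal (?p \<theta>))"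
    unfolding type2_error_def emeasure_obs_law_accept[OF t \<epsilon>] ..
  have "(SUP \<theta>\<in>\<Theta>. ennreal (?p \<theta>)) \<le> 1" by (rule SUP_least) simp
  then have fin: "(SUP \<theta>\<in>\<Theta>. ennreal (?p \<theta>)) < top" by (simp add: order_le_less_trans)
  show "?p \<theta> \<le> type2_error b \<epsilon> \<Theta> \<psi>" if "\<theta> \<in> \<Theta>"
  proof -
    have "ennreal (?p \<theta>) \<le> (SUP \<theta>\<in>\<Theta>. ennreal (?p \<theta>))" using that by (rule SUP_upper)
    then have "enn2real (ennreal (?p \<theta>)) \<le> enn2real (SUP \<theta>\<in>\<Theta>. ennreal (?p \<theta>))"
      using fin by (intro enn2real_mono)
    then show ?thesis by (simp add: eq)
  qed
  show "type2_error b \<epsilon> \<Theta> \<psi> \<le> m" if "0 \<le> m" "\<And>\<theta>. \<theta> \<in> \<Theta> \<Longrightarrow> ?p \<theta> \<le> m"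
  proof -
    have "(SUP \<theta>\<in>\<Theta>. ennreal (?p \<theta>)) \<le> ennreal m"
      using that by (intro SUP_least) (auto intro: ennreal_leI)
    then show ?thesis unfolding eq using that(1) by (intro enn2real_leI)
  qed
qed

lemma type2_error_nonneg: "0 \<le> type2_error b \<epsilon> \<Theta> \<psi>"
  by (simp add: type2_error_def)

lemma level_testsD:
  assumes "\<psi> \<in> level_tests b \<alpha> \<delta> \<epsilon>" "0 < \<epsilon>"
  shows "is_test \<psi>" "1 - \<alpha> - \<delta> \<epsilon> \<le> gs.P.prob (accept_set \<epsilon> \<psi>)"
  using assms type1_error_eq[of \<psi> \<epsilon> b] by (auto simp: level_tests_def)

lemma level_testsI:
  assumes "is_test \<psi>" "0 < \<epsilon>" "1 - \<alpha> - \<delta> \<epsilon> \<le> gs.P.prob (accept_set \<epsilon> \<psi>)"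
  shows "\<psi> \<in> level_tests b \<alpha> \<delta> \<epsilon>"
  using assms type1_error_eq[of \<psi> \<epsilon> b] by (auto simp: level_tests_def)

lemma minimax_type2_error_le:
  "\<psi> \<in> level_tests b \<alpha> \<delta> \<epsilon> \<Longrightarrow> minimax_type2_error b \<epsilon> \<Theta> \<alpha> \<delta> \<le> type2_error b \<epsilon> \<Theta> \<psi>"
  unfolding minimax_type2_error_def
  by (rule cINF_lower) (auto intro!: bdd_belowI2[where m = 0] type2_error_nonneg)

lemma minimax_type2_error_ge:
  assumes "level_tests b \<alpha> \<delta> \<epsilon> \<noteq> {}" "\<And>\<psi>. \<psi> \<in> level_tests b \<alpha> \<delta> \<epsilon> \<Longrightarrow> m \<le> type2_error b \<epsilon> \<Theta> \<psi>"
  shows "m \<le> minimax_type2_error b \<epsilon> \<Theta> \<alpha> \<delta>"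
  unfolding minimax_type2_error_def using assms by (rule cINF_greatest)

context noise_level
begin

abbreviation "\<Psi> \<equiv> Psi_test a b R \<epsilon> r"
abbreviation "wmax \<equiv> max_weight a b R r"
abbreviation "chi \<equiv> gs.chi_sum supp w"
abbreviation "F x \<equiv> gs.P.prob {\<xi> \<in> space gs.G. chi \<xi> \<le> x}"
abbreviation "lr_par l \<equiv> 2 * u * w l"

lemma accept_set_Psi: "accept_set \<epsilon> (\<Psi> t) = {\<xi> \<in> space gs.G. chi \<xi> \<le> t}"
proof -
  have "test_statistic a b R \<epsilon> r (\<lambda>l\<in>Nstar. \<epsilon> * \<xi> l) = chi \<xi>" for \<xi>
    unfolding test_statistic_eq gs.chi_sum_def using supp eps_pos by (intro sum.cong) auto
  then show ?thesis by (auto simp: accept_set_def Psi_test_def)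
qed

lemma accept_set_Psi_shift:
  "{\<xi> \<in> space gs.G. (\<lambda>l\<in>Nstar. z l + \<xi> l) \<in> accept_set \<epsilon> (\<Psi> t)}
    = {\<xi> \<in> space gs.G. chi (\<lambda>l\<in>Nstar. z l + \<xi> l) \<le> t}"
  by (auto simp: accept_set_Psi space_PiM)

lemma sum_weight_shift_le: "(\<Sum>l\<in>supp. (w l)\<^sup>2 * (z l)\<^sup>2) \<le> wmax * (\<Sum>l\<in>supp. w l * (z l)\<^sup>2)"
proof -
  have "(\<Sum>l\<in>supp. (w l)\<^sup>2 * (z l)\<^sup>2) \<le> (\<Sum>l\<in>supp. wmax * (w l * (z l)\<^sup>2))"
  proof (rule sum_mono)
    fix l assume l: "l \<in> supp"
    have "w l * (w l * (z l)\<^sup>2) \<le> wmax * (w l * (z l)\<^sup>2)"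
      using weight_le_max[OF l] weight_nonneg[of l] by (intro mult_right_mono) auto
    then show "(w l)\<^sup>2 * (z l)\<^sup>2 \<le> wmax * (w l * (z l)\<^sup>2)" by (simp add: power2_eq_square mult.assoc)
  qed
  then show ?thesis by (simp add: sum_distrib_left)
qed

text \<open>The slack \<open>\<kappa> * (1 + h)\<close> grows with the mean \<open>h\<close> of the
  statistic. The linear part has variance at most \<open>4 * wmax * h\<close>, hence at most
  \<open>4 * wmax * (1 + h)\<^sup>2\<close>, and \<open>\<kappa> < 1\<close> keeps the shifted
  threshold decreasing in \<open>h\<close>, so that \<open>h = u\<close> is the worst case.\<close>

lemma type2_error_Psi_le:
  assumes \<kappa>: "0 < \<kappa>" "\<kappa> < 1"
  shows "type2_error b \<epsilon> (alternative a R r) (\<Psi> t) \<le> F (t - u + \<kappa> * (1 + u)) + 4 * wmax / \<kappa>\<^sup>2"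
proof (rule type2_error_le[OF is_test_Psi_test eps_pos])
  show "0 \<le> F (t - u + \<kappa> * (1 + u)) + 4 * wmax / \<kappa>\<^sup>2"
    using max_weight_nonneg by simp
  fix \<theta> assume \<theta>: "\<theta> \<in> alternative a R r"
  define h where "h = (\<Sum>l\<in>supp. w l * (shift \<theta> l)\<^sup>2)"
  have h: "u \<le> h" unfolding h_def by (rule mean_shift_ge[OF \<theta>])
  have h0: "0 < h" using h u_pos by linarith
  have \<eta>: "0 < \<kappa> * (1 + h)" using \<kappa> h0 by simp
  have "accept_prob b \<epsilon> \<theta> (\<Psi> t)
    = gs.P.prob {\<xi> \<in> space gs.G. chi (\<lambda>l\<in>Nstar. shift \<theta> l + \<xi> l) \<le> t}"
    unfolding accept_set_Psi_shift shift_def ..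
  also have "\<dots> \<le> F (t - h + \<kappa> * (1 + h)) + 4 * (\<Sum>l\<in>supp. (w l)\<^sup>2 * (shift \<theta> l)\<^sup>2) / (\<kappa> * (1 + h))\<^sup>2"
    unfolding h_def by (rule gs.prob_chi_sum_shift(1)[OF supp \<eta>[unfolded h_def]])
  also have "F (t - h + \<kappa> * (1 + h)) \<le> F (t - u + \<kappa> * (1 + u))"
  proof (rule gs.P.finite_measure_mono)
    have "(1 - \<kappa>) * u \<le> (1 - \<kappa>) * h" using h \<kappa> by (intro mult_left_mono) auto
    then have "t - h + \<kappa> * (1 + h) \<le> t - u + \<kappa> * (1 + u)" by (simp add: algebra_simps)
    then show "{\<xi> \<in> space gs.G. chi \<xi> \<le> t - h + \<kappa> * (1 + h)} \<subseteq> {\<xi> \<in> space gs.G. chi \<xi> \<le> t - u + \<kappa> * (1 + u)}"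
      by auto
    have [measurable]: "chi \<in> borel_measurable gs.G" using supp by measurable
    show "{\<xi> \<in> space gs.G. chi \<xi> \<le> t - u + \<kappa> * (1 + u)} \<in> sets gs.G" by measurable
  qed
  also have "4 * (\<Sum>l\<in>supp. (w l)\<^sup>2 * (shift \<theta> l)\<^sup>2) / (\<kappa> * (1 + h))\<^sup>2 \<le> 4 * wmax / \<kappa>\<^sup>2"
  proof -
    have "4 * (\<Sum>l\<in>supp. (w l)\<^sup>2 * (shift \<theta> l)\<^sup>2) \<le> 4 * (wmax * h)"
      using sum_weight_shift_le[of "shift \<theta>"] by (simp add: h_def)
    also have "\<dots> \<le> 4 * (wmax * (1 + h)\<^sup>2)"
      using h0 max_weight_nonneg by (intro mult_left_mono) (auto simp: power2_eq_square algebra_simps)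
    finally show ?thesis using \<kappa> h0 by (simp add: power_mult_distrib divide_le_eq)
  qed
  finally show "accept_prob b \<epsilon> \<theta> (\<Psi> t)
    \<le> F (t - u + \<kappa> * (1 + u)) + 4 * wmax / \<kappa>\<^sup>2" by simp
qed

text \<open>The distance \<open>h - c * u\<close> from the mean \<open>h\<close> to the threshold is
  at least \<open>(1 - c) * h\<close>, and the variance is at most \<open>1 + 4 * h\<close> because
  \<open>w l \<le> 1\<close>. The resulting Chebyshev bound decreases in \<open>h\<close>, so
  \<open>h = u\<close> is the worst case.\<close>

lemma type2_error_Psi_consistent:
  assumes c: "0 < c" "c < 1"
  shows "type2_error b \<epsilon> (alternative a R r) (\<Psi> (c * u)) \<le> (1 + 4 * u) / ((1 - c)\<^sup>2 * u\<^sup>2)"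
proof (rule type2_error_le[OF is_test_Psi_test eps_pos])
  show "0 \<le> (1 + 4 * u) / ((1 - c)\<^sup>2 * u\<^sup>2)" using u_pos by simp
  fix \<theta> assume \<theta>: "\<theta> \<in> alternative a R r"
  define h where "h = (\<Sum>l\<in>supp. w l * (shift \<theta> l)\<^sup>2)"
  have h: "u \<le> h" unfolding h_def by (rule mean_shift_ge[OF \<theta>])
  have cu: "c * u < u" "c * u \<le> c * h" using c u_pos h by auto
  have h0: "0 < h" using h u_pos by linarith
  have "accept_prob b \<epsilon> \<theta> (\<Psi> (c * u))
    = gs.P.prob {\<xi> \<in> space gs.G. chi (\<lambda>l\<in>Nstar. shift \<theta> l + \<xi> l) \<le> c * u}"
    unfolding accept_set_Psi_shift shift_def ..
  also have "\<dots> \<le> (2 * (\<Sum>l\<in>supp. (w l)\<^sup>2) + 4 * (\<Sum>l\<in>supp. (w l)\<^sup>2 * (shift \<theta> l)\<^sup>2)) / (h - c * u)\<^sup>2"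
    unfolding h_def using cu h by (intro gs.prob_chi_sum_shift_chebyshev[OF supp]) (simp add: h_def)
  also have "\<dots> \<le> (1 + 4 * h) / ((1 - c) * h)\<^sup>2"
  proof (rule frac_le)
    have "(\<Sum>l\<in>supp. (w l)\<^sup>2 * (shift \<theta> l)\<^sup>2) \<le> h"
      unfolding h_def
    proof (rule sum_mono)
      fix l assume l: "l \<in> supp"
      have "(w l)\<^sup>2 \<le> w l" using weight_le_1[OF l] weight_nonneg[of l] by (simp add: power2_eq_square mult_left_le)
      then show "(w l)\<^sup>2 * (shift \<theta> l)\<^sup>2 \<le> w l * (shift \<theta> l)\<^sup>2" by (rule mult_right_mono) simp
    qed
    then show "2 * (\<Sum>l\<in>supp. (w l)\<^sup>2) + 4 * (\<Sum>l\<in>supp. (w l)\<^sup>2 * (shift \<theta> l)\<^sup>2) \<le> 1 + 4 * h"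
      using sum_weight_sq by simp
    show "0 < ((1 - c) * h)\<^sup>2" using c h0 by simp
    show "((1 - c) * h)\<^sup>2 \<le> (h - c * u)\<^sup>2"
      using c h0 cu by (intro power_mono) (auto simp: algebra_simps)
    show "0 \<le> 1 + 4 * h" using h0 by simp
  qed
  also have "\<dots> \<le> (1 + 4 * u) / ((1 - c)\<^sup>2 * u\<^sup>2)"
  proof -
    have "(1 + 4 * h) / h\<^sup>2 \<le> (1 + 4 * u) / u\<^sup>2"
    proof -
      have "(1 + 4 * x) / x\<^sup>2 = (1 / x)\<^sup>2 + 4 * (1 / x)" if "0 < x" for x :: real
        using that by (simp add: field_simps power2_eq_square)
      moreover have "1 / h \<le> 1 / u" using h u_pos by (simp add: frac_le)
      ultimately show ?thesis using h0 u_pos by (simp add: add_mono power_mono)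
    qed
    then have "((1 + 4 * h) / h\<^sup>2) / (1 - c)\<^sup>2 \<le> ((1 + 4 * u) / u\<^sup>2) / (1 - c)\<^sup>2"
      by (rule divide_right_mono) simp
    then show ?thesis by (simp add: power_mult_distrib mult.commute)
  qed
  finally show "accept_prob b \<epsilon> \<theta> (\<Psi> (c * u))
    \<le> (1 + 4 * u) / ((1 - c)\<^sup>2 * u\<^sup>2)" .
qed

lemma lr_par_nonneg: "0 \<le> lr_par l"
  using u_pos weight_nonneg[of l] by simp

lemma sum_lr_par_sq: "(\<Sum>l\<in>supp. (lr_par l)\<^sup>2 / 2) = u\<^sup>2"
proof -
  have "(\<Sum>l\<in>supp. (lr_par l)\<^sup>2 / 2) = 2 * u\<^sup>2 * (\<Sum>l\<in>supp. (w l)\<^sup>2)"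
    unfolding sum_distrib_left by (intro sum.cong) (simp_all add: power_mult_distrib)
  then show ?thesis using sum_weight_sq by simp
qed

text \<open>Every sign change of the extremal solution is an alternative, so the Bayes risk under
  random signs is at most the maximal risk.\<close>

lemma mixture_le_type2_error:
  assumes t: "is_test \<psi>"
  shows "gs.P.expectation (\<lambda>\<xi>. gs.mixture_lr supp lr_par \<xi> * indicator (accept_set \<epsilon> \<psi>) \<xi>)
    \<le> type2_error b \<epsilon> (alternative a R r) \<psi>"
proof (rule gs.mixture_lr_le[OF supp lr_par_nonneg accept_set_measurable[OF t]])
  fix \<sigma> :: "('d \<Rightarrow> nat) \<Rightarrow> real" assume \<sigma>: "\<sigma> \<in> PiE supp (\<lambda>_. {-1, 1})"
  have "(\<lambda>k\<in>Nstar. gs.sign_shift supp lr_par \<sigma> k + \<xi> k) = (\<lambda>l\<in>Nstar. b l * sign_change \<sigma> l / \<epsilon> + \<xi> l)" for \<xi>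
    using shift_sign_change[of _ \<sigma>] by (auto simp: gs.sign_shift_def shift_def fun_eq_iff)
  then show "gs.P.prob {\<xi> \<in> space gs.G. (\<lambda>k\<in>Nstar. gs.sign_shift supp lr_par \<sigma> k + \<xi> k) \<in> accept_set \<epsilon> \<psi>}
    \<le> type2_error b \<epsilon> (alternative a R r) \<psi>"
    using type2_error_ge[OF t eps_pos sign_change_alternative[OF \<sigma>], of b] by simp
qed

lemma type2_error_ge_small_u:
  assumes t: "is_test \<psi>"
  shows "gs.P.prob (accept_set \<epsilon> \<psi>) - sqrt (exp (u\<^sup>2) - 1) \<le> type2_error b \<epsilon> (alternative a R r) \<psi>"
  using gs.mixture_lr_total_variation[of supp lr_par, OF supp lr_par_nonneg accept_set_measurable[OF t], of \<epsilon>]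
    mixture_le_type2_error[OF t] unfolding sum_lr_par_sq by simp

text \<open>The first two terms bound from below the probability that the threshold test accepts
  under the mixture. The root is the price of exchanging the likelihood ratios, and the last term
  that of a test which accepts less often than the threshold test under the null hypothesis.\<close>

lemma type2_error_ge_sharp:
  assumes t: "is_test \<psi>" and small: "2 * u * wmax \<le> 1 / 4" and \<eta>: "0 < \<eta>"
  shows "F (t - u - \<eta>) - 4 * wmax * u / \<eta>\<^sup>2
      - sqrt (exp (u\<^sup>2) * (exp (8 * u ^ 3 * wmax) - 1))
      - exp (u * t) * max 0 (F t - gs.P.prob (accept_set \<epsilon> \<psi>))
    \<le> type2_error b \<epsilon> (alternative a R r) \<psi>"
proof -
  let ?E = "\<lambda>A. gs.P.expectation (\<lambda>\<xi>. gs.mixture_lr supp lr_par \<xi> * indicator A \<xi>)"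
  let ?A = "accept_set \<epsilon> \<psi>" and ?B = "{\<xi> \<in> space gs.G. chi \<xi> \<le> t}"
  have [measurable]: "chi \<in> borel_measurable gs.G" using supp by measurable
  have B: "?B \<in> sets gs.G" by measurable
  have l4: "lr_par l \<le> 1 / 4" if "l \<in> supp" for l
  proof -
    have "2 * u * w l \<le> 2 * u * wmax" using weight_le_max[OF that] u_pos by (intro mult_left_mono) auto
    then show ?thesis using small by linarith
  qed
  have NP: "?E ?B - sqrt (exp (\<Sum>l\<in>supp. (lr_par l)\<^sup>2 / 2) * (exp (\<Sum>l\<in>supp. 2 * (lr_par l) ^ 3) - 1))
      - exp (u * t) * max 0 (F t - gs.P.prob ?A) \<le> ?E ?A"
    by (rule gs.mixture_lr_neyman_pearson[OF supp refl lr_par_nonneg l4 less_imp_le[OF u_pos] accept_set_measurable[OF t]])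
  \<comment> \<open>The constant is \<open>2 * 8\<close> times the bound \<open>wmax / 2\<close> for
    the sum of the cubes of the weights.\<close>
  have cube: "(\<Sum>l\<in>supp. 2 * (lr_par l) ^ 3) \<le> 8 * u ^ 3 * wmax"
  proof -
    have "(\<Sum>l\<in>supp. 2 * (lr_par l) ^ 3) \<le> (\<Sum>l\<in>supp. 16 * u ^ 3 * wmax * (w l)\<^sup>2)"
    proof (rule sum_mono)
      fix l assume l: "l \<in> supp"
      have "w l * (w l)\<^sup>2 \<le> wmax * (w l)\<^sup>2" using weight_le_max[OF l] by (intro mult_right_mono) auto
      then have "16 * u ^ 3 * (w l * (w l)\<^sup>2) \<le> 16 * u ^ 3 * (wmax * (w l)\<^sup>2)"
        using u_pos by (intro mult_left_mono) auto
      then show "2 * (lr_par l) ^ 3 \<le> 16 * u ^ 3 * wmax * (w l)\<^sup>2"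
        by (simp add: power_mult_distrib power3_eq_cube power2_eq_square mult.assoc mult.left_commute)
    qed
    then show ?thesis using sum_weight_sq by (simp flip: sum_distrib_left)
  qed
  have mean: "F (t - u - \<eta>) - 4 * wmax * u / \<eta>\<^sup>2 \<le> ?E ?B"
  proof (rule gs.mixture_lr_ge[OF supp lr_par_nonneg B])
    fix \<sigma> :: "('d \<Rightarrow> nat) \<Rightarrow> real" assume \<sigma>: "\<sigma> \<in> PiE supp (\<lambda>_. {-1, 1})"
    let ?z = "gs.sign_shift supp lr_par \<sigma>"
    have z2: "(?z l)\<^sup>2 = lr_par l" if "l \<in> supp" for l
    proof -
      have "\<sigma> l = - 1 \<or> \<sigma> l = 1" using \<sigma> that by auto
      then show ?thesis using lr_par_nonneg[of l] that by (auto simp: gs.sign_shift_def power_mult_distrib)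
    qed
    \<comment> \<open>The prior sits where the mean of the statistic attains its minimum
      \<open>u\<close> over the alternatives.\<close>
    have h: "(\<Sum>l\<in>supp. w l * (?z l)\<^sup>2) = u"
    proof -
      have "(\<Sum>l\<in>supp. w l * (?z l)\<^sup>2) = (\<Sum>l\<in>supp. 2 * u * (w l)\<^sup>2)"
      proof (intro sum.cong refl)
        fix l assume "l \<in> supp"
        then show "w l * (?z l)\<^sup>2 = 2 * u * (w l)\<^sup>2"
          unfolding z2[OF \<open>l \<in> supp\<close>] by (simp add: power2_eq_square)
      qed
      also have "\<dots> = u" using sum_weight_sq by (simp flip: sum_distrib_left)
      finally show ?thesis .
    qed
    have "F (t - u - \<eta>) - 4 * wmax * u / \<eta>\<^sup>2 \<le> F (t - u - \<eta>) - 4 * (\<Sum>l\<in>supp. (w l)\<^sup>2 * (?z l)\<^sup>2) / \<eta>\<^sup>2"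
      using sum_weight_shift_le[of ?z] unfolding h by (simp add: divide_right_mono)
    also have "\<dots> \<le> gs.P.prob {\<xi> \<in> space gs.G. chi (\<lambda>k\<in>Nstar. ?z k + \<xi> k) \<le> t}"
      using gs.prob_chi_sum_shift(2)[OF supp \<eta>, of w t ?z] unfolding h .
    also have "{\<xi> \<in> space gs.G. chi (\<lambda>k\<in>Nstar. ?z k + \<xi> k) \<le> t} = {\<xi> \<in> space gs.G. (\<lambda>k\<in>Nstar. ?z k + \<xi> k) \<in> ?B}"
      by (auto simp: space_PiM)
    finally show "F (t - u - \<eta>) - 4 * wmax * u / \<eta>\<^sup>2
      \<le> gs.P.prob {\<xi> \<in> space gs.G. (\<lambda>k\<in>Nstar. ?z k + \<xi> k) \<in> ?B}" .
  qed
  have "sqrt (exp (\<Sum>l\<in>supp. (lr_par l)\<^sup>2 / 2) * (exp (\<Sum>l\<in>supp. 2 * (lr_par l) ^ 3) - 1))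
    \<le> sqrt (exp (u\<^sup>2) * (exp (8 * u ^ 3 * wmax) - 1))"
    unfolding sum_lr_par_sq using cube by (intro real_sqrt_le_mono mult_left_mono) auto
  then show ?thesis using NP mean mixture_le_type2_error[OF t] by linarith
qed

end

section \<open>Asymptotics\<close>

lemma tendsto_zero_iff_eventually_le:
  "(f \<longlongrightarrow> (0::real)) F \<longleftrightarrow> (\<forall>e>0. \<forall>\<^sub>F x in F. \<bar>f x\<bar> \<le> e)"
proof
  assume f: "(f \<longlongrightarrow> 0) F"
  show "\<forall>e>0. \<forall>\<^sub>F x in F. \<bar>f x\<bar> \<le> e"
  proof (intro allI impI)
    fix e :: real assume "0 < e"
    from tendstoD[OF f this] show "\<forall>\<^sub>F x in F. \<bar>f x\<bar> \<le> e" by eventually_elim simp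
  qed
next
  assume *: "\<forall>e>0. \<forall>\<^sub>F x in F. \<bar>f x\<bar> \<le> e"
  show "(f \<longlongrightarrow> 0) F"
  proof (rule tendstoI)
    fix e :: real assume "0 < e"
    then have "0 < e / 2" by simp
    then have "\<forall>\<^sub>F x in F. \<bar>f x\<bar> \<le> e / 2" using * by blast
    then show "\<forall>\<^sub>F x in F. dist (f x) 0 < e" by eventually_elim (use \<open>0 < e\<close> in simp)
  qed
qed


context testing_model
begin

lemma noise_levelI:
  assumes "0 < \<epsilon>" "0 < r" "alternative a R r \<noteq> {}"
  shows "noise_level a b B R r \<epsilon>"
  using assms by unfold_locales

lemma alternative_nonempty: "extremal a b R \<epsilon> r \<noteq> \<infinity> \<Longrightarrow> alternative a R r \<noteq> {}"
  by (auto simp: extremal_def extremal_sq_def top_ereal_def)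

lemma noise_level_finite:
  assumes "0 < \<epsilon>" "0 < r" "extremal a b R \<epsilon> r \<le> ereal M"
  shows "noise_level a b B R r \<epsilon>"
  using assms by (intro noise_levelI alternative_nonempty[of \<epsilon>]) auto

end

lemma (in noise_level) F_close:
  assumes c: "gs.clt_bound TYPE('d) \<eta> \<kappa>" and le: "wmax \<le> \<kappa>"
  shows "\<bar>F x - Phi x\<bar> \<le> \<eta>"
proof -
  have "\<forall>k\<in>supp. 0 \<le> w k \<and> w k \<le> \<kappa>"
    using weight_nonneg weight_le_max le by (auto intro: order_trans)
  then show ?thesis
    using c supp sum_weight_sq unfolding gs.clt_bound_def by blast
qed

locale asymptotic_testing = testing_model a b B R
  for a b :: "('d::finite \<Rightarrow> nat) \<Rightarrow> real" and B R +
  fixes r :: "real \<Rightarrow> real" and \<alpha> :: real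
  assumes r_pos: "\<And>\<epsilon>. 0 < \<epsilon> \<Longrightarrow> 0 < r \<epsilon>" and \<alpha>: "0 < \<alpha>" "\<alpha> < 1"
begin

abbreviation "\<Theta> \<epsilon> \<equiv> alternative a R (r \<epsilon>)"
abbreviation "U \<epsilon> \<equiv> extremal a b R \<epsilon> (r \<epsilon>)"
abbreviation "u \<epsilon> \<equiv> real_of_ereal (U \<epsilon>)"
abbreviation "\<omega>0 \<epsilon> \<equiv> max_weight a b R (r \<epsilon>)"
abbreviation "\<Psi> \<epsilon> \<equiv> Psi_test a b R \<epsilon> (r \<epsilon>)"
abbreviation "H \<equiv> Phi_quantile (1 - \<alpha>)"

lemma Phi_H: "Phi H = 1 - \<alpha>"
  using \<alpha> by (intro Phi_quantile_eq) auto

lemma eventually_eps_pos: "\<forall>\<^sub>F \<epsilon> in at_right (0::real). 0 < \<epsilon>"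
  by (rule eventually_at_right_less)

lemma minimax_type2_error_ge_small_u:
  assumes U: "(U \<longlongrightarrow> 0) (at_right 0)" and \<delta>: "(\<delta> \<longlongrightarrow> 0) (at_right 0)" and e: "0 < e"
  shows "\<forall>\<^sub>F \<epsilon> in at_right 0. \<forall>\<psi>\<in>level_tests b \<alpha> \<delta> \<epsilon>. 1 - \<alpha> - e \<le> type2_error b \<epsilon> (\<Theta> \<epsilon>) \<psi>"
proof -
  have "((\<lambda>x::real. sqrt (exp (x\<^sup>2) - 1)) \<longlongrightarrow> sqrt (exp (0\<^sup>2) - 1)) (at_right 0)"
    by (intro tendsto_intros)
  then have "((\<lambda>x::real. sqrt (exp (x\<^sup>2) - 1)) \<longlongrightarrow> 0) (at_right 0)" by simp
  from order_tendstoD(2)[OF this, of "e / 2"] e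
  obtain m where m: "0 < m" "\<And>x. 0 < x \<Longrightarrow> x < m \<Longrightarrow> sqrt (exp (x\<^sup>2) - 1) < e / 2"
    by (auto simp: eventually_at_right_field)
  have "\<forall>\<^sub>F \<epsilon> in at_right 0. U \<epsilon> < ereal m"
    using order_tendstoD(2)[OF U, of "ereal m"] m(1) by simp
  moreover have "\<forall>\<^sub>F \<epsilon> in at_right 0. \<delta> \<epsilon> < e / 2"
    using order_tendstoD(2)[OF \<delta>, of "e / 2"] e by simp
  ultimately show ?thesis
    using eventually_eps_pos
  proof eventually_elim
    case (elim \<epsilon>)
    interpret nl: noise_level a b B R "r \<epsilon>" \<epsilon>
      using elim r_pos by (intro noise_level_finite[of _ _ m]) auto
    have um: "nl.u < m" using elim(1) by (simp add: nl.extremal_eq)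
    show ?case
    proof
      fix \<psi> assume \<psi>: "\<psi> \<in> level_tests b \<alpha> \<delta> \<epsilon>"
      have "gs.P.prob (accept_set \<epsilon> \<psi>) - sqrt (exp (nl.u\<^sup>2) - 1) \<le> type2_error b \<epsilon> (\<Theta> \<epsilon>) \<psi>"
        by (rule nl.type2_error_ge_small_u[OF level_testsD(1)[OF \<psi> elim(3)]])
      then show "1 - \<alpha> - e \<le> type2_error b \<epsilon> (\<Theta> \<epsilon>) \<psi>"
        using m(2)[OF nl.u_pos um] elim(2) level_testsD(2)[OF \<psi> elim(3)] by linarith
    qed
  qed
qed

text \<open>A coordinate \<open>l\<close> with \<open>a l\<close> large carries almost no signal, uniformly over the ellipsoid; a test
  based on it alone is the substitute for a randomised test that ignores the data.\<close>

lemma trivial_test: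
  assumes \<epsilon>: "0 < \<epsilon>" and \<eta>: "0 < \<eta>"
  obtains \<psi> where "is_test \<psi>" "gs.P.prob (accept_set \<epsilon> \<psi>) = Phi t"
    "type2_error b \<epsilon> (\<Theta> \<epsilon>) \<psi> \<le> Phi t + \<eta>"
proof -
  \<comment> \<open>By \<open>(a l)\<^sup>2 * (\<theta> l)\<^sup>2 \<le> R\<^sup>2\<close> and
    \<open>\<bar>b l\<bar> \<le> B\<close>, a weight \<open>(a l)\<^sup>2\<close> above
    \<open>K\<close> forces the shift \<open>b l * \<theta> l / \<epsilon>\<close> to be at most
    \<open>\<eta>\<close> in modulus.\<close>
  define K where "K = (B * R / (\<epsilon> * \<eta>))\<^sup>2"
  have "infinite (Nstar - {l \<in> Nstar. (a l)\<^sup>2 \<le> K} :: ('d \<Rightarrow> nat) set)"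
    using Nstar_infinite a_fin[of K] by (rule Diff_infinite_finite[rotated])
  then have "(Nstar - {l \<in> Nstar. (a l)\<^sup>2 \<le> K} :: ('d \<Rightarrow> nat) set) \<noteq> {}"
    by (rule infinite_imp_nonempty)
  then obtain l :: "'d \<Rightarrow> nat" where l: "l \<in> Nstar" "K < (a l)\<^sup>2" by force
  define \<psi> :: "(('d \<Rightarrow> nat) \<Rightarrow> real) \<Rightarrow> nat" where "\<psi> y = (if y l > \<epsilon> * t then 1 else 0)" for y
  have test: "is_test \<psi>"
  proof -
    have [measurable]: "(\<lambda>y. y l) \<in> borel_measurable obs_space"
      unfolding obs_space_def using l by (rule_tac measurable_component_singleton) auto
    show ?thesis unfolding is_test_def \<psi>_def[abs_def] by measurable
  qed
  have acc: "accept_set \<epsilon> \<psi> = {\<xi> \<in> space gs.G. \<xi> l \<le> t}"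
    using \<epsilon> l by (auto simp: accept_set_def \<psi>_def)
  have P: "gs.P.prob {\<xi> \<in> space gs.G. \<xi> l \<le> x} = Phi x" for x
  proof -
    have "Phi x = measure (distr gs.G borel (\<lambda>\<xi>. \<xi> l)) {..x}"
      unfolding Phi_eq gs.distr_coord[OF l(1)] ..
    also have "\<dots> = gs.P.prob {\<xi> \<in> space gs.G. \<xi> l \<le> x}"
      using gs.measurable_coord[OF l(1)] by (subst measure_distr) (auto intro!: arg_cong[where f = gs.P.prob])
    finally show ?thesis ..
  qed
  show ?thesis
  proof (rule that[OF test])
    show "gs.P.prob (accept_set \<epsilon> \<psi>) = Phi t" unfolding acc by (rule P)
    show "type2_error b \<epsilon> (\<Theta> \<epsilon>) \<psi> \<le> Phi t + \<eta>"
    proof (rule type2_error_le[OF test \<epsilon>])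
      show "0 \<le> Phi t + \<eta>" using \<eta> by (simp add: Phi_eq)
      fix \<theta> assume \<theta>: "\<theta> \<in> \<Theta> \<epsilon>"
      define z where "z = b l * \<theta> l / \<epsilon>"
      have z: "\<bar>z\<bar> \<le> \<eta>"
      proof -
        have sm: "(\<lambda>l. (a l)\<^sup>2 * (\<theta> l)\<^sup>2) summable_on Nstar" "(\<Sum>\<^sub>\<infinity>l\<in>Nstar. (a l)\<^sup>2 * (\<theta> l)\<^sup>2) \<le> R\<^sup>2"
          using \<theta> by (auto simp: alternative_def ellipsoid_def)
        have "(a l)\<^sup>2 * (\<theta> l)\<^sup>2 \<le> (\<Sum>\<^sub>\<infinity>l\<in>Nstar. (a l)\<^sup>2 * (\<theta> l)\<^sup>2)"
          using sm(1) l(1) by (intro le_infsum_of_member) auto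
        then have 1: "(a l)\<^sup>2 * (\<theta> l)\<^sup>2 \<le> R\<^sup>2" using sm(2) by simp
        have "(b l)\<^sup>2 \<le> B\<^sup>2" using power_mono[OF b_bounded[OF l(1)], of 2] by simp
        then have "(a l)\<^sup>2 * ((b l)\<^sup>2 * (\<theta> l)\<^sup>2) \<le> B\<^sup>2 * R\<^sup>2"
          using mult_mono[OF _ 1, of "(b l)\<^sup>2" "B\<^sup>2"] by (simp add: mult_ac)
        also have "\<dots> = K * (\<epsilon> * \<eta>)\<^sup>2" using \<epsilon> \<eta> by (simp add: K_def power_divide power_mult_distrib)
        also have "\<dots> \<le> (a l)\<^sup>2 * (\<epsilon> * \<eta>)\<^sup>2" using l by (intro mult_right_mono) auto
        finally have "(b l)\<^sup>2 * (\<theta> l)\<^sup>2 \<le> (\<epsilon> * \<eta>)\<^sup>2"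
          by (rule mult_left_le_imp_le) (use a_ge1[OF l(1)] in linarith)
        then have "(b l * \<theta> l)\<^sup>2 \<le> (\<epsilon> * \<eta>)\<^sup>2" by (simp add: power_mult_distrib)
        then have "\<bar>b l * \<theta> l\<bar> \<le> \<epsilon> * \<eta>" using \<epsilon> \<eta> abs_le_square_iff[of "b l * \<theta> l" "\<epsilon> * \<eta>"] by simp
        then show ?thesis using \<epsilon> by (simp add: z_def field_simps)
      qed
      have "{\<xi> \<in> space gs.G. (\<lambda>l\<in>Nstar. b l * \<theta> l / \<epsilon> + \<xi> l) \<in> accept_set \<epsilon> \<psi>} = {\<xi> \<in> space gs.G. \<xi> l \<le> t - z}"
        using l(1) by (auto simp: acc z_def observation_in_space_G)
      then have "accept_prob b \<epsilon> \<theta> \<psi> = Phi (t - z)"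
        by (simp add: P)
      also have "\<dots> \<le> Phi (t + \<eta>)" using z by (intro Phi_mono) auto
      also have "\<dots> \<le> Phi t + \<eta>" using Phi_lipschitz[of t "t + \<eta>"] \<eta> by simp
      finally show "accept_prob b \<epsilon> \<theta> \<psi> \<le> Phi t + \<eta>" .
    qed
  qed
qed

text \<open>Any fixed threshold above \<open>H\<close> has level \<open>\<alpha>\<close> with room
  to spare. Half of the gap absorbs a possibly negative \<open>\<delta>\<close>; the other half,
  \<open>m\<close>, is left for the error of the normal approximation.\<close>

lemma eventually_level:
  assumes \<delta>: "(\<delta> \<longlongrightarrow> 0) (at_right 0)" and t: "H < t"
  obtains m where "0 < m" "\<forall>\<^sub>F \<epsilon> in at_right 0. 1 - \<alpha> - \<delta> \<epsilon> \<le> Phi t - m"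
proof -
  define m where "m = (Phi t - Phi H) / 2"
  have m: "0 < m" using Phi_strict[OF t] by (simp add: m_def)
  have "\<forall>\<^sub>F \<epsilon> in at_right 0. - m < \<delta> \<epsilon>"
    using order_tendstoD(1)[OF \<delta>, of "- m"] m by simp
  then have "\<forall>\<^sub>F \<epsilon> in at_right 0. 1 - \<alpha> - \<delta> \<epsilon> \<le> Phi t - m"
  proof eventually_elim
    case (elim \<epsilon>)
    have "Phi t - m = 1 - \<alpha> + m" using Phi_H by (simp add: m_def field_simps)
    then show ?case using elim by linarith
  qed
  then show ?thesis using that m by blast
qed

text \<open>The lower bound holds for every test of the class; the upper bound is witnessed by a
  test on one uninformative coordinate, with \<open>e / 4\<close> lost in the threshold and
  \<open>e / 4\<close> in the residual signal.\<close>

lemma minimax_small_u: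
  assumes U: "(U \<longlongrightarrow> 0) (at_right 0)" and \<delta>: "(\<delta> \<longlongrightarrow> 0) (at_right 0)"
  shows "((\<lambda>\<epsilon>. minimax_type2_error b \<epsilon> (\<Theta> \<epsilon>) \<alpha> \<delta>) \<longlongrightarrow> 1 - \<alpha>) (at_right 0)"
proof (rule tendstoI)
  fix e :: real assume e: "0 < e"
  obtain m where m: "0 < m" "\<forall>\<^sub>F \<epsilon> in at_right 0. 1 - \<alpha> - \<delta> \<epsilon> \<le> Phi (H + e / 4) - m"
    using eventually_level[OF \<delta>, of "H + e / 4"] e by auto
  have lip: "Phi (H + e / 4) \<le> 1 - \<alpha> + e / 4"
    using Phi_lipschitz[of H "H + e / 4"] e Phi_H by simp
  have "0 < e / 2" using e by simp
  from minimax_type2_error_ge_small_u[OF U \<delta> this] m(2) eventually_eps_pos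
  show "\<forall>\<^sub>F \<epsilon> in at_right 0. dist (minimax_type2_error b \<epsilon> (\<Theta> \<epsilon>) \<alpha> \<delta>) (1 - \<alpha>) < e"
  proof eventually_elim
    case (elim \<epsilon>)
    have "0 < e / 4" using e by simp
    then obtain \<psi> where \<psi>: "is_test \<psi>" "gs.P.prob (accept_set \<epsilon> \<psi>) = Phi (H + e / 4)"
      "type2_error b \<epsilon> (\<Theta> \<epsilon>) \<psi> \<le> Phi (H + e / 4) + e / 4"
      using trivial_test[OF elim(3)] by metis
    have lev: "\<psi> \<in> level_tests b \<alpha> \<delta> \<epsilon>"
      using elim(2,3) \<psi>(1,2) m(1) by (intro level_testsI) auto
    have "minimax_type2_error b \<epsilon> (\<Theta> \<epsilon>) \<alpha> \<delta> \<le> type2_error b \<epsilon> (\<Theta> \<epsilon>) \<psi>"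
      by (rule minimax_type2_error_le[OF lev])
    moreover have "1 - \<alpha> - e / 2 \<le> minimax_type2_error b \<epsilon> (\<Theta> \<epsilon>) \<alpha> \<delta>"
      using lev elim(1) by (intro minimax_type2_error_ge) auto
    ultimately show ?case using \<psi>(3) lip e by (simp add: dist_real_def)
  qed
qed

lemma Psi_level_limit:
  assumes U: "\<forall>\<^sub>F \<epsilon> in at_right 0. U \<epsilon> \<le> ereal M" and \<omega>: "(\<omega>0 \<longlongrightarrow> 0) (at_right 0)" and e: "0 < e"
  shows "\<forall>\<^sub>F \<epsilon> in at_right 0. \<bar>gs.P.prob (accept_set \<epsilon> (\<Psi> \<epsilon> t)) - Phi t\<bar> \<le> e"
proof -
  obtain \<kappa> where \<kappa>: "0 < \<kappa>" "gs.clt_bound TYPE('d) e \<kappa>"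
    using gs.chi_sum_clt[OF e] by auto
  from order_tendstoD(2)[OF \<omega> \<kappa>(1)] U eventually_eps_pos show ?thesis
  proof eventually_elim
    case (elim \<epsilon>)
    interpret nl: noise_level a b B R "r \<epsilon>" \<epsilon>
      using elim r_pos by (intro noise_level_finite[of _ _ M]) auto
    show ?case unfolding nl.accept_set_Psi using elim(1) by (intro nl.F_close[OF \<kappa>(2)]) auto
  qed
qed

lemma type2_error_Psi_upper:
  assumes U: "\<forall>\<^sub>F \<epsilon> in at_right 0. U \<epsilon> \<le> ereal M" and \<omega>: "(\<omega>0 \<longlongrightarrow> 0) (at_right 0)" and e: "0 < e"
  shows "\<forall>\<^sub>F \<epsilon> in at_right 0. type2_error b \<epsilon> (\<Theta> \<epsilon>) (\<Psi> \<epsilon> t) \<le> Phi (t - u \<epsilon>) + e"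
proof -
  \<comment> \<open>The slack \<open>k * (1 + u \<epsilon>)\<close> is at most \<open>e / 3\<close>
    since \<open>u \<epsilon> \<le> \<bar>M\<bar>\<close>; the other two thirds go to the normal
    approximation and to the linear part.\<close>
  define k where "k = min (1 / 2) (e / (3 * (1 + \<bar>M\<bar>)))"
  have k: "0 < k" "k < 1" using e by (auto simp: k_def min_less_iff_disj)
  have "k \<le> e / (3 * (1 + \<bar>M\<bar>))" by (simp add: k_def)
  then have kM: "k * (1 + \<bar>M\<bar>) \<le> e / 3" by (simp add: field_simps)
  obtain \<kappa> where \<kappa>: "0 < \<kappa>" "gs.clt_bound TYPE('d) (e / 3) \<kappa>"
    using gs.chi_sum_clt[of "e / 3"] e by auto
  \<comment> \<open>Weights below this value make
    \<open>4 * \<omega>0 \<epsilon> / k\<^sup>2\<close> at most \<open>e / 3\<close>.\<close>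
  have "0 < e * k\<^sup>2 / 12" using e k by simp
  from order_tendstoD(2)[OF \<omega> this] order_tendstoD(2)[OF \<omega> \<kappa>(1)] U eventually_eps_pos show ?thesis
  proof eventually_elim
    case (elim \<epsilon>)
    interpret nl: noise_level a b B R "r \<epsilon>" \<epsilon>
      using elim r_pos by (intro noise_level_finite[of _ _ M]) auto
    have uM: "nl.u \<le> \<bar>M\<bar>" using elim(3) by (simp add: nl.extremal_eq)
    have "type2_error b \<epsilon> (\<Theta> \<epsilon>) (\<Psi> \<epsilon> t) \<le> nl.F (t - nl.u + k * (1 + nl.u)) + 4 * \<omega>0 \<epsilon> / k\<^sup>2"
      by (rule nl.type2_error_Psi_le[OF k])
    moreover have "\<bar>nl.F (t - nl.u + k * (1 + nl.u)) - Phi (t - nl.u + k * (1 + nl.u))\<bar> \<le> e / 3"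
      using elim(2) by (intro nl.F_close[OF \<kappa>(2)]) auto
    moreover have "4 * \<omega>0 \<epsilon> / k\<^sup>2 \<le> e / 3"
      using elim(1) k by (simp add: field_simps)
    moreover have "Phi (t - nl.u + k * (1 + nl.u)) - Phi (t - nl.u) \<le> k * (1 + nl.u)"
      using Phi_lipschitz[of "t - nl.u" "t - nl.u + k * (1 + nl.u)"] k nl.u_pos by simp
    moreover have "k * (1 + nl.u) \<le> k * (1 + \<bar>M\<bar>)" using k uM by (intro mult_left_mono) auto
    ultimately have "type2_error b \<epsilon> (\<Theta> \<epsilon>) (\<Psi> \<epsilon> t) \<le> Phi (t - nl.u) + e" using kM by linarith
    then show ?case by (simp add: nl.extremal_eq)
  qed
qed

lemma type2_error_lower:
  assumes U: "\<forall>\<^sub>F \<epsilon> in at_right 0. U \<epsilon> \<le> ereal M" and \<omega>: "(\<omega>0 \<longlongrightarrow> 0) (at_right 0)"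
    and \<delta>: "(\<delta> \<longlongrightarrow> 0) (at_right 0)" and e: "0 < e"
  shows "\<forall>\<^sub>F \<epsilon> in at_right 0. \<forall>\<psi>\<in>level_tests b \<alpha> \<delta> \<epsilon>. Phi (H - u \<epsilon>) - e \<le> type2_error b \<epsilon> (\<Theta> \<epsilon>) \<psi>"
proof -
  define N where "N = \<bar>M\<bar> + 1"
  have N: "0 < N" by (simp add: N_def)
  \<comment> \<open>Bounds the critical value \<open>exp (u \<epsilon> * H)\<close> uniformly in
    \<open>\<epsilon>\<close>, whatever the sign of \<open>H\<close>.\<close>
  define c where "c = exp (N * \<bar>H\<bar>)"
  have c: "1 \<le> c" using N by (simp add: c_def)
  \<comment> \<open>Five errors share \<open>e\<close>: linear part, exchange of likelihood ratios,
    level mismatch, normal approximation, and the displacement of the argument of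
    \<open>Phi\<close>.\<close>
  define \<eta> where "\<eta> = e / 5"
  \<comment> \<open>The level mismatch, at most \<open>2 * \<eta>'\<close> from the normal
    approximation and \<open>\<delta>\<close> together, is multiplied by \<open>c\<close> and has to
    stay below \<open>\<eta>\<close>.\<close>
  define \<eta>' where "\<eta>' = e / (10 * c)"
  have \<eta>: "0 < \<eta>" "0 < \<eta>'" "\<eta>' \<le> \<eta>"
    using e c divide_left_mono[of 5 "10 * c" e] by (auto simp: \<eta>_def \<eta>'_def)
  obtain \<kappa> where \<kappa>: "0 < \<kappa>" "gs.clt_bound TYPE('d) \<eta>' \<kappa>"
    using gs.chi_sum_clt[OF \<eta>(2)] by auto
  \<comment> \<open>The three constraints yield the normal approximation, likelihood parameters at
    most \<open>1 / 4\<close>, and a probability at most \<open>\<eta>\<close> for a large linear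
    part.\<close>
  define \<kappa>' where "\<kappa>' = min \<kappa> (min (1 / (8 * N)) (\<eta> * \<eta>\<^sup>2 / (4 * N)))"
  have \<kappa>': "0 < \<kappa>'" using \<kappa>(1) N \<eta> by (simp add: \<kappa>'_def)
  have "((\<lambda>\<epsilon>. sqrt (exp (N\<^sup>2) * (exp (8 * N ^ 3 * \<omega>0 \<epsilon>) - 1))) \<longlongrightarrow> sqrt (exp (N\<^sup>2) * (exp (8 * N ^ 3 * 0) - 1))) (at_right 0)"
    by (intro tendsto_intros \<omega>)
  then have "((\<lambda>\<epsilon>. sqrt (exp (N\<^sup>2) * (exp (8 * N ^ 3 * \<omega>0 \<epsilon>) - 1))) \<longlongrightarrow> 0) (at_right 0)" by simp
  from order_tendstoD(2)[OF this \<eta>(1)] order_tendstoD(2)[OF \<delta> \<eta>(2)] order_tendstoD(2)[OF \<omega> \<kappa>'] U eventually_eps_pos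
  show ?thesis
  proof eventually_elim
    case (elim \<epsilon>)
    interpret nl: noise_level a b B R "r \<epsilon>" \<epsilon>
      using elim r_pos by (intro noise_level_finite[of _ _ M]) auto
    have uN: "nl.u \<le> N" using elim(4) by (simp add: nl.extremal_eq N_def)
    note u0 = nl.u_pos
    note w0 = nl.max_weight_nonneg
    have w: "\<omega>0 \<epsilon> \<le> \<kappa>" "\<omega>0 \<epsilon> \<le> 1 / (8 * N)" "\<omega>0 \<epsilon> \<le> \<eta> * \<eta>\<^sup>2 / (4 * N)"
      using elim(3) by (auto simp: \<kappa>'_def)
    have clt: "\<bar>nl.F x - Phi x\<bar> \<le> \<eta>'" for x
      using w(1) by (intro nl.F_close[OF \<kappa>(2)]) auto
    have small: "2 * nl.u * \<omega>0 \<epsilon> \<le> 1 / 4"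
    proof -
      have "2 * nl.u * \<omega>0 \<epsilon> \<le> 2 * N * (1 / (8 * N))" using uN w(2) u0 w0 N by (intro mult_mono) auto
      then show ?thesis using N by simp
    qed
    have var: "4 * \<omega>0 \<epsilon> * nl.u / \<eta>\<^sup>2 \<le> \<eta>"
    proof -
      have "4 * \<omega>0 \<epsilon> * nl.u \<le> 4 * (\<eta> * \<eta>\<^sup>2 / (4 * N)) * N" using uN w(3) u0 w0 N \<eta> by (intro mult_mono) auto
      then show ?thesis using N \<eta> by (simp add: divide_le_eq)
    qed
    have chi: "sqrt (exp (nl.u\<^sup>2) * (exp (8 * nl.u ^ 3 * \<omega>0 \<epsilon>) - 1)) \<le> sqrt (exp (N\<^sup>2) * (exp (8 * N ^ 3 * \<omega>0 \<epsilon>) - 1))"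
    proof (intro real_sqrt_le_mono mult_mono diff_right_mono)
      show "exp (nl.u\<^sup>2) \<le> exp (N\<^sup>2)" using uN u0 by (simp add: power_mono)
      show "exp (8 * nl.u ^ 3 * \<omega>0 \<epsilon>) \<le> exp (8 * N ^ 3 * \<omega>0 \<epsilon>)"
        using uN u0 w0 by (simp add: power_mono mult_right_mono)
    qed (use u0 w0 in auto)
    have expc: "exp (nl.u * H) \<le> c"
    proof -
      have "nl.u * H \<le> nl.u * \<bar>H\<bar>" using u0 by (intro mult_left_mono) auto
      also have "\<dots> \<le> N * \<bar>H\<bar>" using uN by (intro mult_right_mono) auto
      finally show ?thesis by (simp add: c_def)
    qed
    have lip: "Phi (H - nl.u) - Phi (H - nl.u - \<eta>) \<le> \<eta>"
      using Phi_lipschitz[of "H - nl.u - \<eta>" "H - nl.u"] \<eta> by simp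
    show ?case
    proof
      fix \<psi> assume \<psi>: "\<psi> \<in> level_tests b \<alpha> \<delta> \<epsilon>"
      note lev = level_testsD[OF \<psi> elim(5)]
      have "exp (nl.u * H) * max 0 (nl.F H - gs.P.prob (accept_set \<epsilon> \<psi>)) \<le> c * (2 * \<eta>')"
      proof (intro mult_mono expc)
        show "max 0 (nl.F H - gs.P.prob (accept_set \<epsilon> \<psi>)) \<le> 2 * \<eta>'"
          using clt[of H] lev(2) elim(2) \<eta> Phi_H by auto
      qed (use c in auto)
      also have "\<dots> = \<eta>" using c by (simp add: \<eta>_def \<eta>'_def)
      finally have np: "exp (nl.u * H) * max 0 (nl.F H - gs.P.prob (accept_set \<epsilon> \<psi>)) \<le> \<eta>" .
      have "nl.F (H - nl.u - \<eta>) - 4 * \<omega>0 \<epsilon> * nl.u / \<eta>\<^sup>2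
          - sqrt (exp (nl.u\<^sup>2) * (exp (8 * nl.u ^ 3 * \<omega>0 \<epsilon>) - 1))
          - exp (nl.u * H) * max 0 (nl.F H - gs.P.prob (accept_set \<epsilon> \<psi>)) \<le> type2_error b \<epsilon> (\<Theta> \<epsilon>) \<psi>"
        by (rule nl.type2_error_ge_sharp[OF lev(1) small \<eta>(1)])
      moreover have "Phi (H - nl.u - \<eta>) - \<eta> \<le> nl.F (H - nl.u - \<eta>)"
        using clt[of "H - nl.u - \<eta>"] \<eta> by auto
      moreover have "e = 5 * \<eta>" by (simp add: \<eta>_def)
      ultimately have "Phi (H - nl.u) - e \<le> type2_error b \<epsilon> (\<Theta> \<epsilon>) \<psi>"
        using var chi np lip elim(1) by linarith
      then show "Phi (H - u \<epsilon>) - e \<le> type2_error b \<epsilon> (\<Theta> \<epsilon>) \<psi>" by (simp add: nl.extremal_eq)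
    qed
  qed
qed

text \<open>The upper bound uses the threshold \<open>H + e / 2\<close>, which eventually meets the
  level condition for any admissible \<open>\<delta>\<close> and costs at most \<open>e / 2\<close>
  in \<open>Phi\<close>.\<close>

lemma minimax_bounds:
  assumes U: "\<forall>\<^sub>F \<epsilon> in at_right 0. U \<epsilon> \<le> ereal M" and \<omega>: "(\<omega>0 \<longlongrightarrow> 0) (at_right 0)"
    and \<delta>: "(\<delta> \<longlongrightarrow> 0) (at_right 0)" and e: "0 < e"
  shows "\<forall>\<^sub>F \<epsilon> in at_right 0. \<bar>minimax_type2_error b \<epsilon> (\<Theta> \<epsilon>) \<alpha> \<delta> - Phi (H - u \<epsilon>)\<bar> \<le> e"
proof -
  obtain m where m: "0 < m" "\<forall>\<^sub>F \<epsilon> in at_right 0. 1 - \<alpha> - \<delta> \<epsilon> \<le> Phi (H + e / 2) - m"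
    using eventually_level[OF \<delta>, of "H + e / 2"] e by auto
  have "0 < e / 2" using e by simp
  from type2_error_Psi_upper[OF U \<omega> this, of "H + e / 2"] type2_error_lower[OF U \<omega> \<delta> e]
    Psi_level_limit[OF U \<omega> m(1), of "H + e / 2"] m(2) eventually_eps_pos
  show ?thesis
  proof eventually_elim
    case (elim \<epsilon>)
    have lev: "\<Psi> \<epsilon> (H + e / 2) \<in> level_tests b \<alpha> \<delta> \<epsilon>"
      using elim(3,4) by (intro level_testsI is_test_Psi_test elim(5)) auto
    have "minimax_type2_error b \<epsilon> (\<Theta> \<epsilon>) \<alpha> \<delta> \<le> type2_error b \<epsilon> (\<Theta> \<epsilon>) (\<Psi> \<epsilon> (H + e / 2))"
      by (rule minimax_type2_error_le[OF lev])
    moreover have "Phi (H - u \<epsilon>) - e \<le> minimax_type2_error b \<epsilon> (\<Theta> \<epsilon>) \<alpha> \<delta>"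
      using lev elim(2) by (intro minimax_type2_error_ge) auto
    moreover have "Phi (H + e / 2 - u \<epsilon>) - Phi (H - u \<epsilon>) \<le> e / 2"
      using Phi_lipschitz[of "H - u \<epsilon>" "H + e / 2 - u \<epsilon>"] e by simp
    ultimately show ?case using elim(1) by linarith
  qed
qed

lemma minimax_sharp:
  assumes U: "\<forall>\<^sub>F \<epsilon> in at_right 0. U \<epsilon> \<le> ereal M" and \<omega>: "(\<omega>0 \<longlongrightarrow> 0) (at_right 0)"
    and \<delta>: "(\<delta> \<longlongrightarrow> 0) (at_right 0)"
  shows "((\<lambda>\<epsilon>. minimax_type2_error b \<epsilon> (\<Theta> \<epsilon>) \<alpha> \<delta> - Phi (H - u \<epsilon>)) \<longlongrightarrow> 0) (at_right 0)"
  unfolding tendsto_zero_iff_eventually_le using minimax_bounds[OF U \<omega> \<delta>] by blast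

lemma Psi_asymp_level:
  assumes U: "\<forall>\<^sub>F \<epsilon> in at_right 0. U \<epsilon> \<le> ereal M" and \<omega>: "(\<omega>0 \<longlongrightarrow> 0) (at_right 0)"
  shows "asymp_level_test b \<alpha> (\<lambda>\<epsilon>. \<Psi> \<epsilon> H)"
  unfolding asymp_level_test_def
proof (intro exI conjI allI impI)
  \<comment> \<open>The remainder is read off from the test itself, so membership is immediate for
    every \<open>\<epsilon> > 0\<close>, including those with an empty alternative.\<close>
  let ?\<delta> = "\<lambda>\<epsilon>. \<bar>1 - \<alpha> - gs.P.prob (accept_set \<epsilon> (\<Psi> \<epsilon> H))\<bar>"
  show "(?\<delta> \<longlongrightarrow> 0) (at_right 0)"
    unfolding tendsto_zero_iff_eventually_le
  proof (intro allI impI)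
    fix e :: real assume "0 < e"
    from Psi_level_limit[OF U \<omega> this, of H]
    show "\<forall>\<^sub>F \<epsilon> in at_right 0. \<bar>?\<delta> \<epsilon>\<bar> \<le> e" by eventually_elim (use Phi_H in simp)
  qed
  fix \<epsilon> :: real assume "0 < \<epsilon>"
  then show "\<Psi> \<epsilon> H \<in> level_tests b \<alpha> ?\<delta> \<epsilon>" by (intro level_testsI is_test_Psi_test) auto
qed

lemma Psi_asymptotically_minimax:
  assumes U: "\<forall>\<^sub>F \<epsilon> in at_right 0. U \<epsilon> \<le> ereal M" and \<omega>: "(\<omega>0 \<longlongrightarrow> 0) (at_right 0)"
    and \<delta>: "(\<delta> \<longlongrightarrow> 0) (at_right 0)"
  shows "((\<lambda>\<epsilon>. type2_error b \<epsilon> (\<Theta> \<epsilon>) (\<Psi> \<epsilon> H) - minimax_type2_error b \<epsilon> (\<Theta> \<epsilon>) \<alpha> \<delta>) \<longlongrightarrow> 0) (at_right 0)"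
  unfolding tendsto_zero_iff_eventually_le
proof (intro allI impI)
  fix e :: real assume e: "0 < e"
  \<comment> \<open>The threshold test may violate the level condition for the given
    \<open>\<delta>\<close>, so the lower bound is applied to it with its own remainder
    \<open>\<delta>'\<close>; for both remainders the value is \<open>Phi (H - u \<epsilon>)\<close>
    up to \<open>o(1)\<close>.\<close>
  obtain \<delta>' where \<delta>': "(\<delta>' \<longlongrightarrow> 0) (at_right 0)" "\<And>\<epsilon>. 0 < \<epsilon> \<Longrightarrow> \<Psi> \<epsilon> H \<in> level_tests b \<alpha> \<delta>' \<epsilon>"
    using Psi_asymp_level[OF U \<omega>] unfolding asymp_level_test_def by metis
  have "0 < e / 2" using e by simp
  from type2_error_Psi_upper[OF U \<omega> this, of H] type2_error_lower[OF U \<omega> \<delta>'(1) this]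
    minimax_bounds[OF U \<omega> \<delta> this] eventually_eps_pos
  show "\<forall>\<^sub>F \<epsilon> in at_right 0. \<bar>type2_error b \<epsilon> (\<Theta> \<epsilon>) (\<Psi> \<epsilon> H) - minimax_type2_error b \<epsilon> (\<Theta> \<epsilon>) \<alpha> \<delta>\<bar> \<le> e"
  proof eventually_elim
    case (elim \<epsilon>)
    have "Phi (H - u \<epsilon>) - e / 2 \<le> type2_error b \<epsilon> (\<Theta> \<epsilon>) (\<Psi> \<epsilon> H)"
      using elim(2) \<delta>'(2)[OF elim(4)] by blast
    then show ?case using elim(1,3) by linarith
  qed
qed

lemma Psi_consistent:
  assumes U: "(U \<longlongrightarrow> \<infinity>) (at_right 0)" and c: "0 < c" "c < 1"
  shows "((\<lambda>\<epsilon>. type2_error b \<epsilon> (\<Theta> \<epsilon>) (\<Psi> \<epsilon> (c * u \<epsilon>))) \<longlongrightarrow> 0) (at_right 0)"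
  unfolding tendsto_zero_iff_eventually_le
proof (intro allI impI)
  fix e :: real assume e: "0 < e"
  \<comment> \<open>\<open>u \<epsilon> > 1\<close> gives
    \<open>1 + 4 * u \<epsilon> \<le> 5 * u \<epsilon>\<close>, and the second entry brings the
    remaining \<open>5 / ((1 - c)\<^sup>2 * u \<epsilon>)\<close> below \<open>e\<close>.\<close>
  define K where "K = max 1 (5 / ((1 - c)\<^sup>2 * e))"
  have "\<forall>\<^sub>F \<epsilon> in at_right 0. ereal K < U \<epsilon>"
    using order_tendstoD(1)[OF U, of "ereal K"] by simp
  with eventually_eps_pos
  show "\<forall>\<^sub>F \<epsilon> in at_right 0. \<bar>type2_error b \<epsilon> (\<Theta> \<epsilon>) (\<Psi> \<epsilon> (c * u \<epsilon>))\<bar> \<le> e"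
  proof eventually_elim
    case (elim \<epsilon>)
    have "type2_error b \<epsilon> (\<Theta> \<epsilon>) (\<Psi> \<epsilon> (c * u \<epsilon>)) \<le> e"
    \<comment> \<open>An empty alternative has \<open>U \<epsilon> = \<infinity>\<close> and is
      compatible with divergence of \<open>U\<close>; the supremum defining the error is 0
      there.\<close>
    proof (cases "\<Theta> \<epsilon> = {}")
      case True
      then show ?thesis using e by (simp add: type2_error_def)
    next
      case False
      then interpret nl: noise_level a b B R "r \<epsilon>" \<epsilon>
        using elim r_pos by (intro noise_levelI) auto
      have uK: "1 < nl.u" "5 / ((1 - c)\<^sup>2 * e) < nl.u" using elim(2) by (auto simp: nl.extremal_eq K_def)
      have c2: "0 < (1 - c)\<^sup>2" using c by simp
      have "type2_error b \<epsilon> (\<Theta> \<epsilon>) (\<Psi> \<epsilon> (c * u \<epsilon>)) \<le> (1 + 4 * nl.u) / ((1 - c)\<^sup>2 * nl.u\<^sup>2)"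
        using nl.type2_error_Psi_consistent[OF c] by (simp add: nl.extremal_eq)
      also have "\<dots> \<le> (5 * nl.u) / ((1 - c)\<^sup>2 * nl.u\<^sup>2)"
        using uK by (intro divide_right_mono) auto
      also have "\<dots> = 5 / ((1 - c)\<^sup>2 * nl.u)" using uK c2 by (simp add: power2_eq_square)
      also have "\<dots> \<le> e" using uK c2 e by (simp add: field_simps)
      finally show ?thesis .
    qed
    then show ?case using type2_error_nonneg[of b \<epsilon> "\<Theta> \<epsilon>" "\<Psi> \<epsilon> (c * u \<epsilon>)"] by simp
  qed
qed

end



theorem theorem1:
  fixes a b :: "('d::finite \<Rightarrow> nat) \<Rightarrow> real"
    and R \<alpha> H :: real
    and r :: "real \<Rightarrow> real"
    and \<Theta> :: "real \<Rightarrow> (('d \<Rightarrow> nat) \<Rightarrow> real) set"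
    and u :: "real \<Rightarrow> ereal"
    and \<omega>0 :: "real \<Rightarrow> real"
    and \<Psi> :: "real \<Rightarrow> real \<Rightarrow> (('d \<Rightarrow> nat) \<Rightarrow> real) \<Rightarrow> nat"
  assumes "0 < R"
    and "mildly_ill_posed b \<or> severely_ill_posed b"
    and "sobolev_type a \<or> tensor_product_type a"
    and "\<And>\<epsilon>. 0 < \<epsilon> \<Longrightarrow> 0 < r \<epsilon>"
    and "0 < \<alpha>" and "\<alpha> < 1"
  defines "H \<equiv> Phi_quantile (1 - \<alpha>)"
    and "\<Theta> \<equiv> \<lambda>\<epsilon>. alternative a R (r \<epsilon>)"
    and "u \<equiv> \<lambda>\<epsilon>. extremal a b R \<epsilon> (r \<epsilon>)"
    and "\<omega>0 \<equiv> \<lambda>\<epsilon>. max_weight a b R (r \<epsilon>)"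
    and "\<Psi> \<equiv> \<lambda>\<epsilon> t. Psi_test a b R \<epsilon> (r \<epsilon>) t"
  shows "((u \<longlongrightarrow> 0) (at_right 0) \<longrightarrow>
           (\<forall>\<delta>. (\<delta> \<longlongrightarrow> 0) (at_right 0) \<longrightarrow>
              ((\<lambda>\<epsilon>. minimax_type2_error b \<epsilon> (\<Theta> \<epsilon>) \<alpha> \<delta>) \<longlongrightarrow> 1 - \<alpha>) (at_right 0)))
       \<and> ((\<exists>M::real. \<forall>\<^sub>F \<epsilon> in at_right 0. u \<epsilon> \<le> ereal M) \<and> (\<omega>0 \<longlongrightarrow> 0) (at_right 0) \<longrightarrow>
           asymp_level_test b \<alpha> (\<lambda>\<epsilon>. \<Psi> \<epsilon> H) \<and>
           (\<forall>\<delta>. (\<delta> \<longlongrightarrow> 0) (at_right 0) \<longrightarrow>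
              ((\<lambda>\<epsilon>. type2_error b \<epsilon> (\<Theta> \<epsilon>) (\<Psi> \<epsilon> H)
                     - minimax_type2_error b \<epsilon> (\<Theta> \<epsilon>) \<alpha> \<delta>) \<longlongrightarrow> 0) (at_right 0) \<and>
              ((\<lambda>\<epsilon>. minimax_type2_error b \<epsilon> (\<Theta> \<epsilon>) \<alpha> \<delta>
                     - Phi (H - real_of_ereal (u \<epsilon>))) \<longlongrightarrow> 0) (at_right 0)))
       \<and> ((u \<longlongrightarrow> \<infinity>) (at_right 0) \<longrightarrow>
           (\<forall>c. 0 < c \<and> c < 1 \<longrightarrow>
              (\<forall>\<epsilon>>0. is_test (\<Psi> \<epsilon> (c * real_of_ereal (u \<epsilon>)))) \<and>
              ((\<lambda>\<epsilon>. type2_error b \<epsilon> (\<Theta> \<epsilon>) (\<Psi> \<epsilon> (c * real_of_ereal (u \<epsilon>)))) \<longlongrightarrow> 0)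
                (at_right 0)))"
proof -
  obtain B where b: "\<And>l. l \<in> Nstar \<Longrightarrow> b l \<noteq> 0" "\<And>l. l \<in> Nstar \<Longrightarrow> \<bar>b l\<bar> \<le> B"
    using ill_posed_bounded[OF assms(2)] by blast
  interpret asymptotic_testing a b B R r \<alpha>
    using b sobolev_or_tensor_coercive[OF assms(3)] assms(4-6) by unfold_locales auto
  show ?thesis
    unfolding H_def \<Theta>_def u_def \<omega>0_def \<Psi>_def
    using minimax_small_u Psi_asymp_level Psi_asymptotically_minimax minimax_sharp Psi_consistent
      is_test_Psi_test by blast
qed

end
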